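(* Let $\mathbb{G}$ be a homogeneous Carnot group with sub-Laplacian $\mathcal{L}$, and let $\Omega\subset\mathbb{G}$ be a nonempty bounded open connected subset. Then the Dirichlet sub-Laplacian $\mathcal{L}_{\Omega}$, as a self-adjoint operator on $L^{2}(\Omega,dx)$, has a pure point spectrum, i.e. its spectrum consists only of eigenvalues: $\sigma(\mathcal{L}_{\Omega})=\sigma_{pp}(\mathcal{L}_{\Omega})$.
   Context: Group. $\mathbb{G}=(\mathbb{R}^{N},\star)$ is a homogeneous Carnot group: a connected, simply connected Lie group whose Lie algebra is stratified, $\mathfrak{g}=V_{1}\oplus\cdots\oplus V_{r}$ with $[V_{1},V_{i-1}]=V_{i}$ for $2\leqslant i\leqslant r$ and $[V_{1},V_{r}]=\{0\}$, identified with $\mathbb{R}^{N}$ through exponential coordinates of the first kind with respect to a basis of $\mathfrak{g}$ adapted to the stratification (the first $d_{1}$ vectors form a basis of $V_{1}$, the next $d_{2}$ a basis of $V_{2}$, and so on; $d_{i}=\dim V_{i}$, $N=\sum_{i}d_{i}$). Standing assumptions: $N\geqslant 3$ (hence $d_{1}\geqslant 2$) and $r\geqslant 2$. The measure $dx$ is Lebesgue measure on $\mathbb{R}^{N}$, which is a bi-invariant Haar measure. Topological notions and boundedness are those of $\mathbb{R}^{N}$. Sub-Laplacian. $V_{1}$ carries a fixed inner product, $X_{1},\dots,X_{d_{1}}$ is an orthonormal basis of $V_{1}$ viewed as left-invariant vector fields on $\mathbb{G}$, and $\mathcal{L}=\sum_{j=1}^{d_{1}}X_{j}^{2}$. Dirichlet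 form. $\mathcal{E}(f,g)=\int_{\mathbb{G}}\sum_{j=1}^{d_{1}}X_{j}f\,X_{j}g\,dx$, $\mathcal{E}(f)=\mathcal{E}(f,f)$, with domain $\mathcal{D}_{\mathcal{E}}=W^{1}_{2}(\mathbb{G})=\{f\in L^{2}(\mathbb{G},dx): X_{i}f\in L^{2}(\mathbb{G},dx),\ i=1,\dots,d_{1}\}$ (distributional derivatives) and norm $\|f\|^{2}_{W^{1}_{2}}=\mathcal{E}(f)+\|f\|^{2}_{L^{2}}$. For a bounded open connected set $\Omega$, $\mathcal{D}_{\mathcal{E}}(\Omega)$ is the closure in $W^{1}_{2}(\mathbb{G})$ of $\{f\in\mathcal{D}_{\mathcal{E}}:\operatorname{supp}f\subset\Omega\}$. Then $(\mathcal{E},\mathcal{D}_{\mathcal{E}}(\Omega))$ is a regular Dirichlet form on $L^{2}(\Omega,dx)$, and $-\mathcal{L}_{\Omega}$ is the associated non-negative self-adjoint operator on $L^{2}(\Omega,dx)$. $\sigma$ denotes the spectrum and $\sigma_{pp}$ the point spectrum (set of eigenvalues). *)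

theory Defs
  imports "HOL-Analysis.Analysis"
begin

primrec Ck :: "nat \<Rightarrow> ('a::real_normed_vector \<Rightarrow> 'b::real_normed_vector) \<Rightarrow> bool" where
  "Ck 0 f \<longleftrightarrow> continuous_on UNIV f"
| "Ck (Suc k) f \<longleftrightarrow> (\<forall>x. f differentiable (at x)) \<and> (\<forall>v. Ck k (\<lambda>x. frechet_derivative f (at x) v))"

text \<open>Only used on finite-dimensional domains, where \<open>Ck k\<close> (all iterated directional derivatives
  up to order \<open>k\<close> exist and are continuous) is the usual class of \<open>k\<close> times continuously
  differentiable maps.\<close>

definition C_infinity :: "('a::real_normed_vector \<Rightarrow> 'b::real_normed_vector) \<Rightarrow> bool" where
  "C_infinity f \<longleftrightarrow> (\<forall>k. Ck k f)"

text \<open>The left-invariant vector field whose value at the identity \<open>0\<close> is \<open>v\<close>.\<close>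

definition left_inv_field ::
    "(real^'n \<Rightarrow> real^'n \<Rightarrow> real^'n) \<Rightarrow> real^'n \<Rightarrow> real^'n \<Rightarrow> real^'n" where
  "left_inv_field star v x = frechet_derivative (star x) (at 0) v"

definition vf_bracket :: "(real^'n \<Rightarrow> real^'n) \<Rightarrow> (real^'n \<Rightarrow> real^'n) \<Rightarrow> real^'n \<Rightarrow> real^'n" where
  "vf_bracket X Y x = frechet_derivative Y (at x) (X x) - frechet_derivative X (at x) (Y x)"

text \<open>The Lie algebra of left-invariant vector fields is identified with the tangent space
  \<open>real^'n\<close> at the identity, by evaluation at \<open>0\<close>.\<close>

definition lie_bracket ::
    "(real^'n \<Rightarrow> real^'n \<Rightarrow> real^'n) \<Rightarrow> real^'n \<Rightarrow> real^'n \<Rightarrow> real^'n" where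
  "lie_bracket star v w = vf_bracket (left_inv_field star v) (left_inv_field star w) 0"

text \<open>The basis adapted to the stratification is the standard basis of \<open>real^'n\<close>; \<open>wt j\<close> is the
  number of the layer to which the \<open>j\<close>-th basis vector belongs.\<close>

definition layer :: "('n::finite \<Rightarrow> nat) \<Rightarrow> nat \<Rightarrow> (real^'n) set" where
  "layer wt i = span {axis j 1 | j. wt j = i}"

text \<open>In exponential coordinates of the first kind a point \<open>x\<close> is the exponential of the Lie algebra
  element \<open>x\<close>. Equivalently, \<open>\<lambda>t. t *\<^sub>R x\<close> is the one-parameter subgroup with initial velocity
  \<open>x\<close>, which is the assumption \<open>exp_coordinates\<close>.\<close>

locale homogeneous_carnot_group = group star "0 :: real^'n" ginv
  for star :: "real^'n \<Rightarrow> real^'n \<Rightarrow> real^'n" and ginv :: "real^'n \<Rightarrow> real^'n" +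
  fixes wt :: "'n \<Rightarrow> nat" and r :: nat
  assumes dim_ge_3: "CARD('n) \<ge> 3"
    and step_ge_2: "r \<ge> 2"
    and smooth_star: "C_infinity (\<lambda>(x, y). star x y)"
    and smooth_inv: "C_infinity ginv"
    and exp_coordinates: "star (s *\<^sub>R x) (t *\<^sub>R x) = (s + t) *\<^sub>R x"
    and layers: "range wt = {1..r}"
    and generates: "2 \<le> i \<Longrightarrow> i \<le> r \<Longrightarrow>
      span {lie_bracket star v w | v w. v \<in> layer wt 1 \<and> w \<in> layer wt (i - 1)} = layer wt i"
    and terminates: "v \<in> layer wt 1 \<Longrightarrow> w \<in> layer wt r \<Longrightarrow> lie_bracket star v w = 0"

definition inner_product_on :: "'a::real_vector set \<Rightarrow> ('a \<Rightarrow> 'a \<Rightarrow> real) \<Rightarrow> bool" where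
  "inner_product_on V ip \<longleftrightarrow>
    (\<forall>u\<in>V. \<forall>v\<in>V. ip u v = ip v u) \<and>
    (\<forall>u\<in>V. \<forall>v\<in>V. \<forall>w\<in>V. \<forall>a b. ip (a *\<^sub>R u + b *\<^sub>R v) w = a * ip u w + b * ip v w) \<and>
    (\<forall>u\<in>V. u \<noteq> 0 \<longrightarrow> ip u u > 0)"

definition orthonormal_basis_of :: "'a::real_vector set \<Rightarrow> ('a \<Rightarrow> 'a \<Rightarrow> real) \<Rightarrow> 'a set \<Rightarrow> bool" where
  "orthonormal_basis_of V ip B \<longleftrightarrow>
    B \<subseteq> V \<and> independent B \<and> span B = V \<and> (\<forall>u\<in>B. \<forall>v\<in>B. ip u v = (if u = v then 1 else 0))"

text \<open>Elements of \<open>L\<^sup>2\<close> are represented by functions, to be compared up to almost everywhere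
  equality.\<close>

definition L2 :: "'a measure \<Rightarrow> ('a \<Rightarrow> 'b::euclidean_space) set" where
  "L2 M = {f \<in> borel_measurable M. integrable M (\<lambda>x. (norm (f x))\<^sup>2)}"

definition L2norm :: "'a measure \<Rightarrow> ('a \<Rightarrow> 'b::euclidean_space) \<Rightarrow> real" where
  "L2norm M f = sqrt (\<integral>x. (norm (f x))\<^sup>2 \<partial>M)"

definition test_function :: "(real^'n \<Rightarrow> real) \<Rightarrow> bool" where
  "test_function \<phi> \<longleftrightarrow> C_infinity \<phi> \<and> compact (closure {x. \<phi> x \<noteq> 0})"

definition lie_derivative ::
    "(real^'n \<Rightarrow> real^'n \<Rightarrow> real^'n) \<Rightarrow> real^'n \<Rightarrow> (real^'n \<Rightarrow> real) \<Rightarrow> real^'n \<Rightarrow> real" where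
  "lie_derivative star v \<phi> x = frechet_derivative \<phi> (at x) (left_inv_field star v x)"

text \<open>\<open>g\<close> is the distributional derivative of \<open>f\<close> along the left-invariant field of \<open>v\<close>. The
  formal adjoint of that field is its negative, since Lebesgue measure is right-invariant.\<close>

definition has_distr_derivative ::
    "(real^'n \<Rightarrow> real^'n \<Rightarrow> real^'n) \<Rightarrow> real^'n \<Rightarrow> (real^'n \<Rightarrow> real) \<Rightarrow> (real^'n \<Rightarrow> real) \<Rightarrow> bool" where
  "has_distr_derivative star v f g \<longleftrightarrow>
    (\<forall>\<phi>. test_function \<phi> \<longrightarrow>
      (\<integral>x. f x * lie_derivative star v \<phi> x \<partial>lborel) = - (\<integral>x. g x * \<phi> x \<partial>lborel))"

text \<open>Below, \<open>B\<close> is the set of values at \<open>0\<close> of the orthonormal basis \<open>X\<^sub>1, X\<^sub>2, \<dots>\<close> of the first layer.\<close>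

definition W12 ::
    "(real^'n \<Rightarrow> real^'n \<Rightarrow> real^'n) \<Rightarrow> (real^'n) set \<Rightarrow> (real^'n \<Rightarrow> real) set" where
  "W12 star B = {f \<in> L2 lborel. \<forall>v\<in>B. \<exists>g\<in>L2 lborel. has_distr_derivative star v f g}"

text \<open>The choice is unique up to almost everywhere equality.\<close>

definition distr_derivative ::
    "(real^'n \<Rightarrow> real^'n \<Rightarrow> real^'n) \<Rightarrow> real^'n \<Rightarrow> (real^'n \<Rightarrow> real) \<Rightarrow> real^'n \<Rightarrow> real" where
  "distr_derivative star v f = (SOME g. g \<in> L2 lborel \<and> has_distr_derivative star v f g)"

definition dirichlet_form ::
    "(real^'n \<Rightarrow> real^'n \<Rightarrow> real^'n) \<Rightarrow> (real^'n) set \<Rightarrow> (real^'n \<Rightarrow> real) \<Rightarrow> (real^'n \<Rightarrow> real) \<Rightarrow> real" where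
  "dirichlet_form star B f g =
    (\<integral>x. (\<Sum>v\<in>B. distr_derivative star v f x * distr_derivative star v g x) \<partial>lborel)"

definition W12_norm ::
    "(real^'n \<Rightarrow> real^'n \<Rightarrow> real^'n) \<Rightarrow> (real^'n) set \<Rightarrow> (real^'n \<Rightarrow> real) \<Rightarrow> real" where
  "W12_norm star B f = sqrt (dirichlet_form star B f f + (L2norm lborel f)\<^sup>2)"

definition ess_support :: "(real^'n \<Rightarrow> real) \<Rightarrow> (real^'n) set" where
  "ess_support f = - \<Union>{U. open U \<and> (AE x in lborel. x \<in> U \<longrightarrow> f x = 0)}"

definition dirichlet_domain ::
    "(real^'n \<Rightarrow> real^'n \<Rightarrow> real^'n) \<Rightarrow> (real^'n) set \<Rightarrow> (real^'n) set \<Rightarrow> (real^'n \<Rightarrow> real) set" where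
  "dirichlet_domain star B \<Omega> =
    {f \<in> W12 star B. \<forall>\<epsilon>>0. \<exists>g\<in>W12 star B.
       ess_support g \<subseteq> \<Omega> \<and> W12_norm star B (\<lambda>x. f x - g x) < \<epsilon>}"

text \<open>Operators on \<open>L\<^sup>2\<close> are represented by their graphs, as sets of pairs of functions. The
  non-negative operator \<open>A\<close> associated with the form \<open>E\<close> on \<open>D\<close> has as its domain those \<open>f \<in> D\<close> for
  which some \<open>g \<in> L\<^sup>2(\<Omega>)\<close> satisfies \<open>E(f, h) = (g, h)\<close> for all \<open>h \<in> D\<close>, and then \<open>A f = g\<close>.
  Elements of \<open>L\<^sup>2(\<Omega>)\<close> are functions on the whole space whose values off \<open>\<Omega>\<close> are disregarded.\<close>

definition neg_dirichlet_sub_laplacian ::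
    "(real^'n \<Rightarrow> real^'n \<Rightarrow> real^'n) \<Rightarrow> (real^'n) set \<Rightarrow> (real^'n) set
      \<Rightarrow> ((real^'n \<Rightarrow> real) \<times> (real^'n \<Rightarrow> real)) set" where
  "neg_dirichlet_sub_laplacian star B \<Omega> =
    {(f, g). f \<in> dirichlet_domain star B \<Omega> \<and> g \<in> L2 (restrict_space lborel \<Omega>) \<and>
       (\<forall>h\<in>dirichlet_domain star B \<Omega>.
          dirichlet_form star B f h = (\<integral>x. g x * h x \<partial>restrict_space lborel \<Omega>))}"

definition dirichlet_sub_laplacian ::
    "(real^'n \<Rightarrow> real^'n \<Rightarrow> real^'n) \<Rightarrow> (real^'n) set \<Rightarrow> (real^'n) set
      \<Rightarrow> ((real^'n \<Rightarrow> real) \<times> (real^'n \<Rightarrow> real)) set" where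
  "dirichlet_sub_laplacian star B \<Omega> =
    {(f, \<lambda>x. - g x) | f g. (f, g) \<in> neg_dirichlet_sub_laplacian star B \<Omega>}"

text \<open>The spectrum of an operator on a real \<open>L\<^sup>2\<close> space is, as usual, that of its
  complexification.\<close>

definition complexification ::
    "(('a \<Rightarrow> real) \<times> ('a \<Rightarrow> real)) set \<Rightarrow> (('a \<Rightarrow> complex) \<times> ('a \<Rightarrow> complex)) set" where
  "complexification T = {(f, g). (Re \<circ> f, Re \<circ> g) \<in> T \<and> (Im \<circ> f, Im \<circ> g) \<in> T}"

definition resolvent_set ::
    "'a measure \<Rightarrow> (('a \<Rightarrow> complex) \<times> ('a \<Rightarrow> complex)) set \<Rightarrow> complex set" where
  "resolvent_set M T = {z.
    (\<forall>(f, g)\<in>T. (AE x in M. g x - z * f x = 0) \<longrightarrow> (AE x in M. f x = 0)) \<and>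
    (\<forall>u\<in>L2 M. \<exists>(f, g)\<in>T. AE x in M. g x - z * f x = u x) \<and>
    (\<exists>C. \<forall>(f, g)\<in>T. L2norm M f \<le> C * L2norm M (\<lambda>x. g x - z * f x))}"

definition spectrum ::
    "'a measure \<Rightarrow> (('a \<Rightarrow> complex) \<times> ('a \<Rightarrow> complex)) set \<Rightarrow> complex set" where
  "spectrum M T = - resolvent_set M T"

definition point_spectrum ::
    "'a measure \<Rightarrow> (('a \<Rightarrow> complex) \<times> ('a \<Rightarrow> complex)) set \<Rightarrow> complex set" where
  "point_spectrum M T =
    {z. \<exists>(f, g)\<in>T. \<not> (AE x in M. f x = 0) \<and> (AE x in M. g x = z * f x)}"

end

(*
  The resolvent set is governed by a complex Fredholm alternative, so everything rests on the compact
  embedding of the form domain into L^2. If f vanishes outside a bounded set and X_v f is in L^2 for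
  the horizontal v, then pairing f with the translates of a test function along exp(t v) shows that f
  is nearly invariant under small horizontal right translations, uniformly on the unit ball of the form
  domain. Elements that nearly fix the unit ball are stable under products and inverses. Commutators of
  horizontal curves follow the Lie brackets, so by the stratification there is a nearly fixing curve in
  every coordinate direction, and by Brouwer their products cover a neighbourhood of the identity.
  Averaging f over small right translations is an operator with continuous kernel, hence the L^2 norm
  of f is bounded by a small multiple of its energy plus finitely many linear functionals of f.

  Lebesgue measure is never shown to be a Haar measure: supports are bounded, so locally bounded
  Jacobians of the translations suffice.

  For the Fredholm alternative, the complexified form is complex symmetric, and its real part is a
  symmetric real form on pairs. It is bounded below once it is injective, and Riesz for the inner
  product (L f, L h), with L the operator of that form, gives surjectivity.
*)

theory Submission
  imports Defs "HOL-Library.Function_Algebras"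
begin

section \<open>Smooth functions and cutoffs\<close>

text \<open>The resolvent set is given by three clauses on a complexified graph, so the absence of
  an eigenvalue has to be turned into injectivity, surjectivity and a bound, without any spectral
  theorem. Compactness is therefore carried as an inequality with finitely many functionals:
  Bolzano-Weierstrass for finitely many real sequences then replaces weak convergence. The obstacle
  in the embedding is that only horizontal derivatives are available, and these only against test
  functions. Hence near invariance is a dual statement, with the translation acting on the test
  vector. It is required for every \<open>L2\<close> vector, because composing translations produces
  non-smooth test vectors and because at the end f itself is the test vector. No rate is tracked
  through the commutators: smallness is a filter, and each bracket costs only a first-order limit.
  Elements of the function spaces are functions, not classes, so inner products are semidefinite and
  weak derivatives are linear only almost everywhere.\<close>

lemma Ck_SucI:
  assumes "\<And>x. (f has_derivative f' x) (at x)" and "\<And>v. Ck k (\<lambda>x. f' x v)"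
  shows "Ck (Suc k) f"
proof -
  have "frechet_derivative f (at x) = f' x" for x
    using frechet_derivative_at[OF assms(1)[of x]] by simp
  then show ?thesis
    using assms by (auto simp: differentiable_def)
qed

lemma Ck_SucD:
  assumes "Ck (Suc k) f"
  shows "(f has_derivative frechet_derivative f (at x)) (at x)"
    and "Ck k (\<lambda>x. frechet_derivative f (at x) v)"
  using assms by (auto simp: frechet_derivative_works)

lemma Ck_continuous: "Ck k f \<Longrightarrow> continuous_on UNIV f"
  by (cases k) (auto simp: continuous_on_eq_continuous_within differentiable_imp_continuous_within)

lemma Ck_Suc_imp: "Ck (Suc k) f \<Longrightarrow> Ck k f"
proof (induction k arbitrary: f)
  case 0
  then show ?case using Ck_continuous[of "Suc 0" f] by simp
next
  case (Suc k)
  then show ?case by (metis Ck.simps(2))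
qed

lemma Ck_const: "Ck k (\<lambda>x. a)"
proof (induction k arbitrary: a)
  case (Suc k)
  show ?case by (rule Ck_SucI[where f' = "\<lambda>x v. 0"]) (auto intro: Suc.IH)
qed auto

lemma (in bounded_linear) Ck_compose:
  assumes "Ck k g" shows "Ck k (\<lambda>x. f (g x))"
  using assms
proof (induction k arbitrary: g)
  case 0
  then show ?case by (auto intro: continuous_on)
next
  case (Suc k)
  show ?case
    by (rule Ck_SucI[where f' = "\<lambda>x v. f (frechet_derivative g (at x) v)"])
      (use Ck_SucD[OF Suc.prems] Suc.IH in \<open>auto intro: has_derivative\<close>)
qed

lemma Ck_ident: "Ck k (\<lambda>x. x)"
proof (cases k)
  case (Suc j)
  show ?thesis unfolding Suc
    by (rule Ck_SucI[where f' = "\<lambda>x v. v"]) (auto intro: Ck_const)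
qed simp

lemma Ck_add:
  assumes "Ck k f" "Ck k g" shows "Ck k (\<lambda>x. f x + g x)"
  using assms
proof (induction k arbitrary: f g)
  case (Suc k)
  show ?case
    by (rule Ck_SucI[where f' = "\<lambda>x v. frechet_derivative f (at x) v + frechet_derivative g (at x) v"])
      (use Ck_SucD[OF Suc.prems(1)] Ck_SucD[OF Suc.prems(2)] Suc.IH in \<open>auto intro: has_derivative_add\<close>)
qed (auto intro: continuous_on_add)

lemma Ck_sum: "(\<And>i. i \<in> I \<Longrightarrow> Ck k (f i)) \<Longrightarrow> Ck k (\<lambda>x. \<Sum>i\<in>I. f i x)"
  by (induction I rule: infinite_finite_induct) (auto intro: Ck_const Ck_add)

lemma (in bounded_bilinear) Ck_compose2:
  assumes "Ck k f" "Ck k g" shows "Ck k (\<lambda>x. prod (f x) (g x))"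
  using assms
proof (induction k arbitrary: f g)
  case 0
  then show ?case by (auto intro: continuous_on)
next
  case (Suc k)
  have "Ck k f" "Ck k g" using Suc.prems Ck_Suc_imp by auto
  then show ?case
    by (intro Ck_SucI[where f' = "\<lambda>x v. prod (f x) (frechet_derivative g (at x) v) +
          prod (frechet_derivative f (at x) v) (g x)"])
      (use Ck_SucD[OF Suc.prems(1)] Ck_SucD[OF Suc.prems(2)] Suc.IH in \<open>auto intro: FDERIV Ck_add\<close>)
qed

lemmas Ck_scaleR = bounded_bilinear.Ck_compose2[OF bounded_bilinear_scaleR]
lemmas Ck_mult = bounded_bilinear.Ck_compose2[OF bounded_bilinear_mult]
lemmas Ck_inner = bounded_bilinear.Ck_compose2[OF bounded_bilinear_inner]

lemma Ck_prod:
  fixes f :: "'i \<Rightarrow> 'a::real_normed_vector \<Rightarrow> real"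
  shows "(\<And>i. i \<in> I \<Longrightarrow> Ck k (f i)) \<Longrightarrow> Ck k (\<lambda>x. \<Prod>i\<in>I. f i x)"
  by (induction I rule: infinite_finite_induct) (auto intro: Ck_const Ck_mult)

text \<open>\<open>Ck\<close> speaks of derivatives in constant directions, whereas the chain rule
  evaluates the derivative of \<open>f\<close> in the moving direction given by the derivative of
  \<open>g\<close>. Expanding that direction in a basis leaves sums of products covered by the
  induction hypothesis; hence the Euclidean middle space.\<close>

lemma Ck_comp:
  fixes f :: "'b::euclidean_space \<Rightarrow> 'c::real_normed_vector" and g :: "'a::real_normed_vector \<Rightarrow> 'b"
  assumes "Ck k f" "Ck k g" shows "Ck k (\<lambda>x. f (g x))"
  using assms
proof (induction k arbitrary: f g)
  case 0
  then show ?case by (auto intro: continuous_on_compose2)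
next
  case (Suc k)
  note f = Ck_SucD[OF Suc.prems(1)] and g = Ck_SucD[OF Suc.prems(2)]
  have eq: "frechet_derivative f (at (g x)) (frechet_derivative g (at x) v) =
      (\<Sum>b\<in>Basis. (frechet_derivative g (at x) v \<bullet> b) *\<^sub>R frechet_derivative f (at (g x)) b)" for x v
  proof -
    interpret bounded_linear "frechet_derivative f (at (g x))"
      using f(1) by (rule has_derivative_bounded_linear)
    show ?thesis by (subst euclidean_representation[symmetric, of "frechet_derivative g (at x) v"])
        (simp add: sum scaleR del: euclidean_representation)
  qed
  show ?case
  proof (rule Ck_SucI)
    show "((\<lambda>x. f (g x)) has_derivative (\<lambda>v. frechet_derivative f (at (g x)) (frechet_derivative g (at x) v))) (at x)" for x
      by (rule has_derivative_compose[OF g(1) f(1)])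
    show "Ck k (\<lambda>x. frechet_derivative f (at (g x)) (frechet_derivative g (at x) v))" for v
      unfolding eq
      by (intro Ck_sum Ck_scaleR Ck_inner Ck_const Suc.IH f(2) g(2) Ck_Suc_imp[OF Suc.prems(2)])
  qed
qed

lemma Ck_Pair: "Ck k f \<Longrightarrow> Ck k g \<Longrightarrow> Ck k (\<lambda>x. (f x, g x))"
  using Ck_add[OF bounded_linear.Ck_compose[of "\<lambda>a. (a, 0)"] bounded_linear.Ck_compose[of "\<lambda>a. (0, a)"]]
  by (fastforce intro: bounded_linear_Pair bounded_linear_zero bounded_linear_ident)

section \<open>Functions that are flat at the origin, and smooth cutoffs built from them\<close>

definition flat_exp :: "real poly \<Rightarrow> real \<Rightarrow> real" where
  "flat_exp p t = (if t > 0 then poly p (1 / t) * exp (- 1 / t) else 0)"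

lemma poly_over_exp_tendsto_0: "((\<lambda>s::real. poly p s / exp s) \<longlongrightarrow> 0) at_top"
proof -
  have "((\<lambda>s. \<Sum>i\<le>degree p. coeff p i * (s ^ i / exp s)) \<longlongrightarrow> (\<Sum>i\<le>degree p. coeff p i * 0)) at_top"
    by (intro tendsto_intros tendsto_power_div_exp_0)
  then show ?thesis by (simp add: poly_altdef sum_divide_distrib)
qed

text \<open>The functions p(1/t) exp(-1/t), extended by zero, are closed under differentiation:
  p(1/t) has derivative -p'(1/t)/t^2 and exp(-1/t) has derivative exp(-1/t)/t^2, so p becomes X^2 (p
  - p'). Carrying the polynomial along lets smoothness follow by one induction on the order.\<close>

lemma flat_exp_has_derivative:
  "(flat_exp p has_field_derivative flat_exp ([:0, 0, 1:] * (p - pderiv p)) t) (at t)"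
proof -
  consider "t > 0" | "t < 0" | "t = 0" by linarith
  then show ?thesis
  proof cases
    case 1
    have "((\<lambda>t. poly p (1 / t) * exp (- 1 / t)) has_field_derivative
        flat_exp ([:0, 0, 1:] * (p - pderiv p)) t) (at t)"
      using 1 by (auto intro!: derivative_eq_intros simp: flat_exp_def field_simps power2_eq_square)
    then show ?thesis
      by (rule DERIV_cong_ev[THEN iffD1, rotated 3])
        (use 1 eventually_nhds_in_open[of "{0<..}" t] in \<open>auto elim!: eventually_mono simp: flat_exp_def\<close>)
  next
    case 2
    have "((\<lambda>t. 0) has_field_derivative flat_exp ([:0, 0, 1:] * (p - pderiv p)) t) (at t)"
      using 2 by (auto simp: flat_exp_def)
    then show ?thesis
      by (rule DERIV_cong_ev[THEN iffD1, rotated 3])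
        (use 2 eventually_nhds_in_open[of "{..<0}" t] in \<open>auto elim!: eventually_mono simp: flat_exp_def\<close>)
  next
    case 3
    \<comment> \<open>With s = 1/h the difference quotient at 0 is s p(s) / exp s; this is the extra
      factor \<open>[:0, 1:]\<close>.\<close>
    have right: "((\<lambda>h. flat_exp p h / h) \<longlongrightarrow> 0) (at_right 0)"
    proof (rule Lim_transform_eventually)
      have "filterlim (\<lambda>h::real. 1 / h) at_top (at_right 0)"
        using filterlim_inverse_at_top_right by (simp add: inverse_eq_divide)
      from filterlim_compose[OF poly_over_exp_tendsto_0[of "[:0, 1:] * p"] this]
      show "((\<lambda>h. poly ([:0, 1:] * p) (1 / h) / exp (1 / h)) \<longlongrightarrow> 0) (at_right 0)" .
      show "\<forall>\<^sub>F h in at_right 0. poly ([:0, 1:] * p) (1 / h) / exp (1 / h) = flat_exp p h / h"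
        using eventually_at_right_less[of "0::real"]
        by eventually_elim (auto simp: flat_exp_def exp_minus field_simps)
    qed
    have left: "((\<lambda>h. flat_exp p h / h) \<longlongrightarrow> 0) (at_left 0)"
    proof (rule Lim_transform_eventually[OF tendsto_const])
      show "\<forall>\<^sub>F h in at_left 0. 0 = flat_exp p h / h"
        using eventually_at_left_real[of "-1" "0::real"] by (auto elim!: eventually_mono simp: flat_exp_def)
    qed
    have "((\<lambda>h. flat_exp p h / h) \<longlongrightarrow> 0) (at 0)"
      using left right by (simp add: filterlim_split_at)
    then show ?thesis using 3 by (simp add: DERIV_def flat_exp_def)
  qed
qed

lemma Ck_flat_exp: "Ck k (flat_exp p)"
proof (induction k arbitrary: p)
  case 0
  show ?case
    using DERIV_isCont[OF flat_exp_has_derivative] by (simp add: continuous_on_eq_continuous_within)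
next
  case (Suc k)
  show ?case
  proof (rule Ck_SucI)
    show "(flat_exp p has_derivative (\<lambda>v. flat_exp ([:0, 0, 1:] * (p - pderiv p)) t * v)) (at t)" for t
      using flat_exp_has_derivative[of p t] unfolding has_field_derivative_def .
  qed (intro Ck_mult Ck_const Suc.IH)
qed

definition bump :: "real \<Rightarrow> real" where "bump t = flat_exp 1 t"

lemma bump_eq: "bump t = (if t > 0 then exp (- 1 / t) else 0)"
  by (simp add: bump_def flat_exp_def)

lemma bump_bounds: "0 \<le> bump t" "bump t \<le> 1"
  by (auto simp: bump_eq)

lemma bump_mono: "s \<le> t \<Longrightarrow> bump s \<le> bump t"
  by (auto simp: bump_eq field_simps)

lemma Ck_bump: "Ck k f \<Longrightarrow> Ck k (\<lambda>x. bump (f x))"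
  unfolding bump_def by (rule Ck_comp[OF Ck_flat_exp])

lemma test_functionI:
  assumes "\<And>k. Ck k f" and "bounded S" and "\<And>x. x \<notin> S \<Longrightarrow> f x = 0"
  shows "test_function f"
proof -
  have "{x. f x \<noteq> 0} \<subseteq> S" using assms(3) by blast
  then show ?thesis
    using assms bounded_subset
    by (auto simp: test_function_def C_infinity_def compact_closure)
qed

lemma test_function_cutoff:
  assumes "0 \<le> M"
  obtains \<eta> :: "real^'n \<Rightarrow> real" where "test_function \<eta>" "\<And>x. 0 \<le> \<eta> x" "\<And>x. \<eta> x \<le> 1"
    "\<And>x. norm x \<le> M \<Longrightarrow> \<eta> x = 1" "\<And>x. norm x \<ge> M + 1 \<Longrightarrow> \<eta> x = 0"
proof -
  \<comment> \<open>\<open>bump t\<close> is 0 for t \<le> 0 and at least \<open>bump 1\<close> for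
    t \<ge> 1, so \<open>G\<close> is a positive constant on the left and 0 on the right; nesting
    bumps replaces a quotient of smooth functions. The argument is the squared norm, smooth at the
    origin, minus M^2; at radius M + 1 it is at least 1.\<close>
  define G where "G t = bump (bump 1 - bump t)" for t
  define \<eta> where "\<eta> x = G (x \<bullet> x - M\<^sup>2) * inverse (G 0)" for x :: "real^'n"
  have G0: "G t = G 0" if "t \<le> 0" for t using that by (simp add: G_def bump_eq)
  have pos: "G 0 > 0" by (simp add: G_def bump_eq)
  have le: "G t \<le> G 0" for t
    unfolding G_def using bump_bounds(1)[of t] by (intro bump_mono) (simp add: bump_eq)
  have ge: "0 \<le> G t" for t by (simp add: G_def bump_bounds)
  have G1: "G t = 0" if "t \<ge> 1" for t
    using bump_mono[OF that] by (simp add: G_def bump_eq)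
  have smooth: "Ck k \<eta>" for k
    unfolding \<eta>_def G_def diff_conv_add_uminus
    by (intro Ck_mult Ck_const Ck_bump Ck_add Ck_inner Ck_ident bounded_linear.Ck_compose[OF bounded_linear_minus] bounded_linear_ident)
  have inside: "\<eta> x = 1" if "norm x \<le> M" for x
    using that pos G0[of "x \<bullet> x - M\<^sup>2"] by (simp add: \<eta>_def power2_norm_eq_inner[symmetric] power_mono)
  have outside: "\<eta> x = 0" if "norm x \<ge> M + 1" for x
  proof -
    have "(M + 1)\<^sup>2 \<le> (norm x)\<^sup>2" using that assms by (intro power_mono) auto
    then have "x \<bullet> x - M\<^sup>2 \<ge> 1" using assms by (simp add: power2_norm_eq_inner power2_sum)
    then show ?thesis by (simp add: \<eta>_def G1)
  qed
  have "test_function \<eta>"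
    by (rule test_functionI[OF smooth bounded_cball[of 0 "M + 1"]]) (use outside in auto)
  moreover have "0 \<le> \<eta> x" "\<eta> x \<le> 1" for x
    using ge le pos by (auto simp: \<eta>_def field_simps)
  ultimately show ?thesis using that inside outside by blast
qed

text \<open>Stays below the indicator of the box and converges to it pointwise as n grows, so
  integrals over boxes are dominated limits of integrals against test functions.\<close>

definition box_bump :: "real^'n \<Rightarrow> real^'n \<Rightarrow> nat \<Rightarrow> real^'n \<Rightarrow> real" where
  "box_bump a b n x = (\<Prod>i\<in>UNIV. bump (real n * (x $ i - a $ i)) * bump (real n * (b $ i - x $ i)))"

lemma box_bump_zero: "x \<notin> box a b \<Longrightarrow> box_bump a b n x = 0"
  by (fastforce simp: box_bump_def mem_box_cart bump_eq zero_less_mult_iff)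

lemma box_bump_bounds: "0 \<le> box_bump a b n x" "box_bump a b n x \<le> 1"
  unfolding box_bump_def by (auto intro!: prod_nonneg prod_le_1 mult_le_one simp: bump_bounds)

lemma test_function_box_bump: "test_function (box_bump a b n)"
proof (rule test_functionI[OF _ bounded_box[of a b]])
  show "Ck k (box_bump a b n)" for k
    unfolding box_bump_def diff_conv_add_uminus
    by (intro Ck_prod Ck_mult Ck_const Ck_bump Ck_add Ck_ident bounded_linear.Ck_compose[OF bounded_linear_vec_nth]
        bounded_linear.Ck_compose[OF bounded_linear_minus[OF bounded_linear_ident]])
qed (simp add: box_bump_zero)

lemma bump_scaled_tendsto_1: "t > 0 \<Longrightarrow> (\<lambda>n. bump (real n * t)) \<longlonglongrightarrow> 1"
proof -
  assume t: "t > 0"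
  have "(\<lambda>n. exp (- (1 / t) * (1 / real n))) \<longlonglongrightarrow> exp (- (1 / t) * 0)"
    by (intro tendsto_intros lim_1_over_n)
  moreover have "\<forall>\<^sub>F n in sequentially. exp (- (1 / t) * (1 / real n)) = bump (real n * t)"
    using eventually_gt_at_top[of "0::nat"] by eventually_elim (use t in \<open>auto simp: bump_eq\<close>)
  ultimately show ?thesis using Lim_transform_eventually by fastforce
qed

lemma box_bump_tendsto: "(\<lambda>n. box_bump a b n x) \<longlonglongrightarrow> indicator (box a b) x"
proof (cases "x \<in> box a b")
  case True
  then have "(\<lambda>n. box_bump a b n x) \<longlonglongrightarrow> (\<Prod>i\<in>(UNIV::'a set). 1 * 1)"
    unfolding box_bump_def
    by (intro tendsto_prod tendsto_mult bump_scaled_tendsto_1) (auto simp: mem_box_cart)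
  then show ?thesis using True by simp
qed (simp add: box_bump_zero)

section \<open>Hilbert spaces of functions up to null vectors\<close>

text \<open>The carrier is a set inside a vector space, because the spaces in play depend on a
  measure, a group and a domain. The form is only semidefinite, because functions that agree almost
  everywhere are not identified.\<close>

locale semi_inner_space =
  fixes D :: "'v::real_vector set" and e :: "'v \<Rightarrow> 'v \<Rightarrow> real"
  assumes subspace: "subspace D"
    and sym: "x \<in> D \<Longrightarrow> y \<in> D \<Longrightarrow> e x y = e y x"
    and add_left: "x \<in> D \<Longrightarrow> y \<in> D \<Longrightarrow> z \<in> D \<Longrightarrow> e (x + y) z = e x z + e y z"
    and scale_left: "x \<in> D \<Longrightarrow> y \<in> D \<Longrightarrow> e (a *\<^sub>R x) y = a * e x y"
    and nonneg: "x \<in> D \<Longrightarrow> 0 \<le> e x x"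
begin

lemma mem_add: "x \<in> D \<Longrightarrow> y \<in> D \<Longrightarrow> x + y \<in> D"
  and mem_scale: "x \<in> D \<Longrightarrow> a *\<^sub>R x \<in> D"
  and mem_diff: "x \<in> D \<Longrightarrow> y \<in> D \<Longrightarrow> x - y \<in> D"
  and mem_zero: "0 \<in> D"
  and mem_minus: "x \<in> D \<Longrightarrow> - x \<in> D"
  using subspace by (auto intro: subspace_add subspace_scale subspace_diff subspace_0 subspace_neg)

lemmas mem = mem_add mem_scale mem_diff mem_zero mem_minus

lemma add_right: "x \<in> D \<Longrightarrow> y \<in> D \<Longrightarrow> z \<in> D \<Longrightarrow> e x (y + z) = e x y + e x z"
  using sym add_left mem by metis

lemma scale_right: "x \<in> D \<Longrightarrow> y \<in> D \<Longrightarrow> e x (a *\<^sub>R y) = a * e x y"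
  using sym scale_left mem by metis

lemma diff_left: "x \<in> D \<Longrightarrow> y \<in> D \<Longrightarrow> z \<in> D \<Longrightarrow> e (x - y) z = e x z - e y z"
  using add_left[of x "(-1) *\<^sub>R y" z] scale_left[of y z "-1"] mem by auto

lemma diff_right: "x \<in> D \<Longrightarrow> y \<in> D \<Longrightarrow> z \<in> D \<Longrightarrow> e x (y - z) = e x y - e x z"
  using sym diff_left mem by metis

lemmas bilinear = add_left add_right scale_left scale_right diff_left diff_right

definition nrm :: "'v \<Rightarrow> real" where "nrm x = sqrt (e x x)"

lemma nrm_nonneg: "x \<in> D \<Longrightarrow> 0 \<le> nrm x"
  by (simp add: nrm_def nonneg)

lemma nrm_sq: "x \<in> D \<Longrightarrow> (nrm x)\<^sup>2 = e x x"
  by (simp add: nrm_def nonneg)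

lemma nrm_scale: "x \<in> D \<Longrightarrow> nrm (a *\<^sub>R x) = \<bar>a\<bar> * nrm x"
  by (simp add: nrm_def bilinear mem real_sqrt_mult flip: mult.assoc)

lemma nrm_zero: "nrm 0 = 0"
  using scale_left[of 0 0 0] mem_zero by (simp add: nrm_def)

lemma Cauchy_Schwarz:
  assumes "x \<in> D" "y \<in> D"
  shows "\<bar>e x y\<bar> \<le> nrm x * nrm y"
proof -
  have *: "0 \<le> e x x + 2 * t * e x y + t\<^sup>2 * e y y" for t
  proof -
    have "0 \<le> e (x + t *\<^sub>R y) (x + t *\<^sub>R y)"
      by (intro nonneg mem assms)
    also have "\<dots> = e x x + 2 * t * e x y + t\<^sup>2 * e y y"
      using assms mem sym[of x y] by (simp add: bilinear power2_eq_square algebra_simps)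
    finally show ?thesis .
  qed
  have "(e x y)\<^sup>2 \<le> e x x * e y y"
  proof (cases "e y y = 0")
    case True
    have "e x y = 0"
    proof (rule ccontr)
      assume "e x y \<noteq> 0"
      \<comment> \<open>At this parameter the quadratic, which is affine because
        \<open>e y y\<close> vanishes, takes the value -1.\<close>
      then show False
        using *[of "- (e x x + 1) / (2 * e x y)"] True by (simp add: field_simps)
    qed
    then show ?thesis using True by simp
  next
    case False
    then have "e y y > 0" using nonneg[OF assms(2)] by simp
    then show ?thesis
      using *[of "- e x y / e y y"] by (simp add: field_simps power2_eq_square)
  qed
  then have "sqrt ((e x y)\<^sup>2) \<le> sqrt (e x x * e y y)"
    by (rule real_sqrt_le_mono)
  then show ?thesis
    by (simp add: nrm_def real_sqrt_mult)
qed

lemma nrm_triangle: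
  assumes "x \<in> D" "y \<in> D"
  shows "nrm (x + y) \<le> nrm x + nrm y"
proof (rule power2_le_imp_le)
  have "(nrm (x + y))\<^sup>2 = e x x + 2 * e x y + e y y"
    using assms sym[of x y] by (simp add: nrm_sq bilinear mem)
  also have "\<dots> \<le> (nrm x + nrm y)\<^sup>2"
    using Cauchy_Schwarz[OF assms] assms by (simp add: power2_sum nrm_sq)
  finally show "(nrm (x + y))\<^sup>2 \<le> (nrm x + nrm y)\<^sup>2" .
qed (simp add: nrm_nonneg assms)

lemma nrm_minus_commute: "x \<in> D \<Longrightarrow> y \<in> D \<Longrightarrow> nrm (x - y) = nrm (y - x)"
  using nrm_scale[of "x - y" "-1"] mem by simp

lemma nrm_diff_triangle:
  assumes "x \<in> D" "y \<in> D"
  shows "nrm (x - y) \<le> nrm x + nrm y"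
  using nrm_triangle[of x "(-1) *\<^sub>R y"] nrm_scale[of y "-1"] assms mem by auto

lemma tendsto_left:
  assumes "\<And>n. s n \<in> D" "x \<in> D" "y \<in> D" "(\<lambda>n. nrm (s n - x)) \<longlonglongrightarrow> 0"
  shows "(\<lambda>n. e (s n) y) \<longlonglongrightarrow> e x y"
proof -
  have "(\<lambda>n. e (s n) y - e x y) \<longlonglongrightarrow> 0"
  proof (rule Lim_null_comparison)
    show "\<forall>\<^sub>F n in sequentially. norm (e (s n) y - e x y) \<le> nrm (s n - x) * nrm y"
      using Cauchy_Schwarz assms mem by (auto simp flip: diff_left intro!: always_eventually)
    show "(\<lambda>n. nrm (s n - x) * nrm y) \<longlonglongrightarrow> 0"
      using tendsto_mult_right[OF assms(4), of "nrm y"] by simp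
  qed
  then show ?thesis by (simp add: LIM_zero_iff)
qed

end

locale semi_hilbert_space = semi_inner_space +
  assumes complete: "(\<And>n. s n \<in> D) \<Longrightarrow> (\<And>\<epsilon>. \<epsilon> > 0 \<Longrightarrow> \<exists>N. \<forall>m\<ge>N. \<forall>n\<ge>N. nrm (s m - s n) < \<epsilon>) \<Longrightarrow>
    \<exists>x\<in>D. (\<lambda>n. nrm (s n - x)) \<longlonglongrightarrow> 0"
begin

text \<open>The representative minimises e x x - 2 F x. This variational route tolerates null
  vectors: the parallelogram identity makes a minimising sequence Cauchy in the seminorm, and the
  first variation at its limit is the asserted equation.\<close>

lemma riesz_representation:
  assumes F_add: "\<And>x y. x \<in> D \<Longrightarrow> y \<in> D \<Longrightarrow> F (x + y) = F x + F y"
    and F_scale: "\<And>a x. x \<in> D \<Longrightarrow> F (a *\<^sub>R x) = a * F x"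
    and F_bound: "\<And>x. x \<in> D \<Longrightarrow> \<bar>F x\<bar> \<le> K * nrm x"
  obtains f where "f \<in> D" "\<And>h. h \<in> D \<Longrightarrow> e f h = F h"
proof -
  define \<Phi> where "\<Phi> x = e x x - 2 * F x" for x
  define I where "I = Inf (\<Phi> ` D)"
  have lower: "- K\<^sup>2 \<le> \<Phi> x" if "x \<in> D" for x
  proof -
    have "0 \<le> (nrm x - K)\<^sup>2" by simp
    then have "- K\<^sup>2 \<le> e x x - 2 * (K * nrm x)"
      using nrm_sq[OF that] by (simp add: power2_diff algebra_simps)
    also have "\<dots> \<le> \<Phi> x" using F_bound[OF that] by (simp add: \<Phi>_def)
    finally show ?thesis .
  qed
  have bdd: "bdd_below (\<Phi> ` D)" using lower by (auto simp: bdd_below_def)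
  have I_le: "I \<le> \<Phi> x" if "x \<in> D" for x
    unfolding I_def using bdd that by (simp add: cInf_lower)
  have "\<exists>x\<in>D. \<Phi> x < I + 1 / Suc n" for n
  proof -
    have "\<exists>y\<in>\<Phi> ` D. y < I + 1 / Suc n"
      unfolding I_def by (rule cInf_lessD) (use mem_zero in auto)
    then show ?thesis by auto
  qed
  then obtain s where s: "\<And>n. s n \<in> D" "\<And>n. \<Phi> (s n) < I + 1 / Suc n" by metis
  have close: "e (s m - s n) (s m - s n) < 2 / Suc m + 2 / Suc n" for m n
  proof -
    define p where "p = (1/2) *\<^sub>R (s m + s n)"
    have "p \<in> D" using s mem by (simp add: p_def)
    \<comment> \<open>Parallelogram identity; the linear parts cancel because \<open>p\<close> is
      the midpoint.\<close>
    have "e (s m - s n) (s m - s n) = 2 * \<Phi> (s m) + 2 * \<Phi> (s n) - 4 * \<Phi> p"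
      using s mem sym[of "s m" "s n"] by (simp add: \<Phi>_def p_def bilinear F_add F_scale field_simps)
    then show ?thesis using s(2)[of m] s(2)[of n] I_le[OF \<open>p \<in> D\<close>] by linarith
  qed
  have "\<exists>N. \<forall>m\<ge>N. \<forall>n\<ge>N. nrm (s m - s n) < \<epsilon>" if \<epsilon>: "\<epsilon> > 0" for \<epsilon>
  proof -
    obtain N where N: "4 / \<epsilon>\<^sup>2 < real N" using reals_Archimedean2 by blast
    have "nrm (s m - s n) < \<epsilon>" if "m \<ge> N" "n \<ge> N" for m n
    proof (rule power2_less_imp_less)
      have pos: "0 < real N" using N \<epsilon> by (smt (verit) divide_nonneg_nonneg zero_le_power2)
      have "2 / real (Suc k) \<le> 2 / real N" if "k \<ge> N" for k
        using that pos by (intro divide_left_mono mult_pos_pos) auto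
      then have "(nrm (s m - s n))\<^sup>2 < 2 / real N + 2 / real N"
        using close[of m n] that s mem by (smt (verit) nrm_sq)
      also have "\<dots> < \<epsilon>\<^sup>2" using N \<epsilon> pos by (simp add: field_simps)
      finally show "(nrm (s m - s n))\<^sup>2 < \<epsilon>\<^sup>2" .
    qed (use \<epsilon> in simp)
    then show ?thesis by blast
  qed
  then obtain f where f: "f \<in> D" "(\<lambda>n. nrm (s n - f)) \<longlonglongrightarrow> 0"
    using complete s by blast
  have "e f h = F h" if h: "h \<in> D" for h
  proof -
    \<comment> \<open>Near-minimality of \<open>s n\<close>, compared at
      \<open>s n + t *\<^sub>R h\<close> and passed to the limit; \<open>\<Phi>\<close> itself is
      never evaluated at \<open>f\<close>.\<close>
    have ineq: "0 \<le> 2 * t * (e f h - F h) + t\<^sup>2 * e h h" for t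
    proof (rule LIMSEQ_le)
      show "(\<lambda>n. - 1 / Suc n) \<longlonglongrightarrow> 0"
        using tendsto_minus[OF LIMSEQ_inverse_real_of_nat] by (simp add: inverse_eq_divide)
      show "(\<lambda>n. 2 * t * (e (s n) h - F h) + t\<^sup>2 * e h h) \<longlonglongrightarrow> 2 * t * (e f h - F h) + t\<^sup>2 * e h h"
        by (intro tendsto_intros tendsto_left s f h)
      have "- 1 / real (Suc n) \<le> 2 * t * (e (s n) h - F h) + t\<^sup>2 * e h h" for n
      proof -
        have "I \<le> \<Phi> (s n + t *\<^sub>R h)" using s h mem by (intro I_le) auto
        also have "\<dots> = \<Phi> (s n) + (2 * t * (e (s n) h - F h) + t\<^sup>2 * e h h)"
          using s h mem sym[of "s n" h]
          by (simp add: \<Phi>_def bilinear F_add F_scale power2_eq_square algebra_simps)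
        finally show ?thesis using s(2)[of n] by simp
      qed
      then show "\<exists>N. \<forall>n\<ge>N. - 1 / real (Suc n) \<le> 2 * t * (e (s n) h - F h) + t\<^sup>2 * e h h" by blast
    qed
    \<comment> \<open>A quadratic in t without constant term that is nowhere negative has no linear
      term. It is tested at t = -d, divided by \<open>e h h\<close> when that is positive.\<close>
    define d where "d = e f h - F h"
    have "d = 0"
    proof (cases "e h h = 0")
      case True
      then show ?thesis using ineq[of "- d"] by (auto simp: d_def[symmetric] mult_le_0_iff)
    next
      case False
      then have pos: "e h h > 0" using nonneg[OF h] by simp
      then show ?thesis
        using ineq[of "- d / e h h"] unfolding d_def[symmetric]
        by (auto simp add: field_simps power2_eq_square mult_le_0_iff)
    qed
    then show ?thesis by (simp add: d_def)
  qed
  then show ?thesis using f that by blast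
qed

text \<open>The closure has the shape used in \<open>dirichlet_domain\<close>, to which the lemma is
  applied; its other use is the \<open>L2\<close> closure of the test functions. Limits exist in
  \<open>D\<close>, and the triangle inequality keeps them in the closure.\<close>

lemma semi_hilbert_closure:
  assumes S: "subspace S" "S \<subseteq> D"
  shows "semi_hilbert_space {f \<in> D. \<forall>\<epsilon>>0. \<exists>g\<in>S. nrm (f - g) < \<epsilon>} e" (is "semi_hilbert_space ?C e")
proof -
  have C: "f \<in> D" if "f \<in> ?C" for f using that by simp
  have "subspace ?C"
    unfolding subspace_def
  proof (intro conjI ballI allI)
    show "0 \<in> ?C"
      using subspace_0[OF S(1)] mem_zero by (auto simp: nrm_zero intro!: bexI[of _ 0])
  next
    fix x y assume xy: "x \<in> ?C" "y \<in> ?C"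
    have "\<exists>g\<in>S. nrm (x + y - g) < \<epsilon>" if "\<epsilon> > 0" for \<epsilon>
    proof -
      obtain g h where gh: "g \<in> S" "nrm (x - g) < \<epsilon> / 2" "h \<in> S" "nrm (y - h) < \<epsilon> / 2"
        using xy \<open>\<epsilon> > 0\<close> half_gt_zero by blast
      have "nrm (x + y - (g + h)) \<le> nrm (x - g) + nrm (y - h)"
        using nrm_triangle[of "x - g" "y - h"] gh S xy by (simp add: mem subsetD algebra_simps)
      then show ?thesis using gh subspace_add[OF S(1)] by (intro bexI[of _ "g + h"]) auto
    qed
    then show "x + y \<in> ?C" using xy mem by simp
  next
    fix a x assume x: "x \<in> ?C"
    have "\<exists>g\<in>S. nrm (a *\<^sub>R x - g) < \<epsilon>" if "\<epsilon> > 0" for \<epsilon>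
    proof -
      have "\<epsilon> / (\<bar>a\<bar> + 1) > 0" using \<open>\<epsilon> > 0\<close> by auto
      then obtain g where g: "g \<in> S" "nrm (x - g) < \<epsilon> / (\<bar>a\<bar> + 1)" using x by blast
      have "nrm (a *\<^sub>R x - a *\<^sub>R g) = \<bar>a\<bar> * nrm (x - g)"
        using nrm_scale[of "x - g" a] x g S by (simp add: mem subsetD scaleR_diff_right)
      also have "\<dots> \<le> (\<bar>a\<bar> + 1) * nrm (x - g)"
        using nrm_nonneg[of "x - g"] x g S by (simp add: mem subsetD mult_right_mono)
      also have "\<dots> < \<epsilon>" using g by (simp add: field_simps)
      finally show ?thesis using g subspace_scale[OF S(1)] by blast
    qed
    then show "a *\<^sub>R x \<in> ?C" using x mem by simp
  qed
  then interpret C: semi_inner_space ?C e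
    by unfold_locales (use sym add_left scale_left nonneg in auto)
  show ?thesis
  proof
    fix s :: "nat \<Rightarrow> 'a" assume s: "\<And>n. s n \<in> ?C"
      and cauchy: "\<And>\<epsilon>. \<epsilon> > 0 \<Longrightarrow> \<exists>N. \<forall>m\<ge>N. \<forall>n\<ge>N. nrm (s m - s n) < \<epsilon>"
    obtain x where x: "x \<in> D" "(\<lambda>n. nrm (s n - x)) \<longlonglongrightarrow> 0"
      using complete[of s] s cauchy by blast
    have "\<exists>g\<in>S. nrm (x - g) < \<epsilon>" if \<epsilon>: "\<epsilon> > 0" for \<epsilon>
    proof -
      obtain n where "nrm (s n - x) < \<epsilon> / 2"
        using order_tendstoD(2)[OF x(2), of "\<epsilon> / 2"] \<epsilon> eventually_sequentially by auto
      moreover obtain g where "g \<in> S" "nrm (s n - g) < \<epsilon> / 2"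
        using s[of n] half_gt_zero[OF \<epsilon>] by blast
      moreover have "nrm (x - g) \<le> nrm (x - s n) + nrm (s n - g)"
        using nrm_triangle[of "x - s n" "s n - g"] x C[OF s] \<open>g \<in> S\<close> S by (auto simp: mem)
      ultimately show ?thesis
        using nrm_minus_commute[OF x(1) C[OF s]] by (intro bexI[of _ g]) auto
    qed
    then show "\<exists>x\<in>?C. (\<lambda>n. nrm (s n - x)) \<longlonglongrightarrow> 0" using x by blast
  qed
qed

end

section \<open>Symmetric, possibly indefinite forms: from injectivity to solvability\<close>

lemma finite_family_convergent_subseq:
  fixes a :: "'i \<Rightarrow> nat \<Rightarrow> real"
  assumes "finite I" and "\<And>i. i \<in> I \<Longrightarrow> bounded (range (a i))"
  obtains r where "strict_mono (r :: nat \<Rightarrow> nat)" "\<And>i. i \<in> I \<Longrightarrow> convergent (a i \<circ> r)"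
proof -
  have "\<exists>r :: nat \<Rightarrow> nat. strict_mono r \<and> (\<forall>i\<in>I. convergent (a i \<circ> r))"
    using assms
  proof (induction I rule: finite_induct)
    case empty
    show ?case by (intro exI[of _ id]) (auto simp: strict_mono_def)
  next
    case (insert j I)
    then obtain r :: "nat \<Rightarrow> nat" where r: "strict_mono r" "\<forall>i\<in>I. convergent (a i \<circ> r)" by (metis insertI2)
    have "bounded (range (a j \<circ> r))"
      using insert.prems[of j] by (auto intro: bounded_subset)
    then obtain l q where q: "strict_mono (q :: nat \<Rightarrow> nat)" "(a j \<circ> r \<circ> q) \<longlonglongrightarrow> l"
      using bounded_imp_convergent_subsequence by blast
    have "convergent (a i \<circ> (r \<circ> q))" if "i \<in> insert j I" for i
    proof (cases "i = j")
      case True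
      then show ?thesis using q by (auto simp: convergent_def comp_assoc)
    next
      case False
      then show ?thesis using that r q(1)
        by (metis comp_assoc convergent_subseq_convergent insertE)
    qed
    then show ?case using strict_mono_compose[OF r(1) q(1)] by (intro exI[of _ "r \<circ> q"] conjI ballI) (auto simp: o_def)
  qed
  then show ?thesis using that by blast
qed

locale symmetric_form = semi_hilbert_space D e
  for D :: "'v::real_vector set" and e +
  fixes c :: "'v \<Rightarrow> 'v \<Rightarrow> real" and M :: real
  assumes c_sym: "x \<in> D \<Longrightarrow> y \<in> D \<Longrightarrow> c x y = c y x"
    and c_add: "x \<in> D \<Longrightarrow> y \<in> D \<Longrightarrow> z \<in> D \<Longrightarrow> c (x + y) z = c x z + c y z"
    and c_scale: "x \<in> D \<Longrightarrow> y \<in> D \<Longrightarrow> c (a *\<^sub>R x) y = a * c x y"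
    and c_bound: "x \<in> D \<Longrightarrow> y \<in> D \<Longrightarrow> \<bar>c x y\<bar> \<le> M * nrm x * nrm y"
begin

lemma c_add_right: "x \<in> D \<Longrightarrow> y \<in> D \<Longrightarrow> z \<in> D \<Longrightarrow> c x (y + z) = c x y + c x z"
  using c_sym c_add mem by metis

lemma c_scale_right: "x \<in> D \<Longrightarrow> y \<in> D \<Longrightarrow> c x (a *\<^sub>R y) = a * c x y"
  using c_sym c_scale mem by metis

lemma c_diff: "x \<in> D \<Longrightarrow> y \<in> D \<Longrightarrow> z \<in> D \<Longrightarrow> c (x - y) z = c x z - c y z"
  using c_add[of x "(-1) *\<^sub>R y" z] c_scale[of y z "-1"] mem by auto

text \<open>\<open>K\<close> bounds the functional \<open>c f\<close> in the dual norm, and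
  \<open>est\<close> is coercivity up to finitely many bounded functionals. If no \<open>k\<close>
  worked, there would be unit vectors with \<open>c f\<close> tending to 0. Along a subsequence on
  which the finitely many functionals converge, \<open>est\<close> applied to differences makes
  these vectors Cauchy, and their limit is a unit vector annihilated by \<open>c\<close>.\<close>

lemma bounded_below_of_injective:
  fixes l :: "'i \<Rightarrow> 'v \<Rightarrow> real"
  assumes "finite I"
    and l_scale: "\<And>i x a. i \<in> I \<Longrightarrow> x \<in> D \<Longrightarrow> l i (a *\<^sub>R x) = a * l i x"
    and l_diff: "\<And>i x y. i \<in> I \<Longrightarrow> x \<in> D \<Longrightarrow> y \<in> D \<Longrightarrow> l i (x - y) = l i x - l i y"
    and l_bound: "\<And>i x. i \<in> I \<Longrightarrow> x \<in> D \<Longrightarrow> \<bar>l i x\<bar> \<le> A * nrm x"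
    and est: "\<And>f K. f \<in> D \<Longrightarrow> 0 \<le> K \<Longrightarrow> (\<And>h. h \<in> D \<Longrightarrow> \<bar>c f h\<bar> \<le> K * nrm h) \<Longrightarrow>
      nrm f \<le> C * (K + (\<Sum>i\<in>I. \<bar>l i f\<bar>))"
    and inj: "\<And>f. f \<in> D \<Longrightarrow> (\<And>h. h \<in> D \<Longrightarrow> c f h = 0) \<Longrightarrow> e f f = 0"
  obtains k where "k > 0"
    "\<And>f K. f \<in> D \<Longrightarrow> 0 \<le> K \<Longrightarrow> (\<And>h. h \<in> D \<Longrightarrow> \<bar>c f h\<bar> \<le> K * nrm h) \<Longrightarrow> k * nrm f \<le> K"
proof -
  have "\<exists>k>0. \<forall>f\<in>D. \<forall>K\<ge>0. (\<forall>h\<in>D. \<bar>c f h\<bar> \<le> K * nrm h) \<longrightarrow> k * nrm f \<le> K"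
  proof (rule ccontr)
    assume "\<not> ?thesis"
    then have neg': "\<exists>f\<in>D. \<exists>K\<ge>0. (\<forall>h\<in>D. \<bar>c f h\<bar> \<le> K * nrm h) \<and> K < k * nrm f" if "k > 0" for k
      using that by (meson not_le)
    have "\<exists>f\<in>D. nrm f = 1 \<and> (\<forall>h\<in>D. \<bar>c f h\<bar> \<le> (1 / Suc n) * nrm h)" for n
    proof -
      obtain f K where f: "f \<in> D" and K: "K \<ge> 0" "\<forall>h\<in>D. \<bar>c f h\<bar> \<le> K * nrm h"
        "K < 1 / Suc n * nrm f"
        using neg' by (metis of_nat_0_less_iff zero_less_Suc zero_less_divide_1_iff)
      have pos: "nrm f > 0"
        using K nrm_nonneg[OF f] by (cases "nrm f = 0") auto
      define g where "g = (1 / nrm f) *\<^sub>R f"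
      have g: "g \<in> D" "nrm g = 1" using f pos by (auto simp: g_def mem nrm_scale)
      have "\<bar>c g h\<bar> \<le> 1 / Suc n * nrm h" if h: "h \<in> D" for h
      proof -
        have "\<bar>c g h\<bar> = \<bar>c f h\<bar> / nrm f" using f h pos by (simp add: g_def c_scale abs_mult)
        also have "\<dots> \<le> (K * nrm h) / nrm f" using K h pos by (intro divide_right_mono) auto
        also have "\<dots> \<le> (1 / Suc n * nrm f * nrm h) / nrm f"
          using K pos nrm_nonneg[OF h] by (intro divide_right_mono mult_right_mono) auto
        finally show ?thesis using pos by simp
      qed
      then show ?thesis using g by blast
    qed
    then obtain s where s: "\<And>n. s n \<in> D" "\<And>n. nrm (s n) = 1"
      and sc: "\<And>n h. h \<in> D \<Longrightarrow> \<bar>c (s n) h\<bar> \<le> (1 / Suc n) * nrm h"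
      by metis
    have "bounded (range (\<lambda>n. l i (s n)))" if "i \<in> I" for i
      unfolding bounded_iff using l_bound[OF that s(1)] s(2) by (intro exI[of _ A]) auto
    then obtain r where r: "strict_mono (r :: nat \<Rightarrow> nat)" "\<And>i. i \<in> I \<Longrightarrow> convergent ((\<lambda>n. l i (s n)) \<circ> r)"
      using finite_family_convergent_subseq[OF \<open>finite I\<close>, of "\<lambda>i n. l i (s n)"] by auto
    define C' where "C' = max C 1"
    have C': "C' > 0" "C \<le> C'" by (auto simp: C'_def)
    have diff_est: "nrm (s m - s n) \<le> C' * (1 / Suc m + 1 / Suc n + (\<Sum>i\<in>I. \<bar>l i (s m) - l i (s n)\<bar>))" for m n
    proof -
      have "nrm (s m - s n) \<le> C * (1 / Suc m + 1 / Suc n + (\<Sum>i\<in>I. \<bar>l i (s m - s n)\<bar>))"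
      proof (rule est)
        show "\<bar>c (s m - s n) h\<bar> \<le> (1 / Suc m + 1 / Suc n) * nrm h" if "h \<in> D" for h
          using sc[OF that, of m] sc[OF that, of n] s that by (simp add: c_diff distrib_right)
      qed (use s mem in auto)
      also have "\<dots> \<le> C' * (1 / Suc m + 1 / Suc n + (\<Sum>i\<in>I. \<bar>l i (s m - s n)\<bar>))"
        using C' by (intro mult_right_mono add_nonneg_nonneg sum_nonneg) auto
      finally show ?thesis using s l_diff by simp
    qed
    have cauchy: "\<exists>N. \<forall>m\<ge>N. \<forall>n\<ge>N. nrm (s (r m) - s (r n)) < \<epsilon>" if \<epsilon>: "\<epsilon> > 0" for \<epsilon>
    proof -
      \<comment> \<open>The functionals and the two defects 1/Suc together contribute at most (2 +
        card I) \<delta>; the third unit makes the inequality strict.\<close>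
      define \<delta> where "\<delta> = \<epsilon> / (C' * (3 + card I))"
      have \<delta>: "\<delta> > 0" using \<epsilon> C' by (simp add: \<delta>_def)
      have "\<forall>i\<in>I. \<exists>N. \<forall>m\<ge>N. \<forall>n\<ge>N. \<bar>l i (s (r m)) - l i (s (r n))\<bar> < \<delta>"
        using r(2) \<delta> by (auto simp: Cauchy_convergent_iff[symmetric] Cauchy_def dist_real_def)
      then obtain N where N: "\<And>i m n. i \<in> I \<Longrightarrow> m \<ge> N i \<Longrightarrow> n \<ge> N i \<Longrightarrow> \<bar>l i (s (r m)) - l i (s (r n))\<bar> < \<delta>"
        by metis
      obtain N1 where N1: "1 / \<delta> < real N1" using reals_Archimedean2 by blast
      have small: "1 / Suc (r m) \<le> \<delta>" if "m \<ge> N1" for m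
      proof -
        have "real N1 \<le> Suc (r m)" using seq_suble[OF r(1), of m] that by simp
        then have "1 / \<delta> \<le> Suc (r m)" using N1 by linarith
        then show ?thesis using \<delta> by (simp add: field_simps)
      qed
      define N0 where "N0 = Max (insert N1 (N ` I))"
      have N0: "N1 \<le> N0" "\<And>i. i \<in> I \<Longrightarrow> N i \<le> N0"
        using \<open>finite I\<close> by (auto simp: N0_def)
      have "nrm (s (r m) - s (r n)) < \<epsilon>" if mn: "m \<ge> N0" "n \<ge> N0" for m n
      proof -
        have "(\<Sum>i\<in>I. \<bar>l i (s (r m)) - l i (s (r n))\<bar>) \<le> (\<Sum>i\<in>I. \<delta>)"
          using N N0 mn by (intro sum_mono less_imp_le) (meson order_trans)
        then have "1 / Suc (r m) + 1 / Suc (r n) + (\<Sum>i\<in>I. \<bar>l i (s (r m)) - l i (s (r n))\<bar>) \<le> \<delta> + \<delta> + card I * \<delta>"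
          using small[of m] small[of n] N0 mn by simp
        also have "\<dots> < (3 + card I) * \<delta>" using \<delta> by (simp add: algebra_simps)
        finally have "C' * (1 / Suc (r m) + 1 / Suc (r n) + (\<Sum>i\<in>I. \<bar>l i (s (r m)) - l i (s (r n))\<bar>)) < C' * ((3 + card I) * \<delta>)"
          using C' by simp
        also have "\<dots> = \<epsilon>" using C' by (simp add: \<delta>_def)
        finally show ?thesis using diff_est[of "r m" "r n"] by linarith
      qed
      then show ?thesis by blast
    qed
    obtain f where f: "f \<in> D" "(\<lambda>n. nrm (s (r n) - f)) \<longlonglongrightarrow> 0"
      using complete[OF _ cauchy] s by auto
    have "c f h = 0" if h: "h \<in> D" for h
    proof -
      have "(\<lambda>n. c (s (r n)) h) \<longlonglongrightarrow> 0"
      proof (rule Lim_null_comparison)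
        show "\<forall>\<^sub>F n in sequentially. norm (c (s (r n)) h) \<le> (1 / Suc (r n)) * nrm h"
          using sc h by (simp add: always_eventually)
        have "(\<lambda>n. 1 / Suc (r n)) \<longlonglongrightarrow> 0"
          using LIMSEQ_subseq_LIMSEQ[OF LIMSEQ_inverse_real_of_nat r(1)] by (simp add: o_def inverse_eq_divide)
        then show "(\<lambda>n. (1 / Suc (r n)) * nrm h) \<longlonglongrightarrow> 0"
          using tendsto_mult_right[of "\<lambda>n. 1 / Suc (r n)" 0 _ "nrm h"] by simp
      qed
      moreover have "(\<lambda>n. c (s (r n)) h - c f h) \<longlonglongrightarrow> 0"
      proof (rule Lim_null_comparison)
        show "\<forall>\<^sub>F n in sequentially. norm (c (s (r n)) h - c f h) \<le> M * nrm (s (r n) - f) * nrm h"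
          using c_bound s f h mem by (auto simp flip: c_diff intro!: always_eventually)
        show "(\<lambda>n. M * nrm (s (r n) - f) * nrm h) \<longlonglongrightarrow> 0"
          using tendsto_mult_right[OF tendsto_mult_left[OF f(2), of M], of "nrm h"] by simp
      qed
      ultimately show ?thesis
        using LIMSEQ_unique by (fastforce simp: LIM_zero_iff)
    qed
    then have "e f f = 0" using inj f by blast
    \<comment> \<open>The limit inherits norm at least 1, which is what excludes a null
      vector.\<close>
    moreover have "1 \<le> nrm (s (r n) - f) + nrm f" for n
      using nrm_triangle[of "s (r n) - f" f] s f mem by simp
    then have "1 \<le> 0 + nrm f"
      using f by (intro tendsto_lowerbound[OF tendsto_add[OF f(2) tendsto_const]]) auto
    ultimately show False by (simp add: nrm_def)
  qed
  then show ?thesis using that by metis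
qed

text \<open>With \<open>L\<close> the operator of \<open>c\<close>, the form \<open>e (L f) (L h)\<close> is an equivalent inner product, and
  Riesz for it solves \<open>L (L g) = F\<close>.\<close>

lemma solvable_of_bounded_below:
  assumes k: "k > 0"
    and below: "\<And>f K. f \<in> D \<Longrightarrow> 0 \<le> K \<Longrightarrow> (\<And>h. h \<in> D \<Longrightarrow> \<bar>c f h\<bar> \<le> K * nrm h) \<Longrightarrow> k * nrm f \<le> K"
    and F_add: "\<And>x y. x \<in> D \<Longrightarrow> y \<in> D \<Longrightarrow> F (x + y) = F x + F y"
    and F_scale: "\<And>a x. x \<in> D \<Longrightarrow> F (a *\<^sub>R x) = a * F x"
    and F_bound: "\<And>x. x \<in> D \<Longrightarrow> \<bar>F x\<bar> \<le> K * nrm x"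
  obtains f where "f \<in> D" "\<And>h. h \<in> D \<Longrightarrow> c f h = F h"
proof -
  have "\<exists>g\<in>D. \<forall>h\<in>D. e g h = c f h" if "f \<in> D" for f
  proof -
    obtain g where "g \<in> D" "\<And>h. h \<in> D \<Longrightarrow> e g h = c f h"
      by (rule riesz_representation[of "c f" "M * nrm f"])
        (use \<open>f \<in> D\<close> c_add_right c_scale_right c_bound in auto)
    then show ?thesis by blast
  qed
  then obtain L where L: "\<And>f. f \<in> D \<Longrightarrow> L f \<in> D" "\<And>f h. f \<in> D \<Longrightarrow> h \<in> D \<Longrightarrow> e (L f) h = c f h"
    by metis
  define e' where "e' f h = e (L f) (L h)" for f h
  have e'1: "e' f h = c f (L h)" if "f \<in> D" "h \<in> D" for f h
    using that L by (simp add: e'_def)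
  interpret e': semi_inner_space D e'
  proof
    show "e' x y = e' y x" if "x \<in> D" "y \<in> D" for x y
      using that L sym by (simp add: e'_def)
    show "0 \<le> e' x x" if "x \<in> D" for x
      using nonneg[OF L(1)[OF that]] by (simp add: e'_def)
  qed (simp_all add: subspace e'1 mem c_add c_scale L)
  have e'_nrm: "e'.nrm f = nrm (L f)" for f by (simp add: nrm_def e'.nrm_def e'_def)
  \<comment> \<open>\<open>below\<close> is used with K = \<open>nrm (L f)\<close>, which bounds the
    functional \<open>c f\<close> by Cauchy-Schwarz.\<close>
  have lower: "k * nrm f \<le> e'.nrm f" if "f \<in> D" for f
    unfolding e'_nrm
    using L that Cauchy_Schwarz[OF L(1)[OF that]] by (intro below) (auto simp: nrm_nonneg)
  have upper: "e'.nrm f \<le> M * nrm f" if "f \<in> D" for f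
  proof (cases "nrm (L f) = 0")
    case True
    have "k * nrm f \<le> 0" using lower[OF that] True e'_nrm by simp
    then have "nrm f = 0" using k nrm_nonneg[OF that] by (simp add: mult_le_0_iff)
    then show ?thesis using True e'_nrm by simp
  next
    case False
    then have pos: "nrm (L f) > 0" using nrm_nonneg[OF L(1)[OF that]] by simp
    have "nrm (L f) * nrm (L f) = c f (L f)"
      using L that nrm_sq[of "L f"] by (simp add: power2_eq_square)
    also have "\<dots> \<le> M * nrm f * nrm (L f)" using c_bound[of f "L f"] L that by simp
    finally show ?thesis using pos e'_nrm by simp
  qed
  interpret e': semi_hilbert_space D e'
  proof
    fix s :: "nat \<Rightarrow> 'v" assume s: "\<And>n. s n \<in> D"
      and cauchy: "\<And>\<epsilon>. \<epsilon> > 0 \<Longrightarrow> \<exists>N. \<forall>m\<ge>N. \<forall>n\<ge>N. e'.nrm (s m - s n) < \<epsilon>"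
    have "\<exists>N. \<forall>m\<ge>N. \<forall>n\<ge>N. nrm (s m - s n) < \<epsilon>" if "\<epsilon> > 0" for \<epsilon>
    proof -
      obtain N where N: "\<forall>m\<ge>N. \<forall>n\<ge>N. e'.nrm (s m - s n) < k * \<epsilon>"
        using cauchy[of "k * \<epsilon>"] k \<open>\<epsilon> > 0\<close> by auto
      have "nrm (s m - s n) < \<epsilon>" if "m \<ge> N" "n \<ge> N" for m n
      proof -
        have "k * nrm (s m - s n) < k * \<epsilon>" using N that lower[of "s m - s n"] s mem by fastforce
        then show ?thesis using k by simp
      qed
      then show ?thesis by blast
    qed
    then obtain x where x: "x \<in> D" "(\<lambda>n. nrm (s n - x)) \<longlonglongrightarrow> 0"
      using complete s by blast
    have "(\<lambda>n. e'.nrm (s n - x)) \<longlonglongrightarrow> 0"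
    proof (rule Lim_null_comparison)
      show "\<forall>\<^sub>F n in sequentially. norm (e'.nrm (s n - x)) \<le> M * nrm (s n - x)"
        using upper s x mem e'.nrm_nonneg by (auto intro!: always_eventually)
      show "(\<lambda>n. M * nrm (s n - x)) \<longlonglongrightarrow> 0" using tendsto_mult_left[OF x(2), of M] by simp
    qed
    then show "\<exists>x\<in>D. (\<lambda>n. e'.nrm (s n - x)) \<longlonglongrightarrow> 0" using x by blast
  qed
  have "\<bar>F x\<bar> \<le> (\<bar>K\<bar> / k) * e'.nrm x" if "x \<in> D" for x
  proof -
    have "\<bar>F x\<bar> \<le> \<bar>K\<bar> * nrm x"
      using F_bound[OF that] nrm_nonneg[OF that] by (smt (verit) mult_right_mono)
    also have "\<dots> \<le> \<bar>K\<bar> * (e'.nrm x / k)"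
      using lower[OF that] k by (intro mult_left_mono) (auto simp: field_simps)
    finally show ?thesis by simp
  qed
  then obtain g where g: "g \<in> D" "\<And>h. h \<in> D \<Longrightarrow> e' g h = F h"
    using e'.riesz_representation[OF F_add F_scale] by metis
  \<comment> \<open>\<open>c (L g) h = c h (L g) = e' h g = e' g h\<close>: the symmetry of
    \<open>c\<close> and of \<open>e'\<close> moves the operator across.\<close>
  have "c (L g) h = F h" if "h \<in> D" for h
    using g that e'1[OF that g(1)] e'.sym[OF that g(1)] c_sym[of h "L g"] L by auto
  then show ?thesis using that L g by blast
qed

end

section \<open>Square integrable functions and test functions\<close>

text \<open>On top of the pointwise sums of \<open>Function_Algebras\<close>, this makes sets of
  functions eligible as carriers of \<open>semi_inner_space\<close>.\<close>

instantiation "fun" :: (type, real_vector) real_vector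
begin

definition scaleR_fun :: "real \<Rightarrow> ('a \<Rightarrow> 'b) \<Rightarrow> 'a \<Rightarrow> 'b" where
  "scaleR_fun a f = (\<lambda>x. a *\<^sub>R f x)"

instance
  by standard (simp_all add: scaleR_fun_def fun_eq_iff scaleR_add_right scaleR_add_left)

end

lemma scaleR_fun_apply [simp]: "(a *\<^sub>R f) x = a *\<^sub>R f x"
  by (simp add: scaleR_fun_def)

lemma L2_real_iff: "f \<in> L2 M \<longleftrightarrow> f \<in> borel_measurable M \<and> integrable M (\<lambda>x. (f x)\<^sup>2)"
  for f :: "'a \<Rightarrow> real"
  by (simp add: L2_def)

lemma L2_measurable: "f \<in> L2 M \<Longrightarrow> f \<in> borel_measurable M"
  by (simp add: L2_def)

lemma L2_square_integrable: "f \<in> L2 M \<Longrightarrow> integrable M (\<lambda>x. (f x)\<^sup>2)" for f :: "'a \<Rightarrow> real"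
  by (simp add: L2_def)

lemma L2_mult_integrable:
  fixes f g :: "'a \<Rightarrow> real"
  assumes "f \<in> L2 M" "g \<in> L2 M"
  shows "integrable M (\<lambda>x. f x * g x)"
proof (rule Bochner_Integration.integrable_bound)
  show "integrable M (\<lambda>x. (f x)\<^sup>2 + (g x)\<^sup>2)"
    using assms by (intro Bochner_Integration.integrable_add L2_square_integrable)
  show "AE x in M. norm (f x * g x) \<le> norm ((f x)\<^sup>2 + (g x)\<^sup>2)"
  proof (rule AE_I2)
    fix x
    have "2 * (\<bar>f x\<bar> * \<bar>g x\<bar>) \<le> (f x)\<^sup>2 + (g x)\<^sup>2"
      using sum_squares_bound[of "\<bar>f x\<bar>" "\<bar>g x\<bar>"] by simp
    then show "norm (f x * g x) \<le> norm ((f x)\<^sup>2 + (g x)\<^sup>2)"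
      by (simp add: abs_mult) (smt (verit) mult_nonneg_nonneg abs_ge_zero)
  qed
qed (use assms in \<open>auto dest!: L2_measurable\<close>)

lemma L2_bound:
  fixes f g :: "'a \<Rightarrow> real"
  assumes "g \<in> L2 M" "f \<in> borel_measurable M" "AE x in M. \<bar>f x\<bar> \<le> \<bar>g x\<bar>"
  shows "f \<in> L2 M" "L2norm M f \<le> L2norm M g"
proof -
  have *: "AE x in M. (f x)\<^sup>2 \<le> (g x)\<^sup>2"
    using assms(3) by eventually_elim (simp add: abs_le_square_iff)
  have int: "integrable M (\<lambda>x. (f x)\<^sup>2)"
    by (rule Bochner_Integration.integrable_bound[OF L2_square_integrable[OF assms(1)]])
      (use assms(2) * in auto)
  then show "f \<in> L2 M" using assms(2) by (simp add: L2_real_iff)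
  show "L2norm M f \<le> L2norm M g"
    unfolding L2norm_def using * int L2_square_integrable[OF assms(1)]
    by (auto intro!: real_sqrt_le_mono integral_mono_AE)
qed

lemma L2_cong_AE:
  fixes f g :: "'a \<Rightarrow> real"
  assumes "g \<in> L2 M" "f \<in> borel_measurable M" "AE x in M. f x = g x"
  shows "f \<in> L2 M" "L2norm M f = L2norm M g"
proof -
  show f: "f \<in> L2 M" using assms by (intro L2_bound(1)[OF assms(1,2)]) auto
  show "L2norm M f = L2norm M g"
    using assms L2_measurable[OF assms(1)]
    by (intro antisym L2_bound(2)[OF assms(1,2)] L2_bound(2)[OF f]) auto
qed

lemma subspace_L2: "subspace (L2 M :: ('a \<Rightarrow> real) set)"
  unfolding subspace_def
proof (intro conjI ballI allI)
  fix f g :: "'a \<Rightarrow> real" assume fg: "f \<in> L2 M" "g \<in> L2 M"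
  have "integrable M (\<lambda>x. (f x)\<^sup>2 + 2 * (f x * g x) + (g x)\<^sup>2)"
    using fg by (intro Bochner_Integration.integrable_add integrable_mult_right L2_square_integrable L2_mult_integrable)
  then have "integrable M (\<lambda>x. (f x + g x)\<^sup>2)"
    by (simp add: power2_sum algebra_simps)
  then show "f + g \<in> L2 M"
    using fg by (auto simp: L2_real_iff plus_fun_def)
qed (auto simp: L2_real_iff scaleR_fun_def zero_fun_def power_mult_distrib)

lemma L2_nn_integral:
  fixes f :: "'a \<Rightarrow> real"
  assumes "f \<in> borel_measurable M" "(\<integral>\<^sup>+x. ennreal ((f x)\<^sup>2) \<partial>M) \<le> ennreal C" "0 \<le> C"
  shows "f \<in> L2 M" "(L2norm M f)\<^sup>2 \<le> C"
proof -
  have int: "integrable M (\<lambda>x. (f x)\<^sup>2)"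
    using assms by (intro integrableI_bounded) (auto simp: less_top[symmetric] top_unique)
  then show "f \<in> L2 M" using assms by (simp add: L2_real_iff)
  have "ennreal (\<integral>x. (f x)\<^sup>2 \<partial>M) \<le> ennreal C"
    using assms(2) nn_integral_eq_integral[OF int] by simp
  then show "(L2norm M f)\<^sup>2 \<le> C"
    using assms(3) by (simp add: L2norm_def)
qed

lemma L2norm_nonneg: "0 \<le> L2norm M f"
  by (simp add: L2norm_def)

lemma L2norm_sq_nn_integral:
  fixes f :: "'a \<Rightarrow> real"
  assumes "f \<in> L2 M"
  shows "(\<integral>\<^sup>+x. ennreal ((f x)\<^sup>2) \<partial>M) = ennreal ((L2norm M f)\<^sup>2)"
  using nn_integral_eq_integral[OF L2_square_integrable[OF assms]] by (simp add: L2norm_def)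

text \<open>Norm bounds survive almost everywhere limits by Fatou; this hands the Cauchy estimates
  of a sequence over to its pointwise limit.\<close>

lemma L2_fatou:
  fixes u :: "nat \<Rightarrow> 'a \<Rightarrow> real"
  assumes u: "\<And>k. u k \<in> L2 M" and f: "f \<in> borel_measurable M"
    and lim: "AE x in M. (\<lambda>k. u k x) \<longlonglongrightarrow> f x"
    and bound: "\<forall>\<^sub>F k in sequentially. L2norm M (u k) \<le> C"
  shows "f \<in> L2 M" "L2norm M f \<le> C"
proof -
  have C: "0 \<le> C"
    using bound L2norm_nonneg by (metis (no_types, lifting) eventually_sequentially order_refl order_trans)
  have "(\<integral>\<^sup>+x. ennreal ((f x)\<^sup>2) \<partial>M) = (\<integral>\<^sup>+x. liminf (\<lambda>k. ennreal ((u k x)\<^sup>2)) \<partial>M)"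
  proof (rule nn_integral_cong_AE, use lim in eventually_elim)
    fix x assume "(\<lambda>k. u k x) \<longlonglongrightarrow> f x"
    then have "(\<lambda>k. ennreal ((u k x)\<^sup>2)) \<longlonglongrightarrow> ennreal ((f x)\<^sup>2)"
      by (intro tendsto_intros)
    then show "ennreal ((f x)\<^sup>2) = liminf (\<lambda>k. ennreal ((u k x)\<^sup>2))"
      by (intro lim_imp_Liminf[symmetric]) simp_all
  qed
  also have "\<dots> \<le> liminf (\<lambda>k. \<integral>\<^sup>+x. ennreal ((u k x)\<^sup>2) \<partial>M)"
    using L2_measurable[OF u] by (intro nn_integral_liminf) auto
  also have "\<dots> = liminf (\<lambda>k. ennreal ((L2norm M (u k))\<^sup>2))"
    using L2norm_sq_nn_integral[OF u] by simp
  also have "\<dots> \<le> liminf (\<lambda>k. ennreal (C\<^sup>2))"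
    using bound by (intro Liminf_mono) (auto elim!: eventually_mono intro!: ennreal_leI power_mono L2norm_nonneg)
  also have "\<dots> = ennreal (C\<^sup>2)" by (simp add: Liminf_const)
  finally have *: "(\<integral>\<^sup>+x. ennreal ((f x)\<^sup>2) \<partial>M) \<le> ennreal (C\<^sup>2)" .
  show "f \<in> L2 M" using L2_nn_integral(1)[OF f *] by simp
  show "L2norm M f \<le> C"
    using L2_nn_integral(2)[OF f *] C by (simp add: abs_le_square_iff[symmetric] L2norm_nonneg)
qed

section \<open>Completeness of the space of square integrable functions\<close>

definition L2_inner :: "'a measure \<Rightarrow> ('a \<Rightarrow> real) \<Rightarrow> ('a \<Rightarrow> real) \<Rightarrow> real" where
  "L2_inner M f g = (\<integral>x. f x * g x \<partial>M)"

interpretation L2: semi_inner_space "L2 M" "L2_inner M" for M :: "'a measure"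
proof
  show "subspace (L2 M :: ('a \<Rightarrow> real) set)" by (rule subspace_L2)
qed (auto simp: L2_inner_def mult.commute distrib_right distrib_left L2_mult_integrable mult.left_commute)

lemma L2_nrm: "L2.nrm M f = L2norm M f"
  by (simp add: L2.nrm_def L2norm_def L2_inner_def power2_eq_square)

lemmas L2_inner_Cauchy_Schwarz = L2.Cauchy_Schwarz[unfolded L2_nrm]

text \<open>Weighted by 2^n, the integrals of the squared increments are still bounded by a
  geometric series. Pointwise finiteness of the weighted sum forces the increments to decay like the
  n-th power of sqrt (1/2), so the telescoping series converges absolutely at almost every
  point.\<close>

lemma L2_AE_convergent_of_fast:
  fixes s :: "nat \<Rightarrow> 'a \<Rightarrow> real"
  assumes s: "\<And>n. s n \<in> L2 M" and fast: "\<And>n. L2norm M (s (Suc n) - s n) \<le> (1/2) ^ n"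
  shows "AE x in M. convergent (\<lambda>n. s n x)"
proof -
  define d where "d n = s (Suc n) - s n" for n
  have d: "d n \<in> L2 M" for n using s by (simp add: d_def L2.mem)
  have "(\<integral>\<^sup>+x. (\<Sum>n. ennreal (2 ^ n * (d n x)\<^sup>2)) \<partial>M) = (\<Sum>n. \<integral>\<^sup>+x. ennreal (2 ^ n * (d n x)\<^sup>2) \<partial>M)"
    using L2_measurable[OF d] by (intro nn_integral_suminf) auto
  also have "\<dots> \<le> (\<Sum>n. ennreal ((1/2) ^ n))"
  proof (intro suminf_le summableI)
    fix n
    have "(\<integral>\<^sup>+x. ennreal (2 ^ n * (d n x)\<^sup>2) \<partial>M) = ennreal (2 ^ n) * ennreal ((L2norm M (d n))\<^sup>2)"
      using L2_measurable[OF d] by (simp add: ennreal_mult nn_integral_cmult L2norm_sq_nn_integral[OF d])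
    also have "\<dots> \<le> ennreal (2 ^ n) * ennreal (((1/2) ^ n)\<^sup>2)"
      using fast[of n] by (intro mult_left_mono ennreal_leI power_mono L2norm_nonneg) (auto simp: d_def)
    also have "\<dots> = ennreal ((1/2) ^ n)"
      by (simp add: ennreal_mult[symmetric] power2_eq_square power_one_over)
    finally show "(\<integral>\<^sup>+x. ennreal (2 ^ n * (d n x)\<^sup>2) \<partial>M) \<le> ennreal ((1/2) ^ n)" .
  qed
  also have "\<dots> < \<infinity>"
    by (subst suminf_ennreal2) (auto intro: summable_geometric)
  finally have "AE x in M. (\<Sum>n. ennreal (2 ^ n * (d n x)\<^sup>2)) \<noteq> \<infinity>"
    using L2_measurable[OF d] by (intro nn_integral_PInf_AE) auto
  then show ?thesis
  proof eventually_elim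
    fix x assume fin: "(\<Sum>n. ennreal (2 ^ n * (d n x)\<^sup>2)) \<noteq> \<infinity>"
    define S where "S = (\<Sum>n. 2 ^ n * (d n x)\<^sup>2)"
    have summ: "summable (\<lambda>n. 2 ^ n * (d n x)\<^sup>2)"
      using fin by (intro summable_suminf_not_top) (auto simp: infinity_ennreal_def)
    have "\<bar>d n x\<bar> \<le> sqrt S * (sqrt (1/2)) ^ n" for n
    proof -
      have "2 ^ n * (d n x)\<^sup>2 \<le> S"
        unfolding S_def using sum_le_suminf[OF summ, of "{n}"] by simp
      then have "(d n x)\<^sup>2 \<le> S * (1/2) ^ n"
        by (simp add: field_simps power_one_over)
      then have "sqrt ((d n x)\<^sup>2) \<le> sqrt (S * (1/2) ^ n)" by (rule real_sqrt_le_mono)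
      then show ?thesis by (simp only: real_sqrt_mult real_sqrt_power[of "1/2"] real_sqrt_abs)
    qed
    then have bound: "norm (d n x) \<le> sqrt S * (sqrt (1/2)) ^ n" for n by simp
    have "summable (\<lambda>n. sqrt S * (sqrt (1/2)) ^ n)"
      by (intro summable_mult summable_geometric) (simp add: real_sqrt_divide)
    then have "summable (\<lambda>n. d n x)"
      by (rule summable_comparison_test'[where N = 0]) (rule bound)
    then have "summable (\<lambda>n. s (Suc n) x - s n x)" by (simp add: d_def)
    then have "convergent (\<lambda>n. \<Sum>i<n. s (Suc i) x - s i x)"
      by (simp add: summable_iff_convergent)
    then have "convergent (\<lambda>n. s n x - s 0 x)"
      using sum_lessThan_telescope[of "\<lambda>i. s i x"] by simp
    then have "convergent (\<lambda>n. (s n x - s 0 x) + s 0 x)"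
      by (intro convergent_add convergent_const)
    then show "convergent (\<lambda>n. s n x)" by simp
  qed
qed

text \<open>Riesz-Fischer: a fast subsequence converges almost everywhere, and
  \<open>L2_fatou\<close> turns the Cauchy bounds into bounds on the distance to the limit.\<close>

interpretation L2: semi_hilbert_space "L2 M" "L2_inner M" for M :: "'a measure"
proof
  fix s :: "nat \<Rightarrow> 'a \<Rightarrow> real"
  assume s: "\<And>n. s n \<in> L2 M"
    and cauchy: "\<And>\<epsilon>. \<epsilon> > 0 \<Longrightarrow> \<exists>N. \<forall>m\<ge>N. \<forall>n\<ge>N. L2.nrm M (s m - s n) < \<epsilon>"
  have "\<exists>N. \<forall>m\<ge>N. \<forall>n\<ge>N. L2norm M (s m - s n) < (1/2) ^ k" for k
    using cauchy[of "(1/2) ^ k"] by (simp add: L2_nrm)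
  then obtain N where N: "\<And>k m n. m \<ge> N k \<Longrightarrow> n \<ge> N k \<Longrightarrow> L2norm M (s m - s n) < (1/2) ^ k"
    by metis
  \<comment> \<open>The partial sums make \<open>r\<close> monotone and at least \<open>N k\<close>;
    the summand k makes it unbounded.\<close>
  define r where "r k = (\<Sum>i\<le>k. N i) + k" for k
  have r: "N k \<le> r k" "r k \<le> r (Suc k)" "k \<le> r k" for k
    using member_le_sum[of k "{..k}" N] by (auto simp: r_def)
  have "AE x in M. convergent (\<lambda>k. s (r k) x)"
  proof (rule L2_AE_convergent_of_fast)
    show "L2norm M (s (r (Suc k)) - s (r k)) \<le> (1/2) ^ k" for k
      using N[of k "r (Suc k)" "r k"] r(1)[of k] r(2)[of k] by linarith
  qed (use s in simp)
  then have ae: "AE x in M. (\<lambda>k. s (r k) x) \<longlonglongrightarrow> lim (\<lambda>k. s (r k) x)"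
    by (simp add: convergent_LIMSEQ_iff)
  define f where "f x = lim (\<lambda>k. s (r k) x)" for x
  have f_meas: "f \<in> borel_measurable M"
    unfolding f_def using L2_measurable[OF s] by (intro borel_measurable_lim_metric) auto
  have close: "s n - f \<in> L2 M \<and> L2norm M (s n - f) \<le> (1/2) ^ k" if n: "n \<ge> N k" for n k
  proof -
    have 1: "s n - s (r j) \<in> L2 M" for j using s by (simp add: L2.mem)
    have 2: "s n - f \<in> borel_measurable M"
      using L2_measurable[OF s] f_meas by (simp add: fun_diff_def)
    have 3: "AE x in M. (\<lambda>j. (s n - s (r j)) x) \<longlonglongrightarrow> (s n - f) x"
      using ae by eventually_elim (auto simp: f_def intro!: tendsto_intros)
    have 4: "\<forall>\<^sub>F j in sequentially. L2norm M (s n - s (r j)) \<le> (1/2) ^ k"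
      using eventually_ge_at_top[of "N k"]
    proof eventually_elim
      fix j assume "N k \<le> j"
      then show "L2norm M (s n - s (r j)) \<le> (1/2) ^ k"
        using N[of k n "r j"] n r(3)[of j] by linarith
    qed
    show ?thesis using L2_fatou[OF 1 2 3 4] by blast
  qed
  have fL2: "f \<in> L2 M"
    using L2.mem_diff[OF s[of "N 0"] conjunct1[OF close[of 0 "N 0"]]] by simp
  have "(\<lambda>n. L2norm M (s n - f)) \<longlonglongrightarrow> 0"
  proof (rule LIMSEQ_I)
    fix \<epsilon> :: real assume "\<epsilon> > 0"
    then obtain k where k: "(1/2) ^ k < \<epsilon>" using real_arch_pow_inv[of \<epsilon> "1/2"] by auto
    have "norm (L2norm M (s n - f) - 0) < \<epsilon>" if "n \<ge> N k" for n
      using close[OF that] k L2norm_nonneg[of M "s n - f"] by simp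
    then show "\<exists>no. \<forall>n\<ge>no. norm (L2norm M (s n - f) - 0) < \<epsilon>" by blast
  qed
  then show "\<exists>x\<in>L2 M. (\<lambda>n. L2.nrm M (s n - x)) \<longlonglongrightarrow> 0"
    using fL2 by (auto simp: L2_nrm)
qed

lemma L2norm_eq_0:
  fixes f :: "'a \<Rightarrow> real"
  assumes "f \<in> L2 M" "L2norm M f = 0"
  shows "AE x in M. f x = 0"
  using integral_nonneg_eq_0_iff_AE[OF L2_square_integrable[OF assms(1)]] assms(2)
  by (simp add: L2norm_def)

lemma continuous_bounded_support_L2:
  fixes \<phi> :: "'a::euclidean_space \<Rightarrow> real"
  assumes "continuous_on UNIV \<phi>" "bounded S" "\<And>x. x \<notin> S \<Longrightarrow> \<phi> x = 0"
  shows "\<phi> \<in> L2 lborel" "integrable lborel \<phi>"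
proof -
  obtain a where a: "S \<subseteq> cbox (-a) a" using bounded_subset_cbox_symmetric[OF assms(2)] .
  have "integrable lborel (\<lambda>x. indicator (cbox (-a) a) x *\<^sub>R (\<phi> x)\<^sup>2)"
    "integrable lborel (\<lambda>x. indicator (cbox (-a) a) x *\<^sub>R \<phi> x)"
    by (intro borel_integrable_compact compact_cbox continuous_intros continuous_on_subset[OF assms(1)] subset_UNIV)+
  moreover have "(\<lambda>x. indicator (cbox (-a) a) x *\<^sub>R (\<phi> x)\<^sup>2) = (\<lambda>x. (\<phi> x)\<^sup>2)"
    "(\<lambda>x. indicator (cbox (-a) a) x *\<^sub>R \<phi> x) = \<phi>"
    using a assms(3) by (force simp: indicator_def fun_eq_iff)+
  ultimately show "\<phi> \<in> L2 lborel" "integrable lborel \<phi>"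
    using borel_measurable_continuous_onI[OF assms(1)] by (auto simp: L2_real_iff)
qed

lemma test_function_Ck: "test_function \<phi> \<Longrightarrow> Ck k \<phi>"
  by (simp add: test_function_def C_infinity_def)

lemma test_function_bounded_support:
  assumes "test_function \<phi>"
  obtains S where "bounded S" "\<And>x. x \<notin> S \<Longrightarrow> \<phi> x = 0"
proof (rule that)
  show "bounded (closure {x. \<phi> x \<noteq> 0})"
    using assms by (simp add: test_function_def compact_imp_bounded)
  show "\<phi> x = 0" if "x \<notin> closure {x. \<phi> x \<noteq> 0}" for x
    using that closure_subset[of "{x. \<phi> x \<noteq> 0}"] by auto
qed

lemma test_function_L2:
  assumes "test_function \<phi>" shows "\<phi> \<in> L2 lborel"
proof -
  obtain S where "bounded S" "\<And>x. x \<notin> S \<Longrightarrow> \<phi> x = 0"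
    by (rule test_function_bounded_support[OF assms]) (rule that)
  then show ?thesis
    using continuous_bounded_support_L2(1) Ck_continuous[OF test_function_Ck[OF assms, of 0]] by blast
qed

lemma subspace_test_function: "subspace (Collect test_function)"
  unfolding subspace_def
proof (intro conjI ballI allI)
  show "0 \<in> Collect (test_function :: (real^'a \<Rightarrow> real) \<Rightarrow> bool)"
    using Ck_const[of _ 0] by (auto intro!: test_functionI[of _ "{}"] simp: zero_fun_def)
next
  fix f g :: "real^'a \<Rightarrow> real" assume fg: "f \<in> Collect test_function" "g \<in> Collect test_function"
  obtain S where S: "bounded S" "\<And>x. x \<notin> S \<Longrightarrow> f x = 0"
    by (rule test_function_bounded_support[OF fg(1)[simplified]]) (rule that)
  obtain T where T: "bounded T" "\<And>x. x \<notin> T \<Longrightarrow> g x = 0"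
    by (rule test_function_bounded_support[OF fg(2)[simplified]]) (rule that)
  have "test_function (\<lambda>x. f x + g x)"
    by (rule test_functionI[of _ "S \<union> T"]) (use fg S T in \<open>auto intro: Ck_add simp: test_function_Ck\<close>)
  then show "f + g \<in> Collect test_function" by (simp add: plus_fun_def)
next
  fix c and f :: "real^'a \<Rightarrow> real" assume f: "f \<in> Collect test_function"
  obtain S where S: "bounded S" "\<And>x. x \<notin> S \<Longrightarrow> f x = 0"
    by (rule test_function_bounded_support[OF f[simplified]]) (rule that)
  have "test_function (\<lambda>x. c *\<^sub>R f x)"
    by (rule test_functionI[of _ S]) (use f S in \<open>auto intro: Ck_mult Ck_const simp: test_function_Ck\<close>)
  then show "c *\<^sub>R f \<in> Collect test_function" by (simp add: scaleR_fun_def)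
qed

section \<open>The fundamental lemma of the calculus of variations, and density of test
  functions\<close>

lemma indicator_L2:
  assumes "A \<in> sets M" "emeasure M A < \<infinity>"
  shows "(indicator A :: 'a \<Rightarrow> real) \<in> L2 M"
proof -
  have "(\<lambda>x. (indicator A x :: real)\<^sup>2) = indicator A" by (auto simp: fun_eq_iff indicator_def)
  then show ?thesis using assms by (simp add: L2_real_iff)
qed

text \<open>\<open>ennreal\<close> cuts off negative values, so \<open>g\<close> and
  \<open>- g\<close> as densities give the positive and the negative part of \<open>g\<close>. The
  two measures agree on open boxes, a generator stable under intersection, hence everywhere;
  equality of the densities then forces both parts to vanish.\<close>

lemma AE_zero_of_box_integrals:
  fixes g :: "real^'n \<Rightarrow> real"
  assumes g: "g \<in> L2 lborel" and zero: "\<And>a b. (\<integral>x. g x * indicator (box a b) x \<partial>lborel) = 0"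
  shows "AE x in lborel. g x = 0"
proof -
  have meas [measurable]: "g \<in> borel_measurable borel" using L2_measurable[OF g] by simp
  define P where "P = density lborel (\<lambda>x. ennreal (g x))"
  define Q where "Q = density lborel (\<lambda>x. ennreal (- g x))"
  have ind: "(indicator (box a b) :: _ \<Rightarrow> real) \<in> L2 lborel" for a b :: "real^'n"
    by (rule indicator_L2) (auto simp: emeasure_lborel_box_eq)
  have int: "integrable lborel (\<lambda>x. g x * indicator (box a b) x)" for a b
    by (rule L2_mult_integrable[OF g ind])
  have fin: "emeasure P (box a b) < \<infinity>" and eq: "emeasure P (box a b) = emeasure Q (box a b)" for a b
  proof -
    let ?h = "\<lambda>x. g x * indicator (box a b) x"
    have P: "emeasure P (box a b) = (\<integral>\<^sup>+x. ennreal (?h x) \<partial>lborel)"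
      unfolding P_def by (subst emeasure_density) (auto intro!: nn_integral_cong simp: indicator_def)
    have Q: "emeasure Q (box a b) = (\<integral>\<^sup>+x. ennreal (- ?h x) \<partial>lborel)"
      unfolding Q_def by (subst emeasure_density) (auto intro!: nn_integral_cong simp: indicator_def)
    have finite: "(\<integral>\<^sup>+x. ennreal (?h x) \<partial>lborel) < \<infinity>" "(\<integral>\<^sup>+x. ennreal (- ?h x) \<partial>lborel) < \<infinity>"
      using int[of a b] by (auto simp: real_integrable_def less_top)
    show "emeasure P (box a b) < \<infinity>" using finite P by simp
    have "enn2real (\<integral>\<^sup>+x. ennreal (?h x) \<partial>lborel) = enn2real (\<integral>\<^sup>+x. ennreal (- ?h x) \<partial>lborel)"
      using real_lebesgue_integral_def[OF int, of a b] zero[of a b] by simp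
    then show "emeasure P (box a b) = emeasure Q (box a b)"
      unfolding P Q using finite by (metis ennreal_enn2real infinity_ennreal_def)
  qed
  have "P = Q"
  proof (rule measure_eqI_generator_eq)
    let ?E = "range (\<lambda>(a, b). box a b :: (real^'n) set)"
    have mem: "box a b \<in> ?E" for a b by (rule range_eqI[of _ _ "(a, b)"]) simp
    show "Int_stable ?E"
    proof (rule Int_stableI)
      fix A C assume "A \<in> ?E" "C \<in> ?E"
      then obtain a b c d where "A = box a b" "C = box c d" by auto
      then show "A \<inter> C \<in> ?E" using mem by (simp only: box_Int_box)
    qed
    show "?E \<subseteq> Pow UNIV" by simp
    show "range (\<lambda>n::nat. box (- (real n *\<^sub>R One)) (real n *\<^sub>R One) :: (real^'n) set) \<subseteq> ?E" using mem by blast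
    show "(\<Union>n::nat. box (- (real n *\<^sub>R One)) (real n *\<^sub>R One) :: (real^'n) set) = UNIV"
      using UN_box_eq_UNIV by (simp add: scaleR_minus_right)
    show "sets P = sigma_sets UNIV ?E" "sets Q = sigma_sets UNIV ?E"
      by (simp_all add: P_def Q_def borel_eq_box)
    show "emeasure P X = emeasure Q X" if "X \<in> ?E" for X using that eq by auto
    show "emeasure P (box (- (real n *\<^sub>R One)) (real n *\<^sub>R One)) \<noteq> \<infinity>" for n
      using fin[of "- (real n *\<^sub>R One)" "real n *\<^sub>R One"] by simp
  qed
  then have "AE x in lborel. ennreal (g x) = ennreal (- g x)"
    unfolding P_def Q_def by (intro sigma_finite_measure.density_unique[OF sigma_finite_lborel]) auto
  then show ?thesis
    by eventually_elim (metis ennreal_eq_0_iff ennreal_inj linorder_le_cases neg_0_le_iff_le neg_le_0_iff_le order_antisym)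
qed

lemma AE_zero_of_test_functions:
  fixes g :: "real^'n \<Rightarrow> real"
  assumes g: "g \<in> L2 lborel" and zero: "\<And>\<phi>. test_function \<phi> \<Longrightarrow> (\<integral>x. g x * \<phi> x \<partial>lborel) = 0"
  shows "AE x in lborel. g x = 0"
proof (rule AE_zero_of_box_integrals[OF g])
  fix a b :: "real^'n"
  have [measurable]: "g \<in> borel_measurable borel" using L2_measurable[OF g] by simp
  have ind: "(indicator (box a b) :: _ \<Rightarrow> real) \<in> L2 lborel"
    by (rule indicator_L2) (auto simp: emeasure_lborel_box_eq)
  have "(\<lambda>n. \<integral>x. g x * box_bump a b n x \<partial>lborel) \<longlonglongrightarrow> (\<integral>x. g x * indicator (box a b) x \<partial>lborel)"
  proof (rule integral_dominated_convergence)
    show "integrable lborel (\<lambda>x. norm (g x * indicator (box a b) x))"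
      by (intro integrable_norm L2_mult_integrable[OF g ind])
    show "AE x in lborel. (\<lambda>n. g x * box_bump a b n x) \<longlonglongrightarrow> g x * indicator (box a b) x"
      by (intro AE_I2 tendsto_intros box_bump_tendsto)
    show "AE x in lborel. norm (g x * box_bump a b n x) \<le> norm (g x * indicator (box a b) x)" for n
    proof (rule AE_I2)
      fix x
      show "norm (g x * box_bump a b n x) \<le> norm (g x * indicator (box a b) x)"
        using box_bump_bounds[of a b n x] box_bump_zero[of x a b n]
        by (cases "x \<in> box a b") (auto simp: abs_mult intro: mult_left_le)
    qed
    show "(\<lambda>x. g x * box_bump a b n x) \<in> borel_measurable lborel" for n
      using L2_measurable[OF test_function_L2[OF test_function_box_bump[of a b n]]] by simp
  qed simp
  then show "(\<integral>x. g x * indicator (box a b) x \<partial>lborel) = 0"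
    using zero[OF test_function_box_bump] by (simp add: LIMSEQ_const_iff)
qed

text \<open>Orthogonal projection instead of mollification: Riesz inside the closure
  \<open>C\<close> of the test functions yields \<open>c\<close> such that \<open>f - c\<close> is
  orthogonal to every test function and therefore null. What approximates \<open>c\<close>
  approximates \<open>f\<close>.\<close>

lemma test_functions_dense:
  fixes f :: "real^'n \<Rightarrow> real"
  assumes f: "f \<in> L2 lborel" and \<epsilon>: "\<epsilon> > 0"
  obtains \<phi> where "test_function \<phi>" "L2norm lborel (f - \<phi>) < \<epsilon>"
proof -
  define C where "C = {f \<in> L2 lborel. \<forall>\<epsilon>>0. \<exists>\<phi>\<in>Collect (test_function :: (real^'n \<Rightarrow> real) \<Rightarrow> bool). L2.nrm lborel (f - \<phi>) < \<epsilon>}"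
  interpret C: semi_hilbert_space C "L2_inner lborel"
    unfolding C_def by (rule L2.semi_hilbert_closure) (auto intro: subspace_test_function test_function_L2)
  have CL2: "h \<in> L2 lborel" if "h \<in> C" for h using that by (simp add: C_def)
  have test_C: "\<phi> \<in> C" if "test_function \<phi>" for \<phi>
    using that test_function_L2[OF that] by (auto simp: C_def L2_nrm L2norm_def intro!: exI[of _ \<phi>])
  obtain c where c: "c \<in> C" "\<And>h. h \<in> C \<Longrightarrow> L2_inner lborel c h = L2_inner lborel f h"
  proof (rule C.riesz_representation[of "L2_inner lborel f" "L2norm lborel f"])
    show "\<bar>L2_inner lborel f x\<bar> \<le> L2norm lborel f * C.nrm x" if "x \<in> C" for x
      using L2_inner_Cauchy_Schwarz[OF f CL2[OF that]] by (simp add: C.nrm_def L2.nrm_def flip: L2_nrm)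
  qed (use f CL2 in \<open>auto simp: L2.bilinear\<close>)
  have "AE x in lborel. (f - c) x = 0"
  proof (rule AE_zero_of_test_functions)
    show "f - c \<in> L2 lborel" using f CL2[OF c(1)] by (simp add: L2.mem)
    show "(\<integral>x. (f - c) x * \<phi> x \<partial>lborel) = 0" if "test_function \<phi>" for \<phi>
      using c(2)[OF test_C[OF that]] L2.diff_left[OF f CL2[OF c(1)] test_function_L2[OF that]]
      by (simp add: L2_inner_def)
  qed
  then have ae: "AE x in lborel. f x = c x" by simp
  obtain \<phi> where \<phi>: "test_function \<phi>" "L2norm lborel (c - \<phi>) < \<epsilon>"
    using c(1) \<epsilon> by (auto simp: C_def L2_nrm)
  have "L2norm lborel (f - \<phi>) = L2norm lborel (c - \<phi>)"
  proof (rule L2_cong_AE(2))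
    show "c - \<phi> \<in> L2 lborel" using CL2[OF c(1)] test_function_L2[OF \<phi>(1)] by (simp add: L2.mem)
    show "f - \<phi> \<in> borel_measurable lborel"
      using L2_measurable[OF L2.mem_diff[OF f test_function_L2[OF \<phi>(1)]]] .
  qed (use ae in auto)
  then show ?thesis using \<phi> that by simp
qed

section \<open>Horizontal curves reach every direction\<close>

text \<open>The mean value inequality, applied to \<open>f\<close> minus its derivative at
  \<open>c\<close>. The gain is that both \<open>x\<close> and \<open>y\<close> move: the error is
  relative to their distance, not to the distance from \<open>c\<close>.\<close>

lemma C1_strict_derivative:
  fixes f :: "'a::euclidean_space \<Rightarrow> 'b::real_normed_vector"
  assumes "Ck 1 f" "\<epsilon> > 0"
  obtains \<delta> where "\<delta> > 0" "\<And>x y. x \<in> ball c \<delta> \<Longrightarrow> y \<in> ball c \<delta> \<Longrightarrow>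
    norm (f x - f y - frechet_derivative f (at c) (x - y)) \<le> \<epsilon> * norm (x - y)"
proof -
  define D where "D x = frechet_derivative f (at x)" for x
  have der: "(f has_derivative D x) (at x)" for x
    using assms(1) Ck_SucD(1)[of 0 f x] by (simp add: D_def)
  have cont: "continuous_on UNIV (\<lambda>x. D x v)" for v
    using assms(1) Ck_SucD(2)[of 0 f v] by (simp add: D_def)
  \<comment> \<open>The operator norm is estimated through the values on the \<open>DIM('a)\<close>
    basis vectors.\<close>
  define \<epsilon>' where "\<epsilon>' = \<epsilon> / DIM('a)"
  have \<epsilon>': "\<epsilon>' > 0" using assms(2) by (simp add: \<epsilon>'_def)
  have "\<forall>\<^sub>F x in nhds c. \<forall>b\<in>Basis. dist (D x b) (D c b) < \<epsilon>'"
  proof (intro eventually_ball_finite ballI finite_Basis)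
    fix b :: 'a
    have "isCont (\<lambda>x. D x b) c" using cont by (simp add: continuous_on_eq_continuous_within)
    then show "\<forall>\<^sub>F x in nhds c. dist (D x b) (D c b) < \<epsilon>'"
      using \<epsilon>' by (auto simp: continuous_within tendsto_iff eventually_at_filter elim!: eventually_mono)
  qed
  then obtain \<delta> where \<delta>: "\<delta> > 0" "\<And>x b. dist x c < \<delta> \<Longrightarrow> b \<in> Basis \<Longrightarrow> dist (D x b) (D c b) < \<epsilon>'"
    unfolding eventually_nhds_metric by blast
  have "norm (f x - f y - D c (x - y)) \<le> \<epsilon> * norm (x - y)" if xy: "x \<in> ball c \<delta>" "y \<in> ball c \<delta>" for x y
  proof -
    interpret D0: bounded_linear "D c" using der by (rule has_derivative_bounded_linear)
    have "norm ((f x - D c x) - (f y - D c y)) \<le> \<epsilon> * norm (x - y)"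
    proof (rule differentiable_bound[OF convex_ball _ _ xy])
      fix z assume z: "z \<in> ball c \<delta>"
      show "((\<lambda>x. f x - D c x) has_derivative (\<lambda>h. D z h - D c h)) (at z within ball c \<delta>)"
        by (intro has_derivative_diff has_derivative_at_withinI[OF der] D0.has_derivative has_derivative_ident)
      interpret Dz: bounded_linear "D z" using der by (rule has_derivative_bounded_linear)
      show "onorm (\<lambda>h. D z h - D c h) \<le> \<epsilon>"
      proof (rule onorm_bound)
        fix h :: 'a
        have "D z h - D c h = (\<Sum>b\<in>Basis. (h \<bullet> b) *\<^sub>R (D z b - D c b))"
          by (subst (1 2) euclidean_representation[symmetric, of h])
            (simp add: Dz.sum Dz.scaleR D0.sum D0.scaleR sum_subtractf scaleR_diff_right)
        also have "norm \<dots> \<le> (\<Sum>b\<in>(Basis::'a set). norm h * \<epsilon>')"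
        proof (rule sum_norm_le)
          fix b :: 'a assume b: "b \<in> Basis"
          have "norm (D z b - D c b) \<le> \<epsilon>'"
            using \<delta>(2)[of z b] z b by (simp add: dist_norm norm_minus_commute)
          then show "norm ((h \<bullet> b) *\<^sub>R (D z b - D c b)) \<le> norm h * \<epsilon>'"
            using Basis_le_norm[OF b, of h] by (simp add: mult_mono)
        qed
        also have "\<dots> = \<epsilon> * norm h" by (simp add: \<epsilon>'_def)
        finally show "norm (D z h - D c h) \<le> \<epsilon> * norm h" .
      qed (use assms in simp)
    qed
    then show ?thesis by (simp add: D0.diff algebra_simps)
  qed
  then show ?thesis using \<delta>(1) that unfolding D_def by blast
qed

text \<open>Little-o bookkeeping: an error below every positive multiple of a convergent quantity
  vanishes in the limit. It serves twice in the construction of commutator curves.\<close>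

lemma tendsto_relative_error:
  fixes X Y :: "'a \<Rightarrow> 'b::real_normed_vector" and C :: "'a \<Rightarrow> real"
  assumes X: "(X \<longlongrightarrow> L) F" and C: "(C \<longlongrightarrow> c) F"
    and err: "\<And>\<epsilon>. \<epsilon> > 0 \<Longrightarrow> \<forall>\<^sub>F s in F. norm (Y s - X s) \<le> \<epsilon> * C s"
  shows "(Y \<longlongrightarrow> L) F"
proof -
  have "((\<lambda>s. Y s - X s) \<longlongrightarrow> 0) F"
  proof (rule tendstoI)
    fix e :: real assume e: "e > 0"
    have "e / (2 * (\<bar>c\<bar> + 1)) > 0" using e by (intro divide_pos_pos) auto
    from err[OF this] order_tendstoD(2)[OF C, of "\<bar>c\<bar> + 1"]
    have "\<forall>\<^sub>F s in F. norm (Y s - X s) \<le> e / (2 * (\<bar>c\<bar> + 1)) * C s \<and> C s < \<bar>c\<bar> + 1"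
      by (auto intro: eventually_conj)
    then show "\<forall>\<^sub>F s in F. dist (Y s - X s) 0 < e"
    proof eventually_elim
      fix s assume s: "norm (Y s - X s) \<le> e / (2 * (\<bar>c\<bar> + 1)) * C s \<and> C s < \<bar>c\<bar> + 1"
      have "norm (Y s - X s) \<le> e / (2 * (\<bar>c\<bar> + 1)) * C s" using s by (rule conjunct1)
      also have "\<dots> \<le> e / (2 * (\<bar>c\<bar> + 1)) * (\<bar>c\<bar> + 1)"
        using s e by (intro mult_left_mono) auto
      also have "\<dots> = e / 2" by (simp add: field_simps add_eq_0_iff)
      finally show "dist (Y s - X s) 0 < e" using e by simp
    qed
  qed
  from tendsto_add[OF this X] show ?thesis by simp
qed

lemma Pair_in_ball_zero: "norm x + norm y < \<delta> \<Longrightarrow> (x, y) \<in> ball (0, 0) \<delta>"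
  using norm_Pair_le[of "- x" "- y"] by (simp add: dist_norm)

lemma has_derivative_zero_iff_quotient:
  fixes \<gamma> :: "real \<Rightarrow> 'a::real_normed_vector"
  assumes "\<gamma> 0 = 0"
  shows "(\<gamma> has_derivative (\<lambda>t. t *\<^sub>R w)) (at 0) \<longleftrightarrow> ((\<lambda>t. \<gamma> t /\<^sub>R t) \<longlongrightarrow> w) (at 0)"
proof -
  have "(\<gamma> has_derivative (\<lambda>t. t *\<^sub>R w)) (at 0) \<longleftrightarrow>
      ((\<lambda>t. norm (\<gamma> t - \<gamma> 0 - (t - 0) *\<^sub>R w) / norm (t - 0)) \<longlongrightarrow> 0) (at 0)"
    by (simp add: has_derivative_iff_norm bounded_linear_scaleR_left)
  also have "\<dots> \<longleftrightarrow> ((\<lambda>t. norm (\<gamma> t /\<^sub>R t - w)) \<longlongrightarrow> 0) (at 0)"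
  proof (rule filterlim_cong[OF refl refl], unfold eventually_at_filter, intro always_eventually allI impI)
    fix t :: real assume "t \<noteq> 0"
    then have "\<gamma> t /\<^sub>R t - w = (\<gamma> t - \<gamma> 0 - (t - 0) *\<^sub>R w) /\<^sub>R t"
      using assms by (simp add: scaleR_diff_right)
    then show "norm (\<gamma> t - \<gamma> 0 - (t - 0) *\<^sub>R w) / norm (t - 0) = norm (\<gamma> t /\<^sub>R t - w)"
      by (simp add: divide_inverse_commute)
  qed
  finally show ?thesis by (simp add: tendsto_norm_zero_iff LIM_zero_iff)
qed

section \<open>Expansions of the group product at the identity\<close>

context homogeneous_carnot_group
begin

lemma star_zero [simp]: "star x 0 = x" "star 0 x = x"
  by (simp_all add: left_neutral right_neutral)

text \<open>In exponential coordinates inversion is negation: x and -x are the points at times 1 and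
  -1 of the same one-parameter subgroup.\<close>

lemma star_minus [simp]: "star x (- x) = 0" "star (- x) x = 0"
  using exp_coordinates[of 1 x "-1"] exp_coordinates[of "-1" x 1] by simp_all

lemma star_minus_cancel [simp]: "star (- x) (star x y) = y" "star x (star (- x) y) = y"
  "star (star y x) (- x) = y" "star (star y (- x)) x = y"
  by (simp_all flip: assoc) (simp_all add: assoc)

definition mul :: "(real^'n) \<times> (real^'n) \<Rightarrow> real^'n" where "mul = (\<lambda>(x, y). star x y)"

lemma mul_apply: "mul (x, y) = star x y"
  by (simp add: mul_def)

lemma Ck_mul: "Ck k mul"
  using smooth_star by (simp add: C_infinity_def mul_def)

lemma mul_has_derivative: "(mul has_derivative frechet_derivative mul (at p)) (at p)"
  using Ck_SucD(1)[OF Ck_mul[of "Suc 0"]] .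

lemma continuous_star: "continuous_on S f \<Longrightarrow> continuous_on S g \<Longrightarrow> continuous_on S (\<lambda>x. star (f x) (g x))"
  using continuous_on_compose2[OF Ck_continuous[OF Ck_mul] continuous_on_Pair, of S f g]
  by (simp add: mul_apply)

text \<open>At p = (x, 0) this is the left-invariant field of \<open>w\<close>. It is kept at
  general (x, y) for the mean value inequality in y and for the derivative of left
  translations.\<close>

definition rfield :: "real^'n \<Rightarrow> (real^'n) \<times> (real^'n) \<Rightarrow> real^'n" where
  "rfield w p = frechet_derivative mul (at p) (0, w)"

lemma Ck_rfield: "Ck k (rfield w)"
  unfolding rfield_def using Ck_SucD(2)[OF Ck_mul[of "Suc k"]] .

lemma star_right_has_derivative: "(star x has_derivative (\<lambda>w. rfield w (x, y))) (at y within S)"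
proof -
  have "((\<lambda>y. mul (x, y)) has_derivative (\<lambda>w. frechet_derivative mul (at (x, y)) (0, w))) (at y)"
    by (rule has_derivative_compose[OF _ mul_has_derivative])
      (auto intro!: has_derivative_Pair derivative_intros)
  then show ?thesis
    by (auto simp: mul_apply rfield_def intro: has_derivative_at_withinI)
qed

lemma left_inv_field_eq: "left_inv_field star w x = rfield w (x, 0)"
  unfolding left_inv_field_def
  using frechet_derivative_at[OF star_right_has_derivative[of x 0 UNIV]] by metis

lemma rfield_zero_left: "rfield w (0, y) = w"
proof -
  have "star 0 = (\<lambda>x. x)" by (simp add: fun_eq_iff)
  then have "((\<lambda>x. x) has_derivative (\<lambda>w. rfield w (0, y))) (at y)"
    using star_right_has_derivative[of 0 y UNIV] by simp
  from fun_cong[OF has_derivative_unique[OF this has_derivative_ident], of w] show ?thesis .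
qed

lemma rfield_basis: "rfield w p = (\<Sum>b\<in>Basis. (w \<bullet> b) *\<^sub>R rfield b p)"
proof -
  obtain x y where p: "p = (x, y)" by fastforce
  interpret bounded_linear "\<lambda>w. rfield w p"
    unfolding p using star_right_has_derivative[of x y UNIV] by (rule has_derivative_bounded_linear)
  show ?thesis
    by (subst euclidean_representation[symmetric, of w]) (simp add: sum scaleR)
qed

lemma rfield_linear: "bounded_linear (\<lambda>w. rfield w p)"
  using has_derivative_bounded_linear[OF star_right_has_derivative[of "fst p" "snd p" UNIV]] by simp

text \<open>Since 0 is neutral, both partial derivatives at the identity are the identity map;
  velocities of curves through the identity therefore add under products.\<close>

lemma mul_derivative_zero: "frechet_derivative mul (at (0, 0)) (a, b) = a + b"
proof -
  interpret bounded_linear "frechet_derivative mul (at (0, 0))"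
    using mul_has_derivative by (rule has_derivative_bounded_linear)
  have "((\<lambda>x. mul (x, 0)) has_derivative (\<lambda>a. frechet_derivative mul (at (0, 0)) (a, 0))) (at 0)"
    by (rule has_derivative_compose[OF _ mul_has_derivative])
      (auto intro!: has_derivative_Pair derivative_intros)
  then have "((\<lambda>x. x) has_derivative (\<lambda>a. frechet_derivative mul (at (0, 0)) (a, 0))) (at 0)"
    by (simp add: mul_apply)
  from fun_cong[OF has_derivative_unique[OF this has_derivative_ident], of a]
  have "frechet_derivative mul (at (0, 0)) (a, 0) = a" .
  then show ?thesis
    using rfield_zero_left[of b 0] add[of "(a, 0)" "(0, b)"] by (simp add: rfield_def)
qed

text \<open>The mixed second-order term of the product at the identity, which is a + w +
  \<open>bil a w\<close> up to smaller terms; its antisymmetrisation is the Lie bracket. The basis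
  sum reflects that smoothness is known for each \<open>rfield b\<close> with \<open>b\<close>
  fixed.\<close>

definition bil :: "real^'n \<Rightarrow> real^'n \<Rightarrow> real^'n" where
  "bil a w = (\<Sum>b\<in>Basis. (w \<bullet> b) *\<^sub>R frechet_derivative (rfield b) (at (0, 0)) (a, 0))"

lemma rfield_has_derivative: "(rfield w has_derivative frechet_derivative (rfield w) (at p)) (at p)"
  using Ck_SucD(1)[OF Ck_rfield[of "Suc 0"]] .

lemma bounded_bilinear_bil: "bounded_bilinear bil"
  unfolding bilinear_conv_bounded_bilinear[symmetric] bilinear_def
proof (intro conjI allI)
  fix a
  show "linear (bil a)"
    unfolding bil_def
    by (intro linear_compose_sum ballI linearI) (auto simp: inner_left_distrib scaleR_left_distrib)
next
  fix w
  have "linear (\<lambda>a. frechet_derivative (rfield b) (at (0, 0)) (a, 0))" for b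
  proof -
    interpret bounded_linear "frechet_derivative (rfield b) (at (0, 0))"
      using rfield_has_derivative by (rule has_derivative_bounded_linear)
    show ?thesis using add scaleR by (intro linearI) (fastforce simp flip: add scaleR)+
  qed
  then show "linear (\<lambda>a. bil a w)"
    unfolding bil_def by (intro linear_compose_sum ballI linear_compose_scale_right)
qed

lemma left_inv_field_has_derivative: "(left_inv_field star w has_derivative (\<lambda>a. bil a w)) (at 0)"
proof -
  have "((\<lambda>x. \<Sum>b\<in>Basis. (w \<bullet> b) *\<^sub>R rfield b (x, 0)) has_derivative
      (\<lambda>a. \<Sum>b\<in>Basis. (w \<bullet> b) *\<^sub>R frechet_derivative (rfield b) (at (0, 0)) (a, 0))) (at 0)"
    by (intro has_derivative_sum has_derivative_scaleR_right has_derivative_compose[OF _ rfield_has_derivative])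
      (auto intro!: has_derivative_Pair derivative_intros)
  moreover have "(\<lambda>x. \<Sum>b\<in>Basis. (w \<bullet> b) *\<^sub>R rfield b (x, 0)) = left_inv_field star w"
    by (simp add: left_inv_field_eq fun_eq_iff flip: rfield_basis)
  ultimately show ?thesis by (simp add: bil_def)
qed

lemma lie_bracket_eq: "lie_bracket star v w = bil v w - bil w v"
proof -
  have "frechet_derivative (left_inv_field star w) (at 0) = (\<lambda>a. bil a w)" for w
    using frechet_derivative_at[OF left_inv_field_has_derivative] by (rule sym)
  then show ?thesis
    by (simp add: lie_bracket_def vf_bracket_def left_inv_field_eq rfield_zero_left)
qed

text \<open>For fixed \<open>a\<close> the derivative of the remainder in the second argument y
  compares \<open>rfield\<close> at (a, y) with \<open>rfield\<close> at (0, y), where it is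
  constant. Strict differentiability bounds the difference by \<epsilon> times the norm of a, and
  the mean value inequality from 0 to b supplies the norm of b. Two arguments of size sqrt |s| thus
  leave an error of order o(s).\<close>

lemma star_expansion:
  assumes "\<epsilon> > 0"
  obtains \<delta> where "\<delta> > 0"
    "\<And>a b. norm a < \<delta> \<Longrightarrow> norm b < \<delta> \<Longrightarrow> norm (star a b - a - b - bil a b) \<le> \<epsilon> * (norm a * norm b)"
proof -
  define \<epsilon>' where "\<epsilon>' = \<epsilon> / DIM(real^'n)"
  have \<epsilon>': "\<epsilon>' > 0" using assms by (simp add: \<epsilon>'_def)
  have dim_\<epsilon>': "real DIM(real^'n) * \<epsilon>' = \<epsilon>"
    by (simp add: \<epsilon>'_def)
  have "\<exists>\<delta>>0. \<forall>p\<in>ball (0,0) \<delta>. \<forall>q\<in>ball (0,0) \<delta>.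
      norm (rfield e p - rfield e q - frechet_derivative (rfield e) (at (0,0)) (p - q)) \<le> \<epsilon>' * norm (p - q)" for e
    using C1_strict_derivative[OF Ck_rfield \<epsilon>', where c = "(0,0)"] by metis
  then obtain d where d: "\<And>e. d e > 0" "\<And>e p q. p \<in> ball (0,0) (d e) \<Longrightarrow> q \<in> ball (0,0) (d e) \<Longrightarrow>
      norm (rfield e p - rfield e q - frechet_derivative (rfield e) (at (0,0)) (p - q)) \<le> \<epsilon>' * norm (p - q)"
    by metis
  \<comment> \<open>Halved, because the norm of a pair is estimated by the sum of the norms.\<close>
  define \<delta> where "\<delta> = Min (d ` Basis) / 2"
  have \<delta>: "\<delta> > 0" "\<And>e. e \<in> Basis \<Longrightarrow> 2 * \<delta> \<le> d e" using d(1) by (auto simp: \<delta>_def)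
  have "norm (star a b - a - b - bil a b) \<le> \<epsilon> * (norm a * norm b)" if a: "norm a < \<delta>" and b: "norm b < \<delta>" for a b
  proof -
    interpret B: bounded_bilinear bil by (rule bounded_bilinear_bil)
    have "norm ((star a b - b - bil a b) - (star a 0 - 0 - bil a 0)) \<le> (\<epsilon> * norm a) * norm (b - 0)"
    proof (rule differentiable_bound[OF convex_ball[of 0 \<delta>]])
      fix y assume y: "y \<in> ball (0::real^'n) \<delta>"
      show "((\<lambda>y. star a y - y - bil a y) has_derivative (\<lambda>w. rfield w (a, y) - w - bil a w)) (at y within ball 0 \<delta>)"
        by (intro has_derivative_diff star_right_has_derivative has_derivative_ident
            bounded_linear.has_derivative[OF B.bounded_linear_right])
      show "onorm (\<lambda>w. rfield w (a, y) - w - bil a w) \<le> \<epsilon> * norm a"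
      proof (rule onorm_bound)
        fix w :: "real^'n"
        have eq: "rfield w (a, y) - w - bil a w = (\<Sum>e\<in>Basis. (w \<bullet> e) *\<^sub>R
            (rfield e (a, y) - rfield e (0, y) - frechet_derivative (rfield e) (at (0,0)) ((a, y) - (0, y))))"
          by (subst rfield_basis[of w "(a, y)"])
            (simp add: bil_def rfield_zero_left scaleR_diff_right sum_subtractf euclidean_representation)
        have "norm (rfield w (a, y) - w - bil a w) \<le> (\<Sum>e\<in>(Basis::(real^'n) set). norm w * (\<epsilon>' * norm a))"
          unfolding eq
        proof (rule sum_norm_le)
          fix e :: "real^'n" assume e: "e \<in> Basis"
          have small: "norm a + norm y < d e" "norm (0::real^'n) + norm y < d e"
            using a y \<delta>(2)[OF e] \<delta>(1) by auto
          note in_ball = this[THEN Pair_in_ball_zero]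
          from d(2)[OF in_ball]
          have "norm (rfield e (a, y) - rfield e (0, y) - frechet_derivative (rfield e) (at (0,0)) ((a, y) - (0, y))) \<le> \<epsilon>' * norm a"
            by simp
          then show "norm ((w \<bullet> e) *\<^sub>R (rfield e (a, y) - rfield e (0, y) - frechet_derivative (rfield e) (at (0,0)) ((a, y) - (0, y)))) \<le> norm w * (\<epsilon>' * norm a)"
            using Basis_le_norm[OF e, of w] by (simp add: mult_mono)
        qed
        also have "\<dots> = (real DIM(real^'n) * \<epsilon>') * norm a * norm w"
          by (simp only: sum_constant mult_ac)
        also have "real DIM(real^'n) * \<epsilon>' = \<epsilon>" by (rule dim_\<epsilon>')
        finally show "norm (rfield w (a, y) - w - bil a w) \<le> \<epsilon> * norm a * norm w" .
      qed (use assms in simp)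
    qed (use b \<delta>(1) in auto)
    then show ?thesis by (simp add: B.zero_right algebra_simps)
  qed
  then show ?thesis using \<delta>(1) that by blast
qed

text \<open>Strict differentiability of the product between (-q, p) and (-q, q), the latter being
  sent to 0. The error is relative to p - q, which for commutators is of smaller order than p and q
  themselves.\<close>

lemma star_minus_expansion:
  assumes "\<epsilon> > 0"
  obtains \<delta> where "\<delta> > 0"
    "\<And>p q. norm p < \<delta> \<Longrightarrow> norm q < \<delta> \<Longrightarrow> norm (star (- q) p - (p - q)) \<le> \<epsilon> * norm (p - q)"
proof -
  obtain \<delta> where \<delta>: "\<delta> > 0" "\<And>x y. x \<in> ball (0,0) \<delta> \<Longrightarrow> y \<in> ball (0,0) \<delta> \<Longrightarrow>
    norm (mul x - mul y - frechet_derivative mul (at (0,0)) (x - y)) \<le> \<epsilon> * norm (x - y)"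
    using C1_strict_derivative[OF Ck_mul assms] by metis
  show ?thesis
  proof (rule that[of "\<delta> / 2"])
    fix p q :: "real^'n" assume pq: "norm p < \<delta> / 2" "norm q < \<delta> / 2"
    have "(- q, p) \<in> ball (0,0) \<delta>" "(- q, q) \<in> ball (0,0) \<delta>"
      by (rule Pair_in_ball_zero, use pq in simp)+
    from \<delta>(2)[OF this] show "norm (star (- q) p - (p - q)) \<le> \<epsilon> * norm (p - q)"
      by (simp add: mul_apply mul_derivative_zero)
  qed (use \<delta> in simp)
qed

end

text \<open>\<open>\<F>\<close> abstracts a notion of smallness of group elements, a priori weaker than closeness to the
  identity.\<close>

locale carnot_filter = homogeneous_carnot_group star ginv wt r
  for star :: "real^'n \<Rightarrow> real^'n \<Rightarrow> real^'n" and ginv wt r +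
  fixes \<F> :: "(real^'n) filter" and B :: "(real^'n) set"
  assumes filter_star: "filterlim (\<lambda>(x, y). star x y) \<F> (\<F> \<times>\<^sub>F \<F>)"
    and filter_minus: "filterlim uminus \<F> \<F>"
    and filter_zero: "eventually P \<F> \<Longrightarrow> P 0"
    and filter_horizontal: "v \<in> B \<Longrightarrow> filterlim (\<lambda>t. t *\<^sub>R v) \<F> (nhds 0)"
    and span_B: "span B = layer wt 1"
begin

section \<open>Curves that tend to the identity along the filter, and their commutators\<close>

lemma filterlim_star:
  "filterlim f \<F> F \<Longrightarrow> filterlim g \<F> F \<Longrightarrow> filterlim (\<lambda>s. star (f s) (g s)) \<F> F"
  using filterlim_compose[OF filter_star filterlim_Pair[of f \<F> F g \<F>]] by simp

lemma filterlim_minus: "filterlim f \<F> F \<Longrightarrow> filterlim (\<lambda>s. - f s) \<F> F"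
  using filterlim_compose[OF filter_minus] by blast

lemma filterlim_zero: "filterlim (\<lambda>_. 0) \<F> F"
  unfolding filterlim_iff
proof (intro allI impI)
  fix P assume "eventually P \<F>"
  from filter_zero[OF this] show "\<forall>\<^sub>F x in F. P 0" by simp
qed

text \<open>These are the properties that survive forming commutators at square-root times:
  continuity everywhere, a derivative at time 0 only, and smallness in the sense of the filter.
  Continuity feeds the topological inverse mapping argument at the end.\<close>

definition admissible_curve :: "(real \<Rightarrow> real^'n) \<Rightarrow> real^'n \<Rightarrow> bool" where
  "admissible_curve \<gamma> w \<longleftrightarrow> continuous_on UNIV \<gamma> \<and> \<gamma> 0 = 0 \<and> (\<gamma> has_derivative (\<lambda>t. t *\<^sub>R w)) (at 0) \<and>
     filterlim \<gamma> \<F> (nhds 0)"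

lemma has_derivative_star_zero:
  assumes "(f has_derivative f') (at x)" "(g has_derivative g') (at x)" "f x = 0" "g x = 0"
  shows "((\<lambda>x. star (f x) (g x)) has_derivative (\<lambda>h. f' h + g' h)) (at x)"
proof -
  have "((\<lambda>x. mul (f x, g x)) has_derivative (\<lambda>h. frechet_derivative mul (at (f x, g x)) (f' h, g' h))) (at x)"
    by (rule has_derivative_compose[OF has_derivative_Pair[OF assms(1,2)] mul_has_derivative])
  then show ?thesis using assms by (simp add: mul_apply mul_derivative_zero)
qed

lemma admissible_add:
  "admissible_curve \<gamma> v \<Longrightarrow> admissible_curve \<eta> w \<Longrightarrow> admissible_curve (\<lambda>t. star (\<gamma> t) (\<eta> t)) (v + w)"
  unfolding admissible_curve_def
  using has_derivative_star_zero[of \<gamma> _ 0 \<eta>] filterlim_star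
  by (auto intro: continuous_star simp: scaleR_right_distrib)

lemma admissible_scale:
  assumes "admissible_curve \<gamma> v" shows "admissible_curve (\<lambda>t. \<gamma> (c * t)) (c *\<^sub>R v)"
proof -
  have lim: "filterlim (\<lambda>t. c * t) (nhds 0) (nhds (0::real))"
    using tendsto_mult_left[OF tendsto_ident_at, of c "0::real"] by (auto intro!: tendsto_eq_intros simp: filterlim_ident)
  have "((\<lambda>t. \<gamma> (c * t)) has_derivative (\<lambda>t. (c * t) *\<^sub>R v)) (at 0)"
    using assms by (intro has_derivative_compose[of "\<lambda>t. c * t" "\<lambda>t. c * t" 0 UNIV \<gamma>])
      (auto simp: admissible_curve_def intro!: derivative_eq_intros)
  moreover have "continuous_on UNIV (\<lambda>t. \<gamma> (c * t))"
    using assms by (intro continuous_on_compose2[of UNIV \<gamma> UNIV "\<lambda>t. c * t"] continuous_intros)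
      (auto simp: admissible_curve_def)
  ultimately show ?thesis
    using assms filterlim_compose[OF _ lim] by (auto simp: admissible_curve_def mult.commute)
qed

lemma admissible_difference_quotient:
  assumes "admissible_curve \<gamma> w" and "filterlim \<rho> (at 0) F"
  shows "((\<lambda>s. \<gamma> (\<rho> s) /\<^sub>R \<rho> s) \<longlongrightarrow> w) F"
  using assms filterlim_compose[OF _ assms(2)]
  by (auto simp: admissible_curve_def has_derivative_zero_iff_quotient)

text \<open>The curve is the group commutator, the inverse of b a times a b, at square-root times.
  There a b and b a differ by s times the bracket up to o(s), and dividing by b a from the left
  turns the difference into a group element without changing it to first order.\<close>

lemma admissible_bracket:
  assumes \<gamma>: "admissible_curve \<gamma> v" and \<eta>: "admissible_curve \<eta> w"
  obtains \<zeta> where "admissible_curve \<zeta> (lie_bracket star v w)"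
proof -
  interpret B: bounded_bilinear bil by (rule bounded_bilinear_bil)
  \<comment> \<open>\<open>sqrt\<close> is odd, so \<open>sqrt s * sqrt \<bar>s\<bar> = s\<close> for both signs.\<close>
  define a where "a s = \<gamma> (sqrt s)" for s
  define b where "b s = \<eta> (sqrt \<bar>s\<bar>)" for s
  define p where "p s = star (a s) (b s)" for s
  define q where "q s = star (b s) (a s)" for s
  define \<zeta> where "\<zeta> s = star (- q s) (p s)" for s
  have sqrt_mult: "sqrt s * sqrt \<bar>s\<bar> = s" for s :: real
    by (cases "s \<ge> 0") (auto simp: real_sqrt_minus simp flip: real_sqrt_mult)
  have cont: "continuous_on UNIV a" "continuous_on UNIV b"
    using \<gamma> \<eta> unfolding a_def b_def admissible_curve_def
    by (auto intro!: continuous_on_compose2[of UNIV \<gamma>] continuous_on_compose2[of UNIV \<eta>] continuous_intros)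
  have contp: "continuous_on UNIV p" "continuous_on UNIV q"
    unfolding p_def q_def using cont by (auto intro: continuous_star)
  have cont\<zeta>: "continuous_on UNIV \<zeta>"
    unfolding \<zeta>_def using contp by (intro continuous_star continuous_intros)
  have zero: "a 0 = 0" "b 0 = 0" "p 0 = 0" "q 0 = 0" "\<zeta> 0 = 0"
    using \<gamma> \<eta> by (auto simp: a_def b_def p_def q_def \<zeta>_def admissible_curve_def)
  have lim0: "(f \<longlongrightarrow> 0) (at 0)" if "continuous_on UNIV f" "f 0 = 0" for f :: "real \<Rightarrow> real^'n"
    using that by (metis UNIV_I continuous_on_def)
  have small: "\<forall>\<^sub>F s in at 0. norm (f s) < \<delta>" if "continuous_on UNIV f" "f 0 = 0" "\<delta> > 0" for f :: "real \<Rightarrow> real^'n" and \<delta>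
    using tendstoD[OF lim0[OF that(1,2)] that(3)] by simp
  have sqrt_lim: "filterlim sqrt (at 0) (at 0)" "filterlim (\<lambda>s. sqrt \<bar>s\<bar>) (at 0) (at (0::real))"
    by (auto intro!: filterlim_atI tendsto_eq_intros simp: eventually_at_filter)
  have qa: "((\<lambda>s. a s /\<^sub>R sqrt s) \<longlongrightarrow> v) (at 0)" and qb: "((\<lambda>s. b s /\<^sub>R sqrt \<bar>s\<bar>) \<longlongrightarrow> w) (at 0)"
    unfolding a_def b_def
    using admissible_difference_quotient[OF \<gamma> sqrt_lim(1)] admissible_difference_quotient[OF \<eta> sqrt_lim(2)] by auto
  \<comment> \<open>Distributing 1/s over the two arguments is exact because
    \<open>sqrt s * sqrt \<bar>s\<bar>\<close> is s.\<close>
  have scale: "bil (a s) (b s) /\<^sub>R s = bil (a s /\<^sub>R sqrt s) (b s /\<^sub>R sqrt \<bar>s\<bar>)"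
    "bil (b s) (a s) /\<^sub>R s = bil (b s /\<^sub>R sqrt \<bar>s\<bar>) (a s /\<^sub>R sqrt s)" for s
  proof -
    have "inverse s = inverse (sqrt s) * inverse (sqrt \<bar>s\<bar>)"
      using sqrt_mult[of s] by (metis inverse_mult_distrib)
    then show "bil (a s) (b s) /\<^sub>R s = bil (a s /\<^sub>R sqrt s) (b s /\<^sub>R sqrt \<bar>s\<bar>)"
      "bil (b s) (a s) /\<^sub>R s = bil (b s /\<^sub>R sqrt \<bar>s\<bar>) (a s /\<^sub>R sqrt s)"
      by (simp_all add: B.scaleR_left B.scaleR_right mult.commute)
  qed
  have main: "((\<lambda>s. (bil (a s) (b s) - bil (b s) (a s)) /\<^sub>R s) \<longlongrightarrow> bil v w - bil w v) (at 0)"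
    unfolding scaleR_diff_right scale by (intro tendsto_diff B.tendsto qa qb)
  \<comment> \<open>The remainder of \<open>star_expansion\<close> is relative to the product of the
    two norms, which is |s| times a quantity with a finite limit.\<close>
  have pq: "((\<lambda>s. (p s - q s) /\<^sub>R s) \<longlongrightarrow> bil v w - bil w v) (at 0)"
  proof (rule tendsto_relative_error[OF main])
    show "((\<lambda>s. 2 * (norm (a s /\<^sub>R sqrt s) * norm (b s /\<^sub>R sqrt \<bar>s\<bar>))) \<longlongrightarrow> 2 * (norm v * norm w)) (at 0)"
      by (intro tendsto_intros qa qb)
    fix \<epsilon> :: real assume "\<epsilon> > 0"
    then obtain \<delta> where \<delta>: "\<delta> > 0"
      "\<And>a b. norm a < \<delta> \<Longrightarrow> norm b < \<delta> \<Longrightarrow> norm (star a b - a - b - bil a b) \<le> \<epsilon> * (norm a * norm b)"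
      using star_expansion by metis
    show "\<forall>\<^sub>F s in at 0. norm ((p s - q s) /\<^sub>R s - (bil (a s) (b s) - bil (b s) (a s)) /\<^sub>R s)
        \<le> \<epsilon> * (2 * (norm (a s /\<^sub>R sqrt s) * norm (b s /\<^sub>R sqrt \<bar>s\<bar>)))"
      using small[OF cont(1) zero(1) \<delta>(1)] small[OF cont(2) zero(2) \<delta>(1)]
    proof eventually_elim
      fix s assume s: "norm (a s) < \<delta>" "norm (b s) < \<delta>"
      have "norm ((p s - q s) - (bil (a s) (b s) - bil (b s) (a s))) =
          norm ((star (a s) (b s) - a s - b s - bil (a s) (b s)) - (star (b s) (a s) - b s - a s - bil (b s) (a s)))"
        by (simp add: p_def q_def algebra_simps)
      also have "\<dots> \<le> \<epsilon> * (norm (a s) * norm (b s)) + \<epsilon> * (norm (b s) * norm (a s))"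
        by (rule order_trans[OF norm_triangle_ineq4 add_mono[OF \<delta>(2)[OF s] \<delta>(2)[OF s(2,1)]]])
      also have "\<dots> = \<epsilon> * (2 * (norm (a s) * norm (b s)))" by simp
      finally have "norm ((p s - q s) - (bil (a s) (b s) - bil (b s) (a s))) / \<bar>s\<bar>
          \<le> \<epsilon> * (2 * (norm (a s) * norm (b s))) / \<bar>s\<bar>" by (rule divide_right_mono) simp
      also have "norm (a s) * norm (b s) = \<bar>s\<bar> * (norm (a s /\<^sub>R sqrt s) * norm (b s /\<^sub>R sqrt \<bar>s\<bar>))"
      proof (cases "s = 0")
        case False
        have "\<bar>s\<bar> = \<bar>sqrt s\<bar> * \<bar>sqrt \<bar>s\<bar>\<bar>" using sqrt_mult[of s] by (metis abs_mult)
        then show ?thesis using False by (simp add: field_simps)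
      qed (simp add: zero)
      also have "\<epsilon> * (2 * (\<bar>s\<bar> * (norm (a s /\<^sub>R sqrt s) * norm (b s /\<^sub>R sqrt \<bar>s\<bar>)))) / \<bar>s\<bar> =
          \<epsilon> * (2 * (norm (a s /\<^sub>R sqrt s) * norm (b s /\<^sub>R sqrt \<bar>s\<bar>)))"
        by (cases "s = 0") simp_all
      also have "norm ((p s - q s) - (bil (a s) (b s) - bil (b s) (a s))) / \<bar>s\<bar> =
          norm ((p s - q s) /\<^sub>R s - (bil (a s) (b s) - bil (b s) (a s)) /\<^sub>R s)"
        by (simp add: divide_inverse_commute flip: scaleR_diff_right)
      finally show "norm ((p s - q s) /\<^sub>R s - (bil (a s) (b s) - bil (b s) (a s)) /\<^sub>R s)
        \<le> \<epsilon> * (2 * (norm (a s /\<^sub>R sqrt s) * norm (b s /\<^sub>R sqrt \<bar>s\<bar>)))" .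
    qed
  qed
  have "((\<lambda>s. \<zeta> s /\<^sub>R s) \<longlongrightarrow> bil v w - bil w v) (at 0)"
  \<comment> \<open>The comparison quantity is the norm of the quotient (p - q)/s itself, convergent
    by \<open>pq\<close>.\<close>
  proof (rule tendsto_relative_error[OF pq tendsto_norm[OF pq]])
    fix \<epsilon> :: real assume "\<epsilon> > 0"
    then obtain \<delta> where \<delta>: "\<delta> > 0"
      "\<And>p q. norm p < \<delta> \<Longrightarrow> norm q < \<delta> \<Longrightarrow> norm (star (- q) p - (p - q)) \<le> \<epsilon> * norm (p - q)"
      using star_minus_expansion by metis
    show "\<forall>\<^sub>F s in at 0. norm (\<zeta> s /\<^sub>R s - (p s - q s) /\<^sub>R s) \<le> \<epsilon> * norm ((p s - q s) /\<^sub>R s)"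
      using small[OF contp(1) zero(3) \<delta>(1)] small[OF contp(2) zero(4) \<delta>(1)]
    proof eventually_elim
      fix s assume s: "norm (p s) < \<delta>" "norm (q s) < \<delta>"
      have "norm (\<zeta> s - (p s - q s)) / \<bar>s\<bar> \<le> \<epsilon> * norm (p s - q s) / \<bar>s\<bar>"
        unfolding \<zeta>_def by (intro divide_right_mono \<delta>(2) s) simp
      then show "norm (\<zeta> s /\<^sub>R s - (p s - q s) /\<^sub>R s) \<le> \<epsilon> * norm ((p s - q s) /\<^sub>R s)"
        by (simp add: divide_inverse_commute mult.left_commute flip: scaleR_diff_right)
    qed
  qed
  then have der: "(\<zeta> has_derivative (\<lambda>t. t *\<^sub>R lie_bracket star v w)) (at 0)"
    by (simp add: has_derivative_zero_iff_quotient zero lie_bracket_eq)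
  have "filterlim sqrt (nhds 0) (nhds 0)" "filterlim (\<lambda>s. sqrt \<bar>s\<bar>) (nhds 0) (nhds (0::real))"
    by (auto intro!: tendsto_eq_intros simp: filterlim_ident)
  then have "filterlim a \<F> (nhds 0)" "filterlim b \<F> (nhds 0)"
    using \<gamma> \<eta> filterlim_compose unfolding a_def b_def admissible_curve_def by blast+
  then have "filterlim \<zeta> \<F> (nhds 0)"
    unfolding \<zeta>_def p_def q_def by (intro filterlim_star filterlim_minus)
  then show ?thesis using that cont\<zeta> zero der unfolding admissible_curve_def by blast
qed

text \<open>Velocities of admissible curves form a subspace, by products and by rescaling time, and
  this subspace is closed under brackets. From the first layer \<open>generates\<close> climbs
  through the layers, which together contain the standard basis.\<close>

lemma admissible_everywhere: "\<exists>\<gamma>. admissible_curve \<gamma> w"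
proof -
  define A where "A = {w. \<exists>\<gamma>. admissible_curve \<gamma> w}"
  have "subspace A"
    unfolding subspace_def
  proof (intro conjI ballI allI)
    show "0 \<in> A" using filterlim_zero by (auto simp: A_def admissible_curve_def intro!: exI[of _ "\<lambda>_. 0"])
    show "x + y \<in> A" if "x \<in> A" "y \<in> A" for x y using that admissible_add unfolding A_def by blast
    show "a *\<^sub>R x \<in> A" if "x \<in> A" for a x using that admissible_scale unfolding A_def by blast
  qed
  have "B \<subseteq> A"
  proof
    fix v assume "v \<in> B"
    then have "admissible_curve (\<lambda>t. t *\<^sub>R v) v"
      using filter_horizontal
      by (auto simp: admissible_curve_def intro!: continuous_intros derivative_eq_intros)
    then show "v \<in> A" by (auto simp: A_def)
  qed
  then have layer1: "layer wt 1 \<subseteq> A"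
    using span_minimal[OF _ \<open>subspace A\<close>] span_B by metis
  have bracket: "lie_bracket star v w \<in> A" if vw: "v \<in> A" "w \<in> A" for v w
  proof -
    obtain \<gamma> \<eta> where "admissible_curve \<gamma> v" "admissible_curve \<eta> w" using vw unfolding A_def by blast
    then obtain \<zeta> where "admissible_curve \<zeta> (lie_bracket star v w)" by (rule admissible_bracket)
    then show ?thesis unfolding A_def by blast
  qed
  have layer: "layer wt i \<subseteq> A" if "1 \<le> i" "i \<le> r" for i
    using that
  proof (induction i rule: dec_induct)
    case (step i)
    then have "layer wt i \<subseteq> A" by simp
    then have "{lie_bracket star v w | v w. v \<in> layer wt 1 \<and> w \<in> layer wt i} \<subseteq> A"
      using layer1 bracket by blast
    then have "span {lie_bracket star v w | v w. v \<in> layer wt 1 \<and> w \<in> layer wt i} \<subseteq> A"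
      by (rule span_minimal[OF _ \<open>subspace A\<close>])
    then show ?case using generates[of "Suc i"] step by simp
  qed (rule layer1)
  have "axis j 1 \<in> A" for j :: 'n
  proof -
    have "wt j \<in> {1..r}" using layers by blast
    moreover have "axis j 1 \<in> layer wt (wt j)" unfolding layer_def by (rule span_base) blast
    ultimately show ?thesis using layer by auto
  qed
  then have "w \<in> A"
    using subspace_sum[OF \<open>subspace A\<close>, of UNIV "\<lambda>j. (w $ j) *\<^sub>R axis j 1"] subspace_scale[OF \<open>subspace A\<close>]
    by (simp add: basis_expansion flip: scalar_mult_eq_scaleR)
  then show ?thesis by (simp add: A_def)
qed

text \<open>The product of admissible curves in the coordinate directions is differentiable at \<open>0\<close> with
  derivative the identity, so by Brouwer it maps neighbourhoods of \<open>0\<close> onto neighbourhoods.\<close>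

theorem nhds_zero_le: "nhds 0 \<le> \<F>"
proof -
  have "\<forall>j. \<exists>\<gamma>. admissible_curve \<gamma> (axis j 1)" using admissible_everywhere by blast
  then obtain \<gamma> where \<gamma>: "\<And>j. admissible_curve (\<gamma> j) (axis j 1)" by metis
  have "\<exists>F. continuous_on UNIV F \<and> F 0 = 0 \<and> (F has_derivative (\<lambda>s. \<Sum>j\<in>J. (s $ j) *\<^sub>R axis j 1)) (at (0::real^'n)) \<and>
      filterlim F \<F> (nhds 0)" for J :: "'n set"
  proof (induction J rule: finite_induct[OF finite])
    case 1
    show ?case using filterlim_zero by (intro exI[of _ "\<lambda>_. 0"]) auto
  next
    case (2 j J)
    then obtain F where F: "continuous_on UNIV F" "F 0 = 0"
      "(F has_derivative (\<lambda>s. \<Sum>j\<in>J. (s $ j) *\<^sub>R axis j 1)) (at (0::real^'n))" "filterlim F \<F> (nhds 0)"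
      by blast
    have nth: "filterlim (\<lambda>s. s $ j) (nhds 0) (nhds (0::real^'n))"
      using tendsto_vec_nth[of "\<lambda>s::real^'n. s" 0 "nhds 0" j] by (simp add: filterlim_ident)
    have "((\<lambda>s. \<gamma> j (s $ j)) has_derivative (\<lambda>s. (s $ j) *\<^sub>R axis j 1)) (at 0)"
      using \<gamma>[of j]
      by (intro has_derivative_compose[of "\<lambda>s. s $ j" "\<lambda>s. s $ j" _ UNIV "\<gamma> j"])
        (auto simp: admissible_curve_def bounded_linear_vec_nth intro: bounded_linear_imp_has_derivative)
    then have "((\<lambda>s. star (\<gamma> j (s $ j)) (F s)) has_derivative
        (\<lambda>s. (s $ j) *\<^sub>R axis j 1 + (\<Sum>j\<in>J. (s $ j) *\<^sub>R axis j 1))) (at 0)"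
      using F \<gamma>[of j] by (intro has_derivative_star_zero) (auto simp: admissible_curve_def)
    moreover have "filterlim (\<lambda>s. star (\<gamma> j (s $ j)) (F s)) \<F> (nhds 0)"
      using F \<gamma>[of j] filterlim_compose[OF _ nth] by (intro filterlim_star) (auto simp: admissible_curve_def)
    moreover have "continuous_on UNIV (\<lambda>s. star (\<gamma> j (s $ j)) (F s))"
      using F \<gamma>[of j]
      by (intro continuous_star) (auto simp: admissible_curve_def intro!: continuous_on_compose2[of UNIV "\<gamma> j"] continuous_intros)
    ultimately show ?case
      using 2 F \<gamma>[of j] by (intro exI[of _ "\<lambda>s. star (\<gamma> j (s $ j)) (F s)"]) (auto simp: admissible_curve_def)
  qed
  from this[of UNIV] obtain F where F: "continuous_on UNIV F" "F 0 = 0" "filterlim F \<F> (nhds 0)"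
    and F_der: "(F has_derivative (\<lambda>s. \<Sum>j\<in>UNIV. (s $ j) *\<^sub>R axis j 1)) (at (0::real^'n))"
    by blast
  then have der: "(F has_derivative id) (at 0)"
    by (simp add: basis_expansion id_def flip: scalar_mult_eq_scaleR)
  show ?thesis
  proof (rule filter_leI)
    fix P assume "eventually P \<F>"
    then have "\<forall>\<^sub>F s in nhds 0. P (F s)" using F(3) by (simp add: filterlim_iff)
    then obtain T where T: "open T" "0 \<in> T" "\<And>s. s \<in> T \<Longrightarrow> P (F s)" by (auto simp: eventually_nhds)
    \<comment> \<open>A topological inverse mapping theorem: \<open>F\<close> is continuous, has an
      invertible derivative at the single point 0, and \<open>T\<close> is a neighbourhood of that
      point.\<close>
    have "F 0 \<in> interior (F ` T)"
      by (rule sussmann_open_mapping[OF open_UNIV F(1) _ der bounded_linear_ident])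
        (use T in \<open>auto simp: id_def interior_open\<close>)
    then show "eventually P (nhds 0)"
      unfolding eventually_nhds using T F(2) interior_subset[of "F ` T"]
      by (intro exI[of _ "interior (F ` T)"]) auto
  qed
qed

end

section \<open>Change of variables over an arbitrary finite index type\<close>

text \<open>The change of variables theorem of the library asks for a well-ordered index type. A copy of
  a finite type carries a well-order, and the copying is a measure preserving linear isometry.\<close>

typedef 'a well_ordered = "UNIV :: 'a set" by simp

instance well_ordered :: (finite) finite
proof
  have eq: "(UNIV :: 'a well_ordered set) = range Abs_well_ordered"
    by (metis Rep_well_ordered_inverse surjI)
  show "finite (UNIV :: 'a well_ordered set)"
    unfolding eq by (rule finite_imageI) (rule finite)
qed

instantiation well_ordered :: (finite) wellorder
begin

definition less_eq_well_ordered :: "'a well_ordered \<Rightarrow> 'a well_ordered \<Rightarrow> bool" where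
  "x \<le> y \<longleftrightarrow> to_nat (Rep_well_ordered x) \<le> to_nat (Rep_well_ordered y)"

definition less_well_ordered :: "'a well_ordered \<Rightarrow> 'a well_ordered \<Rightarrow> bool" where
  "x < y \<longleftrightarrow> to_nat (Rep_well_ordered x) < to_nat (Rep_well_ordered y)"

instance
proof
  fix P :: "'a well_ordered \<Rightarrow> bool" and a :: "'a well_ordered"
  assume step: "\<And>x. (\<And>y. y < x \<Longrightarrow> P y) \<Longrightarrow> P x"
  show "P a"
    by (induction a rule: measure_induct_rule[of "\<lambda>x :: 'a well_ordered. to_nat (Rep_well_ordered x)"])
      (auto intro: step simp: less_well_ordered_def)
qed (auto simp: less_eq_well_ordered_def less_well_ordered_def Rep_well_ordered_inject)

end

definition reindex :: "real^'n \<Rightarrow> real^('n well_ordered)" where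
  "reindex x = (\<chi> i. x $ Rep_well_ordered i)"

definition unreindex :: "real^('n well_ordered) \<Rightarrow> real^'n" where
  "unreindex y = (\<chi> j. y $ Abs_well_ordered j)"

lemma reindex_unreindex [simp]: "reindex (unreindex y) = y" "unreindex (reindex x) = x"
  by (simp_all add: reindex_def unreindex_def vec_eq_iff Rep_well_ordered_inverse Abs_well_ordered_inverse)

lemma bounded_linear_reindex: "bounded_linear reindex"
  unfolding linear_conv_bounded_linear[symmetric] by (rule linearI) (auto simp: reindex_def vec_eq_iff)

lemma bounded_linear_unreindex: "bounded_linear unreindex"
  unfolding linear_conv_bounded_linear[symmetric] by (rule linearI) (auto simp: unreindex_def vec_eq_iff)

lemma unreindex_measurable [measurable]: "unreindex \<in> borel_measurable borel"
  using borel_measurable_continuous_onI[OF linear_continuous_on[OF bounded_linear_unreindex]] .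

lemma prod_Basis_cart:
  fixes x :: "real^'n" and f :: "real \<Rightarrow> real"
  shows "(\<Prod>b\<in>Basis. f (x \<bullet> b)) = (\<Prod>i\<in>UNIV. f (x $ i))"
proof -
  have eq: "(Basis :: (real^'n) set) = range (\<lambda>i. axis i 1)" by (auto simp: Basis_vec_def)
  show ?thesis
    unfolding eq by (subst prod.reindex) (auto simp: inj_on_def axis_eq_axis inner_axis)
qed

text \<open>A Borel measure with the right values on boxes is Lebesgue measure, and copying the
  indices only permutes the side lengths in the product.\<close>

lemma distr_unreindex: "distr lborel borel unreindex = (lborel :: (real^'n) measure)"
proof (rule lborel_eqI[symmetric])
  fix l u :: "real^'n" assume le: "\<And>b. b \<in> Basis \<Longrightarrow> l \<bullet> b \<le> u \<bullet> b"
  have le': "l $ j \<le> u $ j" for j using le[of "axis j 1"] by (simp add: inner_axis)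
  have bij: "bij Rep_well_ordered"
    by (metis Abs_well_ordered_inverse Rep_well_ordered_inverse UNIV_I bijI')
  have "unreindex -` box l u = box (reindex l) (reindex u)"
  proof (intro set_eqI)
    fix y :: "real^('n well_ordered)"
    have "(\<forall>j. l $ j < y $ Abs_well_ordered j \<and> y $ Abs_well_ordered j < u $ j) \<longleftrightarrow>
        (\<forall>i. l $ Rep_well_ordered i < y $ i \<and> y $ i < u $ Rep_well_ordered i)"
      by (metis Abs_well_ordered_inverse Rep_well_ordered_inverse UNIV_I)
    then show "y \<in> unreindex -` box l u \<longleftrightarrow> y \<in> box (reindex l) (reindex u)"
      by (simp add: mem_box_cart unreindex_def reindex_def)
  qed
  then have "emeasure (distr lborel borel unreindex) (box l u) = emeasure lborel (box (reindex l) (reindex u))"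
    by (subst emeasure_distr) auto
  also have "\<dots> = (\<Prod>b\<in>Basis. (reindex u - reindex l) \<bullet> b)"
    by (rule emeasure_lborel_box) (use le' in \<open>auto simp: Basis_vec_def inner_axis reindex_def\<close>)
  also have "(\<Prod>b\<in>Basis. (reindex u - reindex l) \<bullet> b) = (\<Prod>i\<in>UNIV. (u - l) $ Rep_well_ordered i)"
    using prod_Basis_cart[of "\<lambda>x. x" "reindex u - reindex l"] by (simp add: reindex_def)
  also have "\<dots> = (\<Prod>j\<in>UNIV. (u - l) $ j)"
    using prod.reindex_bij_betw[OF bij, of "\<lambda>j. (u - l) $ j"] by simp
  also have "\<dots> = (\<Prod>b\<in>Basis. (u - l) \<bullet> b)"
    using prod_Basis_cart[of "\<lambda>x. x" "u - l"] by simp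
  finally show "emeasure (distr lborel borel unreindex) (box l u) = (\<Prod>b\<in>Basis. (u - l) \<bullet> b)" .
qed simp

text \<open>The modulus of the determinant of \<open>A\<close> in the copied coordinates, which is
  the form in which it enters the change of variables for the copied map.\<close>

definition jac_det :: "(real^'n \<Rightarrow> real^'n) \<Rightarrow> real" where
  "jac_det A = \<bar>det (matrix (\<lambda>y. reindex (A (unreindex y))))\<bar>"

lemma jac_det_pos:
  assumes A: "linear A" and C: "linear C" and inv: "\<And>x. A (C x) = x"
  shows "0 < jac_det A"
proof -
  let ?A = "\<lambda>y. reindex (A (unreindex y))" and ?C = "\<lambda>y. reindex (C (unreindex y))"
  have lin: "linear ?A" "linear ?C"
    using linear_compose[OF linear_compose[OF bounded_linear.linear[OF bounded_linear_unreindex] A]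
        bounded_linear.linear[OF bounded_linear_reindex]]
      linear_compose[OF linear_compose[OF bounded_linear.linear[OF bounded_linear_unreindex] C]
        bounded_linear.linear[OF bounded_linear_reindex]]
    by (simp_all add: o_def)
  have comp: "?A \<circ> ?C = id" using inv by (simp add: fun_eq_iff)
  have "matrix ?A ** matrix ?C = matrix (?A \<circ> ?C)"
    by (rule matrix_compose[OF lin(2,1), symmetric])
  then have "det (matrix ?A ** matrix ?C) = 1"
    unfolding comp matrix_id by simp
  then have "det (matrix ?A) * det (matrix ?C) = 1"
    by (simp add: det_mul)
  then have "det (matrix ?A) \<noteq> 0" by auto
  then show ?thesis by (simp add: jac_det_def)
qed

lemma continuous_on_jac_det:
  fixes A :: "'a::topological_space \<Rightarrow> real^'n \<Rightarrow> real^'n"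
  assumes "\<And>v. continuous_on S (\<lambda>p. A p v)"
  shows "continuous_on S (\<lambda>p. jac_det (A p))"
proof -
  have "continuous_on S (\<lambda>p. reindex (A p (unreindex (axis j 1))) $ i)" for i j
    by (intro continuous_intros bounded_linear.continuous_on[OF bounded_linear_reindex] assms)
  then show ?thesis
    unfolding jac_det_def det_def matrix_def vec_lambda_beta
    by (intro continuous_on_rabs continuous_on_sum continuous_on_mult_left continuous_on_prod)
qed

theorem change_of_variables:
  fixes g :: "real^'n \<Rightarrow> real^'n" and f :: "real^'n \<Rightarrow> real"
  assumes der: "\<And>x. (g has_derivative g' x) (at x)" and bij: "bij g"
    and f [measurable]: "f \<in> borel_measurable borel" and cont: "\<And>v. continuous_on UNIV (\<lambda>x. g' x v)"
  shows "integrable lborel (\<lambda>x. jac_det (g' x) * f (g x)) \<longleftrightarrow> integrable lborel f" (is ?I)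
    and "integrable lborel f \<Longrightarrow> (\<integral>x. jac_det (g' x) * f (g x) \<partial>lborel) = (\<integral>x. f x \<partial>lborel)"
proof -
  have g_meas [measurable]: "g \<in> borel_measurable borel"
    by (rule borel_measurable_continuous_onI)
      (simp add: continuous_on_eq_continuous_within has_derivative_continuous[OF der])
  have J_meas [measurable]: "(\<lambda>x. jac_det (g' x)) \<in> borel_measurable borel"
    by (rule borel_measurable_continuous_onI[OF continuous_on_jac_det[OF cont]])
  let ?g = "\<lambda>y. reindex (g (unreindex y))"
  let ?g' = "\<lambda>y h. reindex (g' (unreindex y) (unreindex h))"
  have der': "(?g has_derivative ?g' y) (at y within UNIV)" for y
    by (intro bounded_linear.has_derivative[OF bounded_linear_reindex]
        has_derivative_compose[OF bounded_linear_imp_has_derivative[OF bounded_linear_unreindex] der])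
  have bij_reindex: "bij reindex" "bij unreindex"
    by (rule o_bij[of unreindex], simp_all add: fun_eq_iff, rule o_bij[of reindex], simp_all add: fun_eq_iff)
  have "bij (reindex \<circ> (g \<circ> unreindex))"
    by (intro bij_comp bij bij_reindex)
  then have bij': "bij ?g" by (simp add: o_def)
  then have inj': "inj_on ?g UNIV" and "range ?g = UNIV"
    by (rule bij_is_inj, rule bij_is_surj)
  \<comment> \<open>The integrand is wrapped in \<open>real^1\<close> because the cited theorem
    treats vector-valued functions.\<close>
  then have *: "(\<lambda>y. jac_det (g' (unreindex y)) * f (g (unreindex y))) absolutely_integrable_on UNIV \<and>
      integral UNIV (\<lambda>y. jac_det (g' (unreindex y)) * f (g (unreindex y))) = b \<longleftrightarrow>
      (\<lambda>y. f (unreindex y)) absolutely_integrable_on UNIV \<and> integral UNIV (\<lambda>y. f (unreindex y)) = b" for b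
    using has_absolute_integral_change_of_variables[OF _ der' inj', of "\<lambda>y. vec (f (unreindex y)) :: real^1" "vec b"]
    by (simp add: absolutely_integrable_on_1_iff integral_on_1_eq jac_det_def)
  \<comment> \<open>Absolute integrability refers to the completed measure; for Borel functions it
    amounts to integrability for \<open>lborel\<close>.\<close>
  have AI: "h absolutely_integrable_on UNIV \<longleftrightarrow> integrable lborel h"
    and I: "integrable lborel h \<Longrightarrow> integral UNIV h = (\<integral>y. h y \<partial>lborel)"
    if [measurable]: "h \<in> borel_measurable borel" for h :: "real^('n well_ordered) \<Rightarrow> real"
  proof -
    show AI: "h absolutely_integrable_on UNIV \<longleftrightarrow> integrable lborel h"
      by (simp add: set_integrable_def integrable_completion)
    show "integral UNIV h = (\<integral>y. h y \<partial>lborel)" if "integrable lborel h"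
      using set_lebesgue_integral_eq_integral(2)[of UNIV h] that AI
      by (simp add: set_lebesgue_integral_def integral_completion)
  qed
  have tr: "integrable lborel (\<lambda>y. h (unreindex y)) \<longleftrightarrow> integrable lborel h"
    "(\<integral>y. h (unreindex y) \<partial>lborel) = (\<integral>x. h x \<partial>lborel)"
    if [measurable]: "h \<in> borel_measurable borel" for h :: "real^'n \<Rightarrow> real"
    using integrable_distr_eq[of unreindex lborel borel h] integral_distr[of unreindex lborel borel h]
    by (simp_all add: distr_unreindex)
  show iff: ?I
    using *[of "integral UNIV (\<lambda>y. jac_det (g' (unreindex y)) * f (g (unreindex y)))"]
      *[of "integral UNIV (\<lambda>y. f (unreindex y))"]
      AI[of "\<lambda>y. jac_det (g' (unreindex y)) * f (g (unreindex y))"] AI[of "\<lambda>y. f (unreindex y)"]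
      tr(1)[of "\<lambda>x. jac_det (g' x) * f (g x)"] tr(1)[of f] by auto
  show "(\<integral>x. jac_det (g' x) * f (g x) \<partial>lborel) = (\<integral>x. f x \<partial>lborel)" if "integrable lborel f"
    using *[of "integral UNIV (\<lambda>y. f (unreindex y))"] that iff
      AI[of "\<lambda>y. f (unreindex y)"] I[of "\<lambda>y. f (unreindex y)"] tr[of f]
      I[of "\<lambda>y. jac_det (g' (unreindex y)) * f (g (unreindex y))"] tr[of "\<lambda>x. jac_det (g' x) * f (g x)"] by auto
qed

section \<open>Translations and horizontal derivatives\<close>

lemma L2_inner_cong_AE:
  assumes "AE x in M. f x * g x = f' x * g' x" "f \<in> L2 M" "g \<in> L2 M" "f' \<in> L2 M" "g' \<in> L2 M"
  shows "L2_inner M f g = L2_inner M f' g'"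
  unfolding L2_inner_def using assms
  by (intro integral_cong_AE) (auto dest!: L2_measurable)

lemma indicator_cball_L2: "(indicator (cball a R) :: 'a::euclidean_space \<Rightarrow> real) \<in> L2 lborel"
  using emeasure_bounded_finite[OF bounded_cball, of a R] by (intro indicator_L2) simp_all

lemma L2_integrable_of_bounded_support:
  fixes f :: "'a::euclidean_space \<Rightarrow> real"
  assumes f: "f \<in> L2 lborel" and vanish: "AE x in lborel. x \<notin> cball 0 M \<longrightarrow> f x = 0"
  shows "integrable lborel f"
proof -
  have int: "integrable lborel (\<lambda>x. f x * indicator (cball 0 M) x)"
    by (rule L2_mult_integrable[OF f indicator_cball_L2])
  show ?thesis
  proof (rule integrable_cong_AE_imp[OF int])
    show "f \<in> borel_measurable lborel" using f by (rule L2_measurable)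
    show "AE x in lborel. f x * indicator (cball 0 M) x = f x"
      using vanish by eventually_elim (auto simp: indicator_def)
  qed
qed

lemma lie_derivative_zero_outside:
  assumes "x \<notin> closure {x. \<phi> x \<noteq> 0}" shows "lie_derivative star v \<phi> x = 0"
proof -
  have "(\<phi> has_derivative (\<lambda>_. 0)) (at x)"
    by (rule has_derivative_transform_within_open[of "\<lambda>_. 0" _ _ _ "- closure {x. \<phi> x \<noteq> 0}"])
      (use assms closure_subset[of "{x. \<phi> x \<noteq> 0}"] in auto)
  from frechet_derivative_at[OF this] show ?thesis by (simp add: lie_derivative_def fun_eq_iff)
qed

section \<open>Truncated right translations and derivatives along horizontal flows\<close>

context homogeneous_carnot_group
begin

lemma star_left_has_derivative:
  "((\<lambda>x. star x z) has_derivative (\<lambda>a. frechet_derivative mul (at (x, z)) (a, 0))) (at x)"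
proof -
  have "((\<lambda>x. mul (x, z)) has_derivative (\<lambda>a. frechet_derivative mul (at (x, z)) (a, 0))) (at x)"
    by (rule has_derivative_compose[OF _ mul_has_derivative])
      (rule has_derivative_Pair[OF has_derivative_ident has_derivative_const])
  then show ?thesis by (simp add: mul_apply)
qed

text \<open>At p = (x, z) this is the Jacobian factor, at x, of right translation by z;
  \<open>left_jac\<close> is the factor, at z, of left translation by x.\<close>

definition right_jac :: "(real^'n) \<times> (real^'n) \<Rightarrow> real" where
  "right_jac p = jac_det (\<lambda>a. frechet_derivative mul (at p) (a, 0))"

definition left_jac :: "(real^'n) \<times> (real^'n) \<Rightarrow> real" where
  "left_jac p = jac_det (\<lambda>b. frechet_derivative mul (at p) (0, b))"

lemma continuous_mul_derivative: "continuous_on S (\<lambda>p. frechet_derivative mul (at p) v)"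
  using Ck_continuous[OF Ck_SucD(2)[OF Ck_mul[of "Suc 0"]]] continuous_on_subset by blast

lemma continuous_jac: "continuous_on S right_jac" "continuous_on S left_jac"
  unfolding right_jac_def left_jac_def by (intro continuous_on_jac_det continuous_mul_derivative)+

text \<open>Right translation by -z undoes right translation by z, so the chain rule exhibits a
  right inverse of the derivative.\<close>

lemma right_jac_pos: "0 < right_jac (x, z)"
  unfolding right_jac_def
proof (rule jac_det_pos)
  let ?A = "\<lambda>a. frechet_derivative mul (at (x, z)) (a, 0)"
  let ?C = "\<lambda>a. frechet_derivative mul (at (star x z, - z)) (a, 0)"
  show "linear ?A" "linear ?C"
    using star_left_has_derivative has_derivative_linear by blast+
  have "((\<lambda>y. star (star y (- z)) z) has_derivative (\<lambda>a. ?A (?C a))) (at (star x z))"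
    using has_derivative_compose[OF star_left_has_derivative[of "- z" "star x z"]
        star_left_has_derivative[of z "star (star x z) (- z)"]] by simp
  then have "((\<lambda>y. y) has_derivative (\<lambda>a. ?A (?C a))) (at (star x z))" by simp
  from has_derivative_unique[OF this has_derivative_ident]
  show "?A (?C a) = a" for a by (rule fun_cong)
qed

lemma bij_star_right: "bij (\<lambda>x. star x z)"
  by (rule o_bij[of "\<lambda>x. star x (- z)"]) (simp_all add: fun_eq_iff)

lemma bij_star_left: "bij (\<lambda>x. star z x)"
  by (rule o_bij[of "\<lambda>x. star (- z) x"]) (simp_all add: fun_eq_iff)

lemma star_right_measurable: "(\<lambda>x. star x z) \<in> borel_measurable borel"
  and star_left_measurable: "star z \<in> borel_measurable borel"
  by (rule borel_measurable_continuous_onI, intro continuous_star continuous_intros)+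

text \<open>The cutoff confines the Jacobian to a compact set, where it is bounded away from 0. In a
  pairing with a function that vanishes outside the ball it changes nothing.\<close>

definition translate :: "real \<Rightarrow> real^'n \<Rightarrow> (real^'n \<Rightarrow> real) \<Rightarrow> real^'n \<Rightarrow> real" where
  "translate M z \<phi> x = indicator (cball 0 M) x * \<phi> (star x z)"

lemma translate_diff: "translate M z (\<phi> - \<psi>) = translate M z \<phi> - translate M z \<psi>"
  by (simp add: fun_eq_iff translate_def right_diff_distrib)

text \<open>Let c be the minimum of the Jacobian for x in the ball of radius M and z in the unit
  ball. By change of variables the squared norm of the truncated translate is at most 1/c times that
  of \<open>\<phi>\<close>, uniformly in z.\<close>

lemma translate_L2:
  assumes "0 \<le> M"
  obtains C where "0 \<le> C" "\<And>z \<phi>. norm z \<le> 1 \<Longrightarrow> \<phi> \<in> L2 lborel \<Longrightarrow> translate M z \<phi> \<in> L2 lborel"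
    "\<And>z \<phi>. norm z \<le> 1 \<Longrightarrow> \<phi> \<in> L2 lborel \<Longrightarrow> L2norm lborel (translate M z \<phi>) \<le> C * L2norm lborel \<phi>"
proof -
  let ?K = "cball (0::real^'n) M \<times> cball (0::real^'n) 1"
  have "compact ?K" by (intro compact_Times compact_cball)
  moreover have "?K \<noteq> {}" using assms by auto
  ultimately obtain p where p: "\<And>q. q \<in> ?K \<Longrightarrow> right_jac p \<le> right_jac q"
    using continuous_attains_inf[OF _ _ continuous_jac(1)] by metis
  define c where "c = right_jac p"
  have c: "c > 0" using right_jac_pos[of "fst p" "snd p"] by (simp add: c_def)
  have main: "translate M z \<phi> \<in> L2 lborel \<and> L2norm lborel (translate M z \<phi>) \<le> sqrt (1 / c) * L2norm lborel \<phi>"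
    if z: "norm z \<le> 1" and \<phi>: "\<phi> \<in> L2 lborel" for z \<phi>
  proof -
    have \<phi>_meas: "\<phi> \<in> borel_measurable borel" using L2_measurable[OF \<phi>] by simp
    note cov = change_of_variables[of "\<lambda>x. star x z" "\<lambda>x a. frechet_derivative mul (at (x, z)) (a, 0)" "\<lambda>x. (\<phi> x)\<^sup>2",
        OF star_left_has_derivative bij_star_right]
    have cont: "continuous_on UNIV (\<lambda>x. frechet_derivative mul (at (x, z)) (v, 0))" for v
      by (rule continuous_on_compose2[OF continuous_mul_derivative[of UNIV]]) (auto intro: continuous_intros)
    have int: "integrable lborel (\<lambda>x. right_jac (x, z) * (\<phi> (star x z))\<^sup>2)"
      and eq: "(\<integral>x. right_jac (x, z) * (\<phi> (star x z))\<^sup>2 \<partial>lborel) = (\<integral>x. (\<phi> x)\<^sup>2 \<partial>lborel)"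
      using cov cont \<phi>_meas L2_square_integrable[OF \<phi>] by (simp_all add: right_jac_def)
    have le: "(translate M z \<phi> x)\<^sup>2 \<le> (1 / c) * (right_jac (x, z) * (\<phi> (star x z))\<^sup>2)" for x
    proof (cases "x \<in> cball 0 M")
      case True
      then have "c \<le> right_jac (x, z)" using p z by (auto simp: c_def)
      then have "c * (\<phi> (star x z))\<^sup>2 \<le> right_jac (x, z) * (\<phi> (star x z))\<^sup>2" by (intro mult_right_mono) auto
      then show ?thesis using True c by (simp add: translate_def field_simps)
    next
      case False
      then show ?thesis using c less_imp_le[OF right_jac_pos] by (simp add: translate_def)
    qed
    have int': "integrable lborel (\<lambda>x. (1 / c) * (right_jac (x, z) * (\<phi> (star x z))\<^sup>2))"
      using int by (rule integrable_mult_right)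
    have "(\<lambda>x. \<phi> (star x z)) \<in> borel_measurable lborel"
      using measurable_compose[OF star_right_measurable \<phi>_meas] by simp
    then have meas: "translate M z \<phi> \<in> borel_measurable lborel"
      unfolding translate_def[abs_def] by (intro borel_measurable_times borel_measurable_indicator) auto
    have int_tr: "integrable lborel (\<lambda>x. (translate M z \<phi> x)\<^sup>2)"
    proof (rule Bochner_Integration.integrable_bound[OF int'])
      show "(\<lambda>x. (translate M z \<phi> x)\<^sup>2) \<in> borel_measurable lborel"
        using meas by (rule borel_measurable_power)
      have "norm ((translate M z \<phi> x)\<^sup>2) \<le> norm ((1 / c) * (right_jac (x, z) * (\<phi> (star x z))\<^sup>2))" for x
        unfolding real_norm_def abs_power2 by (rule order_trans[OF le abs_ge_self])
      then show "AE x in lborel. norm ((translate M z \<phi> x)\<^sup>2) \<le> norm ((1 / c) * (right_jac (x, z) * (\<phi> (star x z))\<^sup>2))"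
        by (rule AE_I2)
    qed
    have "(\<integral>x. (translate M z \<phi> x)\<^sup>2 \<partial>lborel) \<le> (\<integral>x. (1 / c) * (right_jac (x, z) * (\<phi> (star x z))\<^sup>2) \<partial>lborel)"
      by (rule integral_mono[OF int_tr int' le])
    also have "\<dots> = (1 / c) * (\<integral>x. (\<phi> x)\<^sup>2 \<partial>lborel)" using eq by simp
    finally have "sqrt (\<integral>x. (translate M z \<phi> x)\<^sup>2 \<partial>lborel) \<le> sqrt ((1 / c) * (\<integral>x. (\<phi> x)\<^sup>2 \<partial>lborel))"
      by (rule real_sqrt_le_mono)
    then show ?thesis
      using int_tr meas by (simp add: L2_real_iff L2norm_def real_sqrt_mult real_sqrt_divide)
  qed
  show ?thesis
    by (rule that[of "sqrt (1 / c)"]) (use c main in auto)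
qed

text \<open>The left-invariant field of \<open>v\<close> generates right translation by the
  one-parameter subgroup of \<open>v\<close>; \<open>exp_coordinates\<close> reduces time t to time
  0.\<close>

lemma lie_derivative_curve:
  assumes "Ck 1 \<phi>"
  shows "((\<lambda>t. \<phi> (star x (t *\<^sub>R v))) has_real_derivative lie_derivative star v \<phi> (star x (t *\<^sub>R v))) (at t)"
proof -
  let ?p = "star x (t *\<^sub>R v)"
  have \<phi>: "(\<phi> has_derivative frechet_derivative \<phi> (at p)) (at p)" for p
    using Ck_SucD(1)[of 0 \<phi>] assms by simp
  have "((\<lambda>h. star ?p (h *\<^sub>R v)) has_derivative (\<lambda>h. rfield (h *\<^sub>R v) (?p, 0))) (at 0)"
    by (rule has_derivative_compose[of "\<lambda>h. h *\<^sub>R v" "\<lambda>h. h *\<^sub>R v" 0 UNIV "star ?p"])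
      (auto intro!: derivative_eq_intros star_right_has_derivative)
  from has_derivative_compose[OF this \<phi>]
  have "((\<lambda>h. \<phi> (star ?p (h *\<^sub>R v))) has_derivative (\<lambda>h. frechet_derivative \<phi> (at ?p) (rfield (h *\<^sub>R v) (?p, 0)))) (at 0)"
    by simp
  moreover have "frechet_derivative \<phi> (at ?p) (rfield (h *\<^sub>R v) (?p, 0)) = lie_derivative star v \<phi> ?p * h" for h
    using linear_cmul[OF has_derivative_linear[OF \<phi>[of ?p]]]
      linear_cmul[OF bounded_linear.linear[OF rfield_linear[of "(?p, 0)"]], of h v]
    by (simp add: lie_derivative_def left_inv_field_eq)
  ultimately have "((\<lambda>h. \<phi> (star ?p (h *\<^sub>R v))) has_real_derivative lie_derivative star v \<phi> ?p) (at 0)"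
    by (simp add: has_field_derivative_def)
  moreover have "star ?p (h *\<^sub>R v) = star x ((h + t) *\<^sub>R v)" for h
    by (simp add: assoc exp_coordinates add.commute)
  ultimately show ?thesis
    using DERIV_shift[of "\<lambda>t. \<phi> (star x (t *\<^sub>R v))" _ 0 t] by simp
qed

lemma continuous_lie_derivative:
  assumes "Ck 1 \<phi>" shows "continuous_on UNIV (lie_derivative star v \<phi>)"
proof -
  have "lie_derivative star v \<phi> = (\<lambda>x. \<Sum>b\<in>Basis. (rfield v (x, 0) \<bullet> b) * frechet_derivative \<phi> (at x) b)"
  proof
    fix x
    have lin: "linear (frechet_derivative \<phi> (at x))"
      using Ck_SucD(1)[of 0 \<phi> x] assms has_derivative_linear by auto
    show "lie_derivative star v \<phi> x = (\<Sum>b\<in>Basis. (rfield v (x, 0) \<bullet> b) * frechet_derivative \<phi> (at x) b)"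
      unfolding lie_derivative_def left_inv_field_eq
      by (subst euclidean_representation[symmetric, of "rfield v (x, 0)"])
        (simp only: linear_sum[OF lin] linear_cmul[OF lin] real_scaleR_def)
  qed
  moreover have "continuous_on UNIV (\<lambda>x. frechet_derivative \<phi> (at x) b)" for b
    using Ck_SucD(2)[of 0 \<phi> b] assms by simp
  moreover have "continuous_on UNIV (\<lambda>x. rfield v (x, 0))"
    by (rule continuous_on_compose2[OF Ck_continuous[OF Ck_rfield[of 0]]]) (auto intro: continuous_intros)
  ultimately show ?thesis by (auto intro!: continuous_intros)
qed

lemma lie_derivative_bounded:
  assumes "test_function \<phi>"
  obtains K where "0 \<le> K" "\<And>x. \<bar>lie_derivative star v \<phi> x\<bar> \<le> K"
proof -
  let ?T = "closure {x. \<phi> x \<noteq> 0}"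
  have "compact ?T" using assms by (simp add: test_function_def)
  then have comp: "compact (lie_derivative star v \<phi> ` ?T)"
    by (rule compact_continuous_image[rotated])
      (rule continuous_on_subset[OF continuous_lie_derivative[OF test_function_Ck[OF assms]] subset_UNIV])
  from compact_imp_bounded[OF comp] obtain K where "\<forall>y\<in>lie_derivative star v \<phi> ` ?T. norm y \<le> K"
    unfolding bounded_iff by blast
  then have K: "\<bar>lie_derivative star v \<phi> x\<bar> \<le> K" if "x \<in> ?T" for x
    using that by simp
  have "lie_derivative star v \<phi> x = 0" if "x \<notin> ?T" for x
    using that by (rule lie_derivative_zero_outside)
  then have "\<bar>lie_derivative star v \<phi> x\<bar> \<le> \<bar>K\<bar>" for x
    using K[of x] by (cases "x \<in> ?T") auto
  then show ?thesis using that[of "\<bar>K\<bar>"] by simp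
qed

text \<open>Let F t be the pairing of f with \<open>\<phi>\<close> translated by t v. Since the flow
  commutes with itself, F' pairs f with the horizontal derivative of the translated
  \<open>\<phi>\<close>. The weak derivative moves this onto g, Cauchy-Schwarz bounds F' by the norm
  of g times C, and the mean value inequality does the rest.\<close>

lemma horizontal_estimate_test_function:
  assumes M: "0 \<le> M" and f: "f \<in> L2 lborel" and vanish: "AE x in lborel. x \<notin> cball 0 M \<longrightarrow> f x = 0"
    and g: "g \<in> L2 lborel" and distr: "has_distr_derivative star v f g" and \<phi>: "test_function \<phi>"
    and tr: "\<And>z. norm z \<le> 1 \<Longrightarrow> translate (M + 2) z \<phi> \<in> L2 lborel"
    and C: "\<And>z. norm z \<le> 1 \<Longrightarrow> L2norm lborel (translate (M + 2) z \<phi>) \<le> C"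
    and t: "\<bar>t\<bar> * norm v \<le> 1"
  shows "\<bar>L2_inner lborel f (translate M (t *\<^sub>R v) \<phi> - \<phi>)\<bar> \<le> \<bar>t\<bar> * (L2norm lborel g * C)"
proof -
  define X where "X = lie_derivative star v \<phi>"
  have Ck\<phi>: "Ck k \<phi>" for k by (rule test_function_Ck[OF \<phi>])
  obtain K where K: "0 \<le> K" "\<And>x. \<bar>X x\<bar> \<le> K"
    by (rule lie_derivative_bounded[OF \<phi>, of v]) (rule that, simp_all add: X_def)
  have int_f: "integrable lborel f" by (rule L2_integrable_of_bounded_support[OF f vanish])
  have f_meas: "f \<in> borel_measurable lborel" using f by (rule L2_measurable)
  have cont_star: "continuous_on UNIV (\<lambda>x. h (star x z))" if "continuous_on UNIV h" for h :: "real^'n \<Rightarrow> real" and z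
    by (rule continuous_on_compose2[OF that]) (auto intro: continuous_star continuous_intros)
  have meas_\<phi>: "(\<lambda>x. \<phi> (star x z)) \<in> borel_measurable lborel" for z
    using borel_measurable_continuous_onI[OF cont_star[OF Ck_continuous[OF Ck\<phi>]]] by simp
  have meas_X: "(\<lambda>x. X (star x z)) \<in> borel_measurable lborel" for z
    using borel_measurable_continuous_onI[OF cont_star[OF continuous_lie_derivative[OF Ck\<phi>]]] by (simp add: X_def)
  \<comment> \<open>This Lipschitz bound in time dominates the difference quotients when F is
    differentiated under the integral.\<close>
  have lip: "\<bar>\<phi> (star x (s *\<^sub>R v)) - \<phi> (star x (s' *\<^sub>R v))\<bar> \<le> K * \<bar>s - s'\<bar>" for x s s'
    using field_differentiable_bound[of UNIV "\<lambda>s. \<phi> (star x (s *\<^sub>R v))" "\<lambda>s. X (star x (s *\<^sub>R v))" K s s']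
      lie_derivative_curve[OF Ck\<phi>] K(2) by (simp add: X_def)
  obtain S where S: "bounded S" "\<And>x. x \<notin> S \<Longrightarrow> \<phi> x = 0"
    by (rule test_function_bounded_support[OF \<phi>]) (rule that)
  have tr_eq: "f x * translate M z \<phi> x = f x * \<phi> (star x z)" if "x \<notin> cball 0 M \<longrightarrow> f x = 0" for x z
    using that by (auto simp: translate_def indicator_def)
  have tr_M: "translate M z \<phi> \<in> L2 lborel" if "norm z \<le> 1" for z
  proof (rule L2_bound(1)[OF tr[OF that]])
    show "translate M z \<phi> \<in> borel_measurable lborel"
      unfolding translate_def[abs_def] by (intro borel_measurable_times borel_measurable_indicator meas_\<phi>) auto
    show "AE x in lborel. \<bar>translate M z \<phi> x\<bar> \<le> \<bar>translate (M + 2) z \<phi> x\<bar>"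
      by (rule AE_I2) (auto simp: translate_def indicator_def)
  qed
  define F where "F t = (\<integral>x. f x * \<phi> (star x (t *\<^sub>R v)) \<partial>lborel)" for t
  have bounded_\<phi>: "\<exists>K'. \<forall>x. \<bar>\<phi> x\<bar> \<le> K'"
  proof -
    have comp: "compact (\<phi> ` closure {x. \<phi> x \<noteq> 0})"
      using \<phi> by (intro compact_continuous_image continuous_on_subset[OF Ck_continuous[OF Ck\<phi>] subset_UNIV])
        (simp add: test_function_def)
    from compact_imp_bounded[OF comp] obtain K' where K': "\<forall>y\<in>\<phi> ` closure {x. \<phi> x \<noteq> 0}. norm y \<le> K'"
      unfolding bounded_iff by blast
    have "\<bar>\<phi> x\<bar> \<le> \<bar>K'\<bar>" for x
    proof (cases "\<phi> x = 0")
      case False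
      then have "x \<in> closure {x. \<phi> x \<noteq> 0}" using closure_subset[of "{x. \<phi> x \<noteq> 0}"] by auto
      from K'[THEN bspec, OF imageI, OF this] show ?thesis by simp
    qed simp
    then show ?thesis by blast
  qed
  then obtain K' where K': "\<And>x. \<bar>\<phi> x\<bar> \<le> K'" by blast
  have int_F: "integrable lborel (\<lambda>x. f x * \<phi> (star x z))" for z
  proof (rule Bochner_Integration.integrable_bound[OF integrable_mult_left[OF integrable_norm[OF int_f], of K']])
    show "AE x in lborel. norm (f x * \<phi> (star x z)) \<le> norm (norm (f x) * K')"
    proof (rule AE_I2)
      fix x show "norm (f x * \<phi> (star x z)) \<le> norm (norm (f x) * K')"
        using K'[of "star x z"] by (simp add: abs_mult mult_left_mono)
    qed
  qed (intro borel_measurable_times f_meas meas_\<phi>)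
  have F_der: "(F has_real_derivative (\<integral>x. f x * X (star x (t *\<^sub>R v)) \<partial>lborel)) (at t)" for t
    unfolding DERIV_def tendsto_at_iff_sequentially o_def
  proof (intro allI impI)
    fix h :: "nat \<Rightarrow> real" assume h: "\<forall>i. h i \<in> UNIV - {0}" "h \<longlonglongrightarrow> 0"
    define q where "q i x = (\<phi> (star x ((t + h i) *\<^sub>R v)) - \<phi> (star x (t *\<^sub>R v))) / h i" for i x
    have "(F (t + h i) - F t) / h i = (\<integral>x. f x * q i x \<partial>lborel)" for i
      unfolding F_def q_def
      by (simp add: right_diff_distrib diff_divide_distrib Bochner_Integration.integral_diff int_F)
    moreover have "(\<lambda>i. \<integral>x. f x * q i x \<partial>lborel) \<longlonglongrightarrow> (\<integral>x. f x * X (star x (t *\<^sub>R v)) \<partial>lborel)"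
    proof (rule integral_dominated_convergence)
      show "integrable lborel (\<lambda>x. norm (f x) * K)" by (intro integrable_mult_left integrable_norm int_f)
      show "(\<lambda>x. f x * X (star x (t *\<^sub>R v))) \<in> borel_measurable lborel"
        by (intro borel_measurable_times f_meas meas_X)
      show "(\<lambda>x. f x * q i x) \<in> borel_measurable lborel" for i
        unfolding q_def by (intro borel_measurable_times borel_measurable_divide borel_measurable_diff f_meas meas_\<phi>) simp
      show "AE x in lborel. (\<lambda>i. f x * q i x) \<longlonglongrightarrow> f x * X (star x (t *\<^sub>R v))"
      proof (rule AE_I2)
        fix x
        have "((\<lambda>s. (\<phi> (star x ((t + s) *\<^sub>R v)) - \<phi> (star x (t *\<^sub>R v))) / s) \<longlongrightarrow> X (star x (t *\<^sub>R v))) (at 0)"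
          using lie_derivative_curve[OF Ck\<phi>, of x v t] by (simp add: DERIV_def X_def)
        then have "(\<lambda>i. q i x) \<longlonglongrightarrow> X (star x (t *\<^sub>R v))"
          using h unfolding tendsto_at_iff_sequentially q_def o_def by blast
        then show "(\<lambda>i. f x * q i x) \<longlonglongrightarrow> f x * X (star x (t *\<^sub>R v))" by (rule tendsto_mult_left)
      qed
      show "AE x in lborel. norm (f x * q i x) \<le> norm (f x) * K" for i
      proof (rule AE_I2)
        fix x
        have "h i \<noteq> 0" using h by simp
        then have "\<bar>q i x\<bar> \<le> K"
          using lip[of x "t + h i" "t"] by (simp add: q_def field_simps)
        then show "norm (f x * q i x) \<le> norm (f x) * K" by (simp add: abs_mult mult_left_mono)
      qed
    qed
    ultimately show "(\<lambda>i. (F (t + h i) - F t) / h i) \<longlonglongrightarrow> (\<integral>x. f x * X (star x (t *\<^sub>R v)) \<partial>lborel)"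
      by simp
  qed
  \<comment> \<open>Equal to 1 up to radius M + 1, hence near every point of the ball that carries
    f, so that derivatives agree there. It vanishes from M + 2 on, so that \<open>\<psi>\<close> is
    dominated by the translate truncated at M + 2.\<close>
  obtain \<eta> :: "real^'n \<Rightarrow> real" where \<eta>: "test_function \<eta>" "\<And>x. 0 \<le> \<eta> x" "\<And>x. \<eta> x \<le> 1"
    "\<And>x. norm x \<le> M + 1 \<Longrightarrow> \<eta> x = 1" "\<And>x. norm x \<ge> M + 2 \<Longrightarrow> \<eta> x = 0"
    using test_function_cutoff[of "M + 1"] M by (auto simp: add.assoc)
  have F'_bound: "\<bar>\<integral>x. f x * X (star x (t *\<^sub>R v)) \<partial>lborel\<bar> \<le> L2norm lborel g * C" if t: "\<bar>t\<bar> * norm v \<le> 1" for t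
  proof -
    define \<psi> where "\<psi> x = \<eta> x * \<phi> (star x (t *\<^sub>R v))" for x
    have Ck\<psi>: "Ck k \<psi>" for k
    proof -
      have "Ck k (\<lambda>x. mul (x, t *\<^sub>R v))" by (intro Ck_comp[OF Ck_mul] Ck_Pair Ck_ident Ck_const)
      then show ?thesis
        unfolding \<psi>_def mul_apply by (intro Ck_mult test_function_Ck[OF \<eta>(1)] Ck_comp[OF Ck\<phi>])
    qed
    have \<psi>: "test_function \<psi>"
      by (rule test_functionI[OF Ck\<psi> bounded_cball[of 0 "M + 2"]]) (use \<eta>(5) in \<open>auto simp: \<psi>_def\<close>)
    have "lie_derivative star v \<psi> x = X (star x (t *\<^sub>R v))" if x: "norm x \<le> M" for x
    proof (rule DERIV_unique)
      show "((\<lambda>s. \<psi> (star x (s *\<^sub>R v))) has_real_derivative lie_derivative star v \<psi> x) (at 0)"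
        using lie_derivative_curve[OF Ck\<psi>, of x v 0] by simp
      have 1: "((\<lambda>s. \<phi> (star x ((s + t) *\<^sub>R v))) has_real_derivative X (star x (t *\<^sub>R v))) (at 0)"
        using lie_derivative_curve[OF Ck\<phi>, of x v t] DERIV_shift[of "\<lambda>t. \<phi> (star x (t *\<^sub>R v))" _ 0 t] by (simp add: X_def)
      have "continuous_on UNIV (\<lambda>s. norm (star x (s *\<^sub>R v)))" by (intro continuous_intros continuous_star)
      then have "((\<lambda>s. norm (star x (s *\<^sub>R v))) \<longlongrightarrow> norm (star x (0 *\<^sub>R v))) (at 0)"
        unfolding continuous_on_def by blast
      then have "((\<lambda>s. norm (star x (s *\<^sub>R v))) \<longlongrightarrow> norm (star x (0 *\<^sub>R v))) (nhds 0)"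
        by (rule tendsto_at_iff_tendsto_nhds[THEN iffD1])
      then have "\<forall>\<^sub>F s in nhds 0. norm (star x (s *\<^sub>R v)) < M + 1"
        by (rule order_tendstoD(2)) (use x in simp)
      then have "\<forall>\<^sub>F s in nhds 0. \<psi> (star x (s *\<^sub>R v)) = \<phi> (star x ((s + t) *\<^sub>R v))"
        by eventually_elim (simp add: \<psi>_def \<eta>(4) assoc exp_coordinates)
      from DERIV_cong_ev[OF refl this refl] 1
      show "((\<lambda>s. \<psi> (star x (s *\<^sub>R v))) has_real_derivative X (star x (t *\<^sub>R v))) (at 0)" by simp
    qed
    then have "AE x in lborel. f x * X (star x (t *\<^sub>R v)) = f x * lie_derivative star v \<psi> x"
      using vanish by (auto elim!: eventually_mono)
    then have "(\<integral>x. f x * X (star x (t *\<^sub>R v)) \<partial>lborel) = (\<integral>x. f x * lie_derivative star v \<psi> x \<partial>lborel)"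
      using borel_measurable_continuous_onI[OF continuous_lie_derivative[OF Ck\<psi>, of v]] f_meas
      by (intro integral_cong_AE borel_measurable_times meas_X) auto
    also have "\<dots> = - L2_inner lborel g \<psi>"
      using distr \<psi> by (simp add: has_distr_derivative_def L2_inner_def)
    finally have "\<bar>\<integral>x. f x * X (star x (t *\<^sub>R v)) \<partial>lborel\<bar> \<le> L2norm lborel g * L2norm lborel \<psi>"
      using L2_inner_Cauchy_Schwarz[OF g test_function_L2[OF \<psi>]] by simp
    also have "L2norm lborel \<psi> \<le> L2norm lborel (translate (M + 2) (t *\<^sub>R v) \<phi>)"
    proof (rule L2_bound(2))
      show "translate (M + 2) (t *\<^sub>R v) \<phi> \<in> L2 lborel" using t by (intro tr) simp
      show "\<psi> \<in> borel_measurable lborel" by (rule L2_measurable[OF test_function_L2[OF \<psi>]])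
      have "\<bar>\<psi> x\<bar> \<le> \<bar>translate (M + 2) (t *\<^sub>R v) \<phi> x\<bar>" for x
        using \<eta>(2,3)[of x] \<eta>(5)[of x]
        by (cases "norm x \<le> M + 2") (auto simp: \<psi>_def translate_def abs_mult mult_left_le_one_le)
      then show "AE x in lborel. \<bar>\<psi> x\<bar> \<le> \<bar>translate (M + 2) (t *\<^sub>R v) \<phi> x\<bar>" by (rule AE_I2)
    qed
    also have "\<dots> \<le> C" using t by (intro C) simp
    finally show ?thesis by (simp add: L2norm_nonneg mult_left_mono)
  qed
  have "norm (F t - F 0) \<le> (L2norm lborel g * C) * norm (t - 0)"
  proof (rule field_differentiable_bound)
    show "convex {-\<bar>t\<bar>..\<bar>t\<bar>}" by simp
    fix s assume s: "s \<in> {-\<bar>t\<bar>..\<bar>t\<bar>}"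
    show "(F has_field_derivative (\<integral>x. f x * X (star x (s *\<^sub>R v)) \<partial>lborel)) (at s within {-\<bar>t\<bar>..\<bar>t\<bar>})"
      by (rule has_field_derivative_at_within[OF F_der])
    have "\<bar>s\<bar> * norm v \<le> \<bar>t\<bar> * norm v" using s by (intro mult_right_mono) auto
    then show "norm (\<integral>x. f x * X (star x (s *\<^sub>R v)) \<partial>lborel) \<le> L2norm lborel g * C"
      using F'_bound[of s] t by simp
  qed auto
  moreover have "L2_inner lborel f (translate M (t *\<^sub>R v) \<phi> - \<phi>) = F t - F 0"
  proof -
    have "norm (t *\<^sub>R v) \<le> 1" using t by simp
    then have "L2_inner lborel f (translate M (t *\<^sub>R v) \<phi> - \<phi>) =
        L2_inner lborel f (translate M (t *\<^sub>R v) \<phi>) - L2_inner lborel f \<phi>"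
      by (intro L2.diff_right f tr_M test_function_L2[OF \<phi>])
    moreover have "L2_inner lborel f (translate M (t *\<^sub>R v) \<phi>) = F t"
      unfolding L2_inner_def F_def
    proof (intro integral_cong_AE borel_measurable_times f_meas meas_\<phi>)
      show "translate M (t *\<^sub>R v) \<phi> \<in> borel_measurable lborel"
        by (rule L2_measurable[OF tr_M[OF \<open>norm (t *\<^sub>R v) \<le> 1\<close>]])
      show "AE x in lborel. f x * translate M (t *\<^sub>R v) \<phi> x = f x * \<phi> (star x (t *\<^sub>R v))"
        using vanish by eventually_elim (rule tr_eq)
    qed
    moreover have "L2_inner lborel f \<phi> = F 0" by (simp add: L2_inner_def F_def)
    ultimately show ?thesis by simp
  qed
  ultimately show ?thesis by (simp add: mult.commute)
qed

end

context homogeneous_carnot_group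
begin

lemma translate_mono:
  assumes "M \<le> M'" "translate M' z \<phi> \<in> L2 lborel"
  shows "translate M z \<phi> \<in> L2 lborel" "L2norm lborel (translate M z \<phi>) \<le> L2norm lborel (translate M' z \<phi>)"
proof -
  have eq: "translate M z \<phi> = (\<lambda>x. indicator (cball 0 M) x * translate M' z \<phi> x)"
    using assms(1) by (auto simp: fun_eq_iff translate_def indicator_def)
  have meas: "translate M z \<phi> \<in> borel_measurable lborel"
    unfolding eq by (intro borel_measurable_times borel_measurable_indicator L2_measurable[OF assms(2)]) simp
  have le: "AE x in lborel. \<bar>translate M z \<phi> x\<bar> \<le> \<bar>translate M' z \<phi> x\<bar>"
    unfolding eq by (rule AE_I2) (auto simp: indicator_def)
  show "translate M z \<phi> \<in> L2 lborel" "L2norm lborel (translate M z \<phi>) \<le> L2norm lborel (translate M' z \<phi>)"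
    by (rule L2_bound[OF assms(2) meas le])+
qed

text \<open>Test functions are dense and truncated translations are bounded, so both sides pass to
  the limit. Arbitrary \<open>\<phi>\<close> matter because the estimate is later applied to
  translates of test vectors and to f itself.\<close>

lemma horizontal_estimate:
  assumes M: "0 \<le> M" and f: "f \<in> L2 lborel" and vanish: "AE x in lborel. x \<notin> cball 0 M \<longrightarrow> f x = 0"
    and g: "g \<in> L2 lborel" and distr: "has_distr_derivative star v f g" and \<phi>: "\<phi> \<in> L2 lborel"
    and C0: "0 \<le> C"
    and tr: "\<And>z \<phi>. norm z \<le> 1 \<Longrightarrow> \<phi> \<in> L2 lborel \<Longrightarrow> translate (M + 2) z \<phi> \<in> L2 lborel"
    and C: "\<And>z \<phi>. norm z \<le> 1 \<Longrightarrow> \<phi> \<in> L2 lborel \<Longrightarrow> L2norm lborel (translate (M + 2) z \<phi>) \<le> C * L2norm lborel \<phi>"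
    and t: "\<bar>t\<bar> * norm v \<le> 1"
  shows "\<bar>L2_inner lborel f (translate M (t *\<^sub>R v) \<phi> - \<phi>)\<bar> \<le> \<bar>t\<bar> * (L2norm lborel g * (C * L2norm lborel \<phi>))"
proof -
  let ?z = "t *\<^sub>R v"
  let ?P = "\<lambda>\<phi>. L2_inner lborel f (translate M ?z \<phi> - \<phi>)"
  \<comment> \<open>The coefficient of \<delta>: the first summand bounds the pairing with
    \<open>\<phi> - \<psi>\<close>, the second comes from trading the norm of \<open>\<psi>\<close>
    for that of \<open>\<phi>\<close>.\<close>
  define D where "D = L2norm lborel f * (C + 1) + \<bar>t\<bar> * (L2norm lborel g * C)"
  have D: "0 \<le> D" using C0 by (simp add: D_def L2norm_nonneg)
  have z: "norm ?z \<le> 1" using t by simp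
  have trM: "translate M ?z \<psi> \<in> L2 lborel" "L2norm lborel (translate M ?z \<psi>) \<le> C * L2norm lborel \<psi>"
    if "\<psi> \<in> L2 lborel" for \<psi>
    using translate_mono[OF _ tr[OF z that], of M] C[OF z that] by auto
  have "\<bar>?P \<phi>\<bar> \<le> \<bar>t\<bar> * (L2norm lborel g * (C * L2norm lborel \<phi>)) + D * \<delta>" if \<delta>: "\<delta> > 0" for \<delta>
  proof -
    obtain \<psi> where \<psi>: "test_function \<psi>" "L2norm lborel (\<phi> - \<psi>) < \<delta>"
      using test_functions_dense[OF \<phi> \<delta>] by blast
    have \<psi>L2: "\<psi> \<in> L2 lborel" by (rule test_function_L2[OF \<psi>(1)])
    let ?d = "\<phi> - \<psi>"
    have d: "?d \<in> L2 lborel" using \<phi> \<psi>L2 by (rule L2.mem_diff)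
    have "translate M ?z \<phi> - \<phi> = (translate M ?z ?d - ?d) + (translate M ?z \<psi> - \<psi>)"
      by (simp add: translate_diff)
    then have "?P \<phi> = ?P ?d + ?P \<psi>"
      using L2.add_right[OF f L2.mem_diff[OF trM(1)[OF d] d] L2.mem_diff[OF trM(1)[OF \<psi>L2] \<psi>L2]] by (simp only:)
    moreover have "\<bar>?P ?d\<bar> \<le> L2norm lborel f * (C + 1) * \<delta>"
    proof -
      have "\<bar>?P ?d\<bar> \<le> L2norm lborel f * L2norm lborel (translate M ?z ?d - ?d)"
        by (intro L2_inner_Cauchy_Schwarz f L2.mem_diff trM d)
      also have "L2norm lborel (translate M ?z ?d - ?d) \<le> L2norm lborel (translate M ?z ?d) + L2norm lborel ?d"
        using L2.nrm_diff_triangle[OF trM(1)[OF d] d] by (simp add: L2_nrm)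
      also have "\<dots> \<le> (C + 1) * L2norm lborel ?d" using trM(2)[OF d] by (simp add: algebra_simps)
      also have "\<dots> \<le> (C + 1) * \<delta>" using \<psi>(2) C0 by (intro mult_left_mono) auto
      finally show ?thesis by (simp add: L2norm_nonneg mult_left_mono mult.assoc)
    qed
    moreover have "\<bar>?P \<psi>\<bar> \<le> \<bar>t\<bar> * (L2norm lborel g * (C * L2norm lborel \<psi>))"
      by (rule horizontal_estimate_test_function[OF M f vanish g distr \<psi>(1) tr C t]) (use \<psi>L2 in auto)
    moreover have "\<bar>t\<bar> * (L2norm lborel g * (C * L2norm lborel \<psi>)) \<le>
        \<bar>t\<bar> * (L2norm lborel g * (C * (L2norm lborel \<phi> + \<delta>)))"
    proof -
      have "L2norm lborel \<psi> \<le> L2norm lborel \<phi> + L2norm lborel ?d"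
        using L2.nrm_diff_triangle[OF \<phi> d] by (simp add: L2_nrm)
      then have "L2norm lborel \<psi> \<le> L2norm lborel \<phi> + \<delta>" using \<psi>(2) by simp
      then show ?thesis using C0 by (intro mult_left_mono) (auto simp: L2norm_nonneg)
    qed
    ultimately have "\<bar>?P \<phi>\<bar> \<le> L2norm lborel f * (C + 1) * \<delta> + \<bar>t\<bar> * (L2norm lborel g * (C * (L2norm lborel \<phi> + \<delta>)))"
      by linarith
    also have "\<dots> = \<bar>t\<bar> * (L2norm lborel g * (C * L2norm lborel \<phi>)) + D * \<delta>"
      by (simp add: D_def algebra_simps)
    finally show ?thesis .
  qed
  note approx = this
  show ?thesis
  proof (rule field_le_epsilon)
    fix e :: real assume e: "e > 0"
    have "D * (e / (D + 1)) \<le> e" using D e by (simp add: field_simps)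
    then show "\<bar>?P \<phi>\<bar> \<le> \<bar>t\<bar> * (L2norm lborel g * (C * L2norm lborel \<phi>)) + e"
      using approx[of "e / (D + 1)"] D e by (smt (verit) divide_pos_pos)
  qed
qed

end

section \<open>Elements that nearly fix a family of functions, organised as a filter\<close>

locale horizontal_family = homogeneous_carnot_group star ginv wt r
  for star :: "real^'n \<Rightarrow> real^'n \<Rightarrow> real^'n" and ginv wt r +
  fixes B :: "(real^'n) set" and M :: real and U :: "(real^'n \<Rightarrow> real) set"
  assumes M: "0 \<le> M"
    and U_L2: "f \<in> U \<Longrightarrow> f \<in> L2 lborel"
    and U_norm: "f \<in> U \<Longrightarrow> L2norm lborel f \<le> 1"
    and U_vanish: "f \<in> U \<Longrightarrow> AE x in lborel. x \<notin> cball 0 M \<longrightarrow> f x = 0"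
    and U_derivative: "f \<in> U \<Longrightarrow> v \<in> B \<Longrightarrow> \<exists>g\<in>L2 lborel. L2norm lborel g \<le> 1 \<and> has_distr_derivative star v f g"
    and span_B: "span B = layer wt 1"
begin

text \<open>The dual form of closeness of \<open>f\<close> to its translates, uniform over
  \<open>U\<close>. The bound by \<epsilon> on the norm makes the induced filter finer than the
  neighbourhoods of 0, and the bound by 1 keeps \<open>y\<close> in the range of
  \<open>translate_L2\<close>.\<close>

definition nearly_fixing :: "real \<Rightarrow> (real^'n) set" where
  "nearly_fixing \<epsilon> = {y. norm y < \<epsilon> \<and> norm y < 1 \<and>
    (\<forall>f\<in>U. \<forall>\<phi>\<in>L2 lborel. \<bar>L2_inner lborel f (translate M y \<phi> - \<phi>)\<bar> \<le> \<epsilon> * L2norm lborel \<phi>)}"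

definition small_filter :: "(real^'n) filter" where
  "small_filter = (INF \<epsilon>\<in>{0<..}. principal (nearly_fixing \<epsilon>))"

lemma nearly_fixing_mono: "\<epsilon> \<le> \<epsilon>' \<Longrightarrow> nearly_fixing \<epsilon> \<subseteq> nearly_fixing \<epsilon>'"
proof
  fix y assume "\<epsilon> \<le> \<epsilon>'" and y: "y \<in> nearly_fixing \<epsilon>"
  then have "\<epsilon> * L2norm lborel \<phi> \<le> \<epsilon>' * L2norm lborel \<phi>" for \<phi> :: "real^'n \<Rightarrow> real"
    by (intro mult_right_mono L2norm_nonneg)
  then show "y \<in> nearly_fixing \<epsilon>'"
    using y \<open>\<epsilon> \<le> \<epsilon>'\<close> unfolding nearly_fixing_def by (auto intro: order_trans)
qed

lemma eventually_small_filter: "eventually P small_filter \<longleftrightarrow> (\<exists>\<epsilon>>0. \<forall>y\<in>nearly_fixing \<epsilon>. P y)"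
  unfolding small_filter_def
proof (subst eventually_INF_base)
  fix a b :: real assume "a \<in> {0<..}" "b \<in> {0<..}"
  then show "\<exists>x\<in>{0<..}. principal (nearly_fixing x) \<le> inf (principal (nearly_fixing a)) (principal (nearly_fixing b))"
    using nearly_fixing_mono[of "min a b" a] nearly_fixing_mono[of "min a b" b]
    by (intro bexI[of _ "min a b"]) auto
qed (auto simp: eventually_principal)

lemma filterlim_small_filter:
  "filterlim f small_filter F \<longleftrightarrow> (\<forall>\<epsilon>>0. \<forall>\<^sub>F s in F. f s \<in> nearly_fixing \<epsilon>)"
  unfolding small_filter_def filterlim_INF filterlim_principal by auto

text \<open>\<open>f\<close> vanishes outside the smaller ball, so a larger cutoff is invisible to
  the pairing.\<close>

lemma inner_translate_change_radius:
  assumes "f \<in> U" "M \<le> M'" "translate M' z \<phi> \<in> L2 lborel"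
  shows "L2_inner lborel f (translate M' z \<phi>) = L2_inner lborel f (translate M z \<phi>)"
proof (rule L2_inner_cong_AE)
  show "AE x in lborel. f x * translate M' z \<phi> x = f x * translate M z \<phi> x"
    using U_vanish[OF assms(1)] by eventually_elim (use assms(2) in \<open>auto simp: translate_def indicator_def\<close>)
qed (use assms U_L2 translate_mono(1)[OF assms(2,3)] in auto)

text \<open>Iterated translations call for a second radius: after a move by y the point may have
  left the ball of radius M.\<close>

lemma translate_radius:
  obtains M' where "M \<le> M'" "\<And>x y. norm x \<le> M \<Longrightarrow> norm y \<le> 1 \<Longrightarrow> norm (star x y) \<le> M'"
proof -
  have "compact (mul ` (cball 0 M \<times> cball 0 1))"
    by (intro compact_continuous_image compact_Times compact_cball continuous_on_subset[OF Ck_continuous[OF Ck_mul] subset_UNIV])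
  from compact_imp_bounded[OF this] obtain m where m: "\<forall>p\<in>mul ` (cball 0 M \<times> cball 0 1). norm p \<le> m"
    unfolding bounded_iff by blast
  have "norm (star x y) \<le> m" if "norm x \<le> M" "norm y \<le> 1" for x y
    using m[THEN bspec, OF imageI, of "(x, y)"] that by (simp add: mul_apply)
  then show ?thesis using that[of "max M m"] by (simp add: le_max_iff_disj)
qed

text \<open>The uniform bound \<open>C\<close> on translations closes near fixing under products and
  inverses, at the cost of a factor in \<epsilon>; horizontal directions enter through
  \<open>horizontal_estimate\<close>.\<close>

sublocale carnot_filter star ginv wt r small_filter B
proof
  obtain M' where M': "M \<le> M'" "\<And>x y. norm x \<le> M \<Longrightarrow> norm y \<le> 1 \<Longrightarrow> norm (star x y) \<le> M'"
    by (rule translate_radius) (rule that)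
  have "0 \<le> M'" using M M' by simp
  then obtain C where C: "0 \<le> C" "\<And>z \<phi>. norm z \<le> 1 \<Longrightarrow> \<phi> \<in> L2 lborel \<Longrightarrow> translate M' z \<phi> \<in> L2 lborel"
    "\<And>z \<phi>. norm z \<le> 1 \<Longrightarrow> \<phi> \<in> L2 lborel \<Longrightarrow> L2norm lborel (translate M' z \<phi>) \<le> C * L2norm lborel \<phi>"
    by (rule translate_L2) (rule that)
  have trM: "translate M z \<phi> \<in> L2 lborel" if "norm z \<le> 1" "\<phi> \<in> L2 lborel" for z \<phi>
    using translate_mono(1)[OF M'(1) C(2)[OF that]] .
  have nf: "\<bar>L2_inner lborel f (translate M y \<phi>) - L2_inner lborel f \<phi>\<bar> \<le> \<epsilon> * L2norm lborel \<phi>"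
    if "y \<in> nearly_fixing \<epsilon>" "f \<in> U" "\<phi> \<in> L2 lborel" for y \<epsilon> f \<phi>
  proof -
    have "norm y \<le> 1" "\<bar>L2_inner lborel f (translate M y \<phi> - \<phi>)\<bar> \<le> \<epsilon> * L2norm lborel \<phi>"
      using that by (auto simp: nearly_fixing_def)
    then show ?thesis using L2.diff_right[OF U_L2[OF that(2)] trM[OF _ that(3)] that(3), of y] by simp
  qed
  have nfI: "y \<in> nearly_fixing \<epsilon>"
    if "norm y < \<epsilon>" "norm y < 1"
      "\<And>f \<phi>. f \<in> U \<Longrightarrow> \<phi> \<in> L2 lborel \<Longrightarrow> \<bar>L2_inner lborel f (translate M y \<phi>) - L2_inner lborel f \<phi>\<bar> \<le> \<epsilon> * L2norm lborel \<phi>"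
    for y \<epsilon>
    using that L2.diff_right[OF U_L2 trM, of _ y] by (auto simp: nearly_fixing_def)
  have composition: "star y z \<in> nearly_fixing \<epsilon>"
    if y: "y \<in> nearly_fixing \<delta>" and z: "z \<in> nearly_fixing \<delta>" and \<delta>: "0 < \<delta>" "\<delta> * (C + 1) \<le> \<epsilon>"
      and small: "norm (star y z) < \<epsilon>" "norm (star y z) < 1" for y z \<delta> \<epsilon>
  proof (rule nfI[OF small])
    fix f \<phi> :: "real^'n \<Rightarrow> real" assume f: "f \<in> U" and \<phi>: "\<phi> \<in> L2 lborel"
    have le1: "norm y \<le> 1" "norm z \<le> 1" using y z by (auto simp: nearly_fixing_def)
    let ?\<psi> = "translate M' z \<phi>"
    have \<psi>: "?\<psi> \<in> L2 lborel" using C(2) le1 \<phi> by blast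
    \<comment> \<open>From the ball of radius M, translation by y lands in the ball of radius M', so
      the inner cutoff is 1 there.\<close>
    have eq: "translate M (star y z) \<phi> = translate M y ?\<psi>"
      using M'(2)[OF _ le1(1)] by (auto simp: fun_eq_iff translate_def indicator_def assoc)
    have "\<bar>L2_inner lborel f (translate M y ?\<psi>) - L2_inner lborel f ?\<psi>\<bar> \<le> \<delta> * L2norm lborel ?\<psi>"
      by (rule nf[OF y f \<psi>])
    also have "\<dots> \<le> \<delta> * (C * L2norm lborel \<phi>)" using C(3)[OF le1(2) \<phi>] \<delta> by (intro mult_left_mono) auto
    finally have 1: "\<bar>L2_inner lborel f (translate M y ?\<psi>) - L2_inner lborel f (translate M z \<phi>)\<bar> \<le> \<delta> * (C * L2norm lborel \<phi>)"
      using inner_translate_change_radius[OF f M'(1) \<psi>] by simp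
    have "\<delta> * (C * L2norm lborel \<phi>) + \<delta> * L2norm lborel \<phi> = (\<delta> * (C + 1)) * L2norm lborel \<phi>"
      by (simp add: algebra_simps)
    also have "\<dots> \<le> \<epsilon> * L2norm lborel \<phi>" using \<delta> by (intro mult_right_mono L2norm_nonneg)
    finally show "\<bar>L2_inner lborel f (translate M (star y z) \<phi>) - L2_inner lborel f \<phi>\<bar> \<le> \<epsilon> * L2norm lborel \<phi>"
      using 1 nf[OF z f \<phi>] unfolding eq by linarith
  qed
  show "filterlim (\<lambda>(x, y). star x y) small_filter (small_filter \<times>\<^sub>F small_filter)"
    unfolding filterlim_small_filter
  proof (intro allI impI)
    fix \<epsilon> :: real assume \<epsilon>: "\<epsilon> > 0"
    have "isCont mul (0, 0)" using Ck_continuous[OF Ck_mul[of 0]] by (simp add: continuous_on_eq_continuous_within)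
    then obtain d where d: "d > 0" "\<And>p. dist p (0, 0) < d \<Longrightarrow> dist (mul p) (mul (0, 0)) < min \<epsilon> 1"
      using \<epsilon> unfolding continuous_at_eps_delta by (metis min_less_iff_conj zero_less_one)
    \<comment> \<open>d / 2 puts the pair into the ball given by continuity. \<epsilon> / (C + 1)
      pays for the two steps of \<open>composition\<close>: \<delta> C for the translate by z as
      test vector, \<delta> for \<open>\<phi>\<close>.\<close>
    define \<delta> where "\<delta> = min (d / 2) (\<epsilon> / (C + 1))"
    have C1: "0 < C + 1" using C(1) by simp
    have "\<delta> \<le> \<epsilon> / (C + 1)" unfolding \<delta>_def by (rule min.cobounded2)
    then have "\<delta> * (C + 1) \<le> \<epsilon>" using C1 by (simp only: pos_le_divide_eq)
    moreover have "\<delta> > 0" using d \<epsilon> C1 by (simp add: \<delta>_def)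
    moreover have "\<delta> \<le> d / 2" unfolding \<delta>_def by (rule min.cobounded1)
    ultimately have \<delta>: "\<delta> > 0" "\<delta> \<le> d / 2" "\<delta> * (C + 1) \<le> \<epsilon>" by blast+
    have ev: "eventually (\<lambda>y. y \<in> nearly_fixing \<delta>) small_filter"
      unfolding eventually_small_filter using \<delta> by blast
    have "star y z \<in> nearly_fixing \<epsilon>" if yz: "y \<in> nearly_fixing \<delta>" "z \<in> nearly_fixing \<delta>" for y z
    proof (rule composition[OF yz \<delta>(1,3)])
      have "(y, z) \<in> ball (0, 0) d"
        by (rule Pair_in_ball_zero) (use yz \<delta> in \<open>auto simp: nearly_fixing_def\<close>)
      then have "dist (y, z) (0, 0) < d" by (simp add: dist_commute)
      from d(2)[OF this] show "norm (star y z) < \<epsilon>" "norm (star y z) < 1" by (auto simp: mul_apply)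
    qed
    then show "\<forall>\<^sub>F s in small_filter \<times>\<^sub>F small_filter. (case s of (x, y) \<Rightarrow> star x y) \<in> nearly_fixing \<epsilon>"
      unfolding eventually_prod_filter using ev by auto
  qed
  show "filterlim uminus small_filter small_filter"
    unfolding filterlim_small_filter
  proof (intro allI impI)
    fix \<epsilon> :: real assume \<epsilon>: "\<epsilon> > 0"
    define \<delta> where "\<delta> = \<epsilon> / (C + 1)"
    have \<delta>: "\<delta> > 0" "\<delta> \<le> \<epsilon>" "\<delta> * C \<le> \<epsilon>" using \<epsilon> C(1) by (auto simp: \<delta>_def field_simps)
    have "- y \<in> nearly_fixing \<epsilon>" if y: "y \<in> nearly_fixing \<delta>" for y
    proof (rule nfI)
      show "norm (- y) < \<epsilon>" "norm (- y) < 1" using y \<delta> by (auto simp: nearly_fixing_def)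
      have le1: "norm y \<le> 1" "norm (- y) \<le> 1" using y by (auto simp: nearly_fixing_def)
      fix f \<phi> :: "real^'n \<Rightarrow> real" assume f: "f \<in> U" and \<phi>: "\<phi> \<in> L2 lborel"
      \<comment> \<open>Translating this function by y gives back \<open>\<phi>\<close> on the ball,
        so the estimate for y becomes the one for -y with its two terms exchanged.\<close>
      let ?\<psi> = "translate M' (- y) \<phi>"
      have \<psi>: "?\<psi> \<in> L2 lborel" using C(2) le1 \<phi> by blast
      have "L2_inner lborel f (translate M y ?\<psi>) = L2_inner lborel f \<phi>"
      proof (rule L2_inner_cong_AE)
        show "AE x in lborel. f x * translate M y ?\<psi> x = f x * \<phi> x"
          using U_vanish[OF f] by eventually_elim (use M'(2)[OF _ le1(1)] in \<open>auto simp: translate_def indicator_def\<close>)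
      qed (use f \<phi> U_L2 trM[OF le1(1) \<psi>] in auto)
      then have "\<bar>L2_inner lborel f (translate M (- y) \<phi>) - L2_inner lborel f \<phi>\<bar> \<le> \<delta> * L2norm lborel ?\<psi>"
        using nf[OF y f \<psi>] inner_translate_change_radius[OF f M'(1) \<psi>] by simp
      also have "\<dots> \<le> \<delta> * (C * L2norm lborel \<phi>)" using C(3)[OF le1(2) \<phi>] \<delta> by (intro mult_left_mono) auto
      also have "\<dots> \<le> \<epsilon> * L2norm lborel \<phi>"
        unfolding mult.assoc[symmetric] using \<delta> by (intro mult_right_mono L2norm_nonneg)
      finally show "\<bar>L2_inner lborel f (translate M (- y) \<phi>) - L2_inner lborel f \<phi>\<bar> \<le> \<epsilon> * L2norm lborel \<phi>" .
    qed
    then show "\<forall>\<^sub>F s in small_filter. - s \<in> nearly_fixing \<epsilon>"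
      unfolding eventually_small_filter using \<delta>(1) by blast
  qed
  have zero: "0 \<in> nearly_fixing \<epsilon>" if \<epsilon>: "\<epsilon> > 0" for \<epsilon>
  proof (rule nfI)
    fix f \<phi> :: "real^'n \<Rightarrow> real" assume f: "f \<in> U" and \<phi>: "\<phi> \<in> L2 lborel"
    have "L2_inner lborel f (translate M 0 \<phi>) = L2_inner lborel f \<phi>"
    proof (rule L2_inner_cong_AE)
      show "AE x in lborel. f x * translate M 0 \<phi> x = f x * \<phi> x"
        using U_vanish[OF f] by eventually_elim (auto simp: translate_def indicator_def)
    qed (use f \<phi> U_L2 trM[of 0 \<phi>] in auto)
    then show "\<bar>L2_inner lborel f (translate M 0 \<phi>) - L2_inner lborel f \<phi>\<bar> \<le> \<epsilon> * L2norm lborel \<phi>"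
      using \<epsilon> by (simp add: L2norm_nonneg)
  qed (use \<epsilon> in auto)
  show "P 0" if "eventually P small_filter" for P
    using that zero unfolding eventually_small_filter by blast
  show "filterlim (\<lambda>t. t *\<^sub>R v) small_filter (nhds 0)" if v: "v \<in> B" for v
    unfolding filterlim_small_filter
  proof (intro allI impI)
    fix \<epsilon> :: real assume \<epsilon>: "\<epsilon> > 0"
    \<comment> \<open>A constant of its own, since \<open>horizontal_estimate\<close> works with the
      cutoff radius M + 2.\<close>
    have "0 \<le> M + 2" using M by simp
    then obtain C where C: "0 \<le> C" "\<And>z \<phi>. norm z \<le> 1 \<Longrightarrow> \<phi> \<in> L2 lborel \<Longrightarrow> translate (M + 2) z \<phi> \<in> L2 lborel"
      "\<And>z \<phi>. norm z \<le> 1 \<Longrightarrow> \<phi> \<in> L2 lborel \<Longrightarrow> L2norm lborel (translate (M + 2) z \<phi>) \<le> C * L2norm lborel \<phi>"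
      by (rule translate_L2) (rule that)
    have lim: "((\<lambda>t. \<bar>t\<bar> * C) \<longlongrightarrow> \<bar>0\<bar> * C) (nhds 0)" "((\<lambda>t. norm (t *\<^sub>R v)) \<longlongrightarrow> norm (0 *\<^sub>R v)) (nhds 0)"
      by (intro tendsto_intros filterlim_ident)+
    have "\<forall>\<^sub>F t in nhds 0. \<bar>t\<bar> * C < \<epsilon>"
      by (rule order_tendstoD(2)[OF lim(1)]) (use \<epsilon> in simp)
    moreover have "\<forall>\<^sub>F t in nhds 0. norm (t *\<^sub>R v) < min \<epsilon> 1"
      by (rule order_tendstoD(2)[OF lim(2)]) (use \<epsilon> in simp)
    ultimately show "\<forall>\<^sub>F t in nhds 0. t *\<^sub>R v \<in> nearly_fixing \<epsilon>"
    proof eventually_elim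
      fix t assume t: "\<bar>t\<bar> * C < \<epsilon>" "norm (t *\<^sub>R v) < min \<epsilon> 1"
      have "\<bar>L2_inner lborel f (translate M (t *\<^sub>R v) \<phi> - \<phi>)\<bar> \<le> \<epsilon> * L2norm lborel \<phi>"
        if f: "f \<in> U" and \<phi>: "\<phi> \<in> L2 lborel" for f \<phi>
      proof -
        obtain g where g: "g \<in> L2 lborel" "L2norm lborel g \<le> 1" "has_distr_derivative star v f g"
          using U_derivative[OF f v] by blast
        have "\<bar>L2_inner lborel f (translate M (t *\<^sub>R v) \<phi> - \<phi>)\<bar> \<le> \<bar>t\<bar> * (L2norm lborel g * (C * L2norm lborel \<phi>))"
          by (rule horizontal_estimate[OF M U_L2[OF f] U_vanish[OF f] g(1,3) \<phi> C]) (use t in auto)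
        also have "\<dots> \<le> \<bar>t\<bar> * (1 * (C * L2norm lborel \<phi>))"
          using g(2) C(1) by (intro mult_left_mono mult_right_mono) (auto simp: L2norm_nonneg)
        also have "\<dots> = (\<bar>t\<bar> * C) * L2norm lborel \<phi>" by simp
        also have "\<dots> \<le> \<epsilon> * L2norm lborel \<phi>" using t by (intro mult_right_mono L2norm_nonneg) simp
        finally show ?thesis .
      qed
      then show "t *\<^sub>R v \<in> nearly_fixing \<epsilon>" using t by (auto simp: nearly_fixing_def)
    qed
  qed
  show "span B = layer wt 1" by (rule span_B)
qed

text \<open>The gain from \<open>nhds_zero_le\<close>: near invariance passes from horizontal
  directions to all directions, still uniformly on \<open>U\<close>.\<close>

lemma nearly_fixing_nhds:
  assumes "\<epsilon> > 0"
  obtains \<delta> where "\<delta> > 0" "\<And>y. norm y < \<delta> \<Longrightarrow> y \<in> nearly_fixing \<epsilon>"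
proof -
  have "eventually (\<lambda>y. y \<in> nearly_fixing \<epsilon>) small_filter"
    unfolding eventually_small_filter using assms by blast
  then have "eventually (\<lambda>y. y \<in> nearly_fixing \<epsilon>) (nhds 0)"
    using nhds_zero_le by (rule filter_leD[rotated])
  then show ?thesis using that by (auto simp: eventually_nhds_metric)
qed

end

section \<open>An Ehrling inequality\<close>

lemma unit_mass_near_zero:
  assumes "\<delta> > 0"
  obtains \<rho> :: "'a::euclidean_space \<Rightarrow> real" where "continuous_on UNIV \<rho>" "\<And>y. 0 \<le> \<rho> y"
    "\<And>y. \<delta> \<le> norm y \<Longrightarrow> \<rho> y = 0" "integrable lborel \<rho>" "(\<integral>y. \<rho> y \<partial>lborel) = 1"
proof -
  define \<rho>0 where "\<rho>0 y = max 0 (\<delta> - norm y)" for y :: 'a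
  have cont: "continuous_on UNIV \<rho>0" unfolding \<rho>0_def by (intro continuous_intros)
  have int: "integrable lborel \<rho>0"
    by (rule continuous_bounded_support_L2(2)[OF cont bounded_cball[of 0 \<delta>]]) (simp add: \<rho>0_def)
  have pos: "(\<integral>y. \<rho>0 y \<partial>lborel) > 0"
  proof -
    have "0 < \<delta> / 2 * measure lborel (cball (0::'a) (\<delta> / 2))"
      using content_cball_pos[of "\<delta> / 2" "0::'a"] assms by simp
    also have "\<dots> = (\<integral>y. \<delta> / 2 * indicator (cball (0::'a) (\<delta> / 2)) y \<partial>lborel)"
      using emeasure_bounded_finite[OF bounded_cball, of "0::'a" "\<delta> / 2"] by simp
    also have "\<dots> \<le> (\<integral>y. \<rho>0 y \<partial>lborel)"
    proof (rule integral_mono[OF _ int])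
      show "integrable lborel (\<lambda>y. \<delta> / 2 * indicator (cball (0::'a) (\<delta> / 2)) y)"
        using emeasure_bounded_finite[OF bounded_cball, of "0::'a" "\<delta> / 2"]
        by (intro integrable_mult_right integrable_real_indicator) auto
    qed (use assms in \<open>auto simp: \<rho>0_def indicator_def\<close>)
    finally show ?thesis .
  qed
  have zero: "\<rho>0 y = 0" if "\<delta> \<le> norm y" for y using that by (simp add: \<rho>0_def)
  have nonneg: "0 \<le> \<rho>0 y" for y by (simp add: \<rho>0_def)
  show ?thesis
    by (rule that[of "\<lambda>y. \<rho>0 y / (\<integral>y. \<rho>0 y \<partial>lborel)"])
      (use cont int pos zero nonneg in \<open>auto intro!: continuous_intros\<close>)
qed

context horizontal_family
begin

text \<open>The substitution u = x y frees the argument of \<open>f\<close>: an average over right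
  translations becomes a pairing with the kernel \<open>\<kappa>\<close>, which contains only the
  Jacobian and \<open>\<rho>\<close>. Since \<open>f\<close> vanishes outside the ball, the kernel
  may be cut off there.\<close>

lemma left_average_kernel:
  assumes f: "f \<in> U" and \<rho>: "continuous_on UNIV \<rho>"
  defines "\<kappa> \<equiv> \<lambda>x u. left_jac (- x, u) * \<rho> (star (- x) u)"
  shows "(\<lambda>u. indicator (cball 0 M) u * \<kappa> x u) \<in> L2 lborel"
    and "(\<integral>y. \<rho> y * f (star x y) \<partial>lborel) = L2_inner lborel (\<lambda>u. indicator (cball 0 M) u * \<kappa> x u) f"
proof -
  have f_meas: "f \<in> borel_measurable borel" using L2_measurable[OF U_L2[OF f]] by simp
  have cont: "continuous_on UNIV (\<lambda>u. (- x, u))" by (intro continuous_intros)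
  have cont\<kappa>: "continuous_on UNIV (\<kappa> x)"
    unfolding \<kappa>_def
    by (intro continuous_on_mult continuous_on_compose2[OF continuous_jac(2)[of UNIV] cont]
        continuous_on_compose2[OF \<rho>] continuous_star continuous_intros) auto
  show L2: "(\<lambda>u. indicator (cball 0 M) u * \<kappa> x u) \<in> L2 lborel"
  proof -
    have "integrable lborel (\<lambda>u. indicator (cball 0 M) u *\<^sub>R (\<kappa> x u)\<^sup>2)"
      by (intro borel_integrable_compact compact_cball continuous_intros continuous_on_subset[OF cont\<kappa>] subset_UNIV)
    moreover have "(\<lambda>u. indicator (cball 0 M) u *\<^sub>R (\<kappa> x u)\<^sup>2) = (\<lambda>u. (indicator (cball 0 M) u * \<kappa> x u)\<^sup>2)"
      by (auto simp: fun_eq_iff indicator_def)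
    moreover have "(\<lambda>u. indicator (cball 0 M) u * \<kappa> x u) \<in> borel_measurable lborel"
      using borel_measurable_continuous_onI[OF cont\<kappa>] by (intro borel_measurable_times borel_measurable_indicator) auto
    ultimately show ?thesis by (simp add: L2_real_iff)
  qed
  have d1: "(star (- x) has_derivative (\<lambda>b. frechet_derivative mul (at (- x, u)) (0, b))) (at u)" for u
    using star_right_has_derivative[of "- x" u UNIV] by (simp add: rfield_def)
  have d2: "bij (star (- x))" using bij_star_left[of "- x"] by simp
  have d3: "continuous_on UNIV (\<lambda>u. frechet_derivative mul (at (- x, u)) (0, v))" for v
    by (rule continuous_on_compose2[OF continuous_mul_derivative[of UNIV] cont]) simp
  have d4: "(\<lambda>y. \<rho> y * f (star x y)) \<in> borel_measurable borel"
    using borel_measurable_continuous_onI[OF \<rho>] measurable_compose[OF star_left_measurable f_meas] by simp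
  have cov: "integrable lborel (\<lambda>u. left_jac (- x, u) * (\<rho> (star (- x) u) * f (star x (star (- x) u)))) \<longleftrightarrow>
      integrable lborel (\<lambda>y. \<rho> y * f (star x y))"
    "integrable lborel (\<lambda>y. \<rho> y * f (star x y)) \<Longrightarrow>
      (\<integral>u. left_jac (- x, u) * (\<rho> (star (- x) u) * f (star x (star (- x) u))) \<partial>lborel) = (\<integral>y. \<rho> y * f (star x y) \<partial>lborel)"
    unfolding left_jac_def by (fact change_of_variables[OF d1 d2 d4 d3])+
  have eq: "left_jac (- x, u) * (\<rho> (star (- x) u) * f (star x (star (- x) u))) = \<kappa> x u * f u" for u
    by (simp add: \<kappa>_def)
  have ae: "AE u in lborel. (indicator (cball 0 M) u * \<kappa> x u) * f u = \<kappa> x u * f u"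
    using U_vanish[OF f] by eventually_elim (auto simp: indicator_def)
  have meas: "(\<lambda>u. \<kappa> x u * f u) \<in> borel_measurable lborel"
    using borel_measurable_continuous_onI[OF cont\<kappa>] f_meas by (intro borel_measurable_times) auto
  have int0: "integrable lborel (\<lambda>u. (indicator (cball 0 M) u * \<kappa> x u) * f u)"
    by (rule L2_mult_integrable[OF L2 U_L2[OF f]])
  have "integrable lborel (\<lambda>u. \<kappa> x u * f u)"
    by (rule integrable_cong_AE_imp[OF int0 meas ae])
  then have "(\<integral>y. \<rho> y * f (star x y) \<partial>lborel) = (\<integral>u. \<kappa> x u * f u \<partial>lborel)"
    using cov unfolding eq by simp
  also have "\<dots> = (\<integral>u. (indicator (cball 0 M) u * \<kappa> x u) * f u \<partial>lborel)"
    by (rule integral_cong_AE[symmetric]) (use int0 meas ae in auto)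
  finally show "(\<integral>y. \<rho> y * f (star x y) \<partial>lborel) = L2_inner lborel (\<lambda>u. indicator (cball 0 M) u * \<kappa> x u) f"
    by (simp add: L2_inner_def)
qed

text \<open>The pairing of f with its translate by y, weighted by \<open>\<rho> y\<close>, is
  integrated in two orders. For each y with positive weight the pairing is at least the squared norm
  of f minus \<epsilon>. For each x the integral over y is f x times an average bounded by S; what
  remains is the integral of |f| over the ball, at most the norm of the indicator.\<close>

lemma average_estimate:
  assumes f: "f \<in> U" and \<rho>: "continuous_on UNIV \<rho>" "\<And>y. 0 \<le> \<rho> y" "integrable lborel \<rho>" "(\<integral>y. \<rho> y \<partial>lborel) = 1"
    and supp: "\<And>y. y \<notin> nearly_fixing \<epsilon> \<Longrightarrow> \<rho> y = 0" and \<epsilon>: "0 \<le> \<epsilon>"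
    and bound: "\<And>x. norm x \<le> M \<Longrightarrow> \<bar>\<integral>y. \<rho> y * f (star x y) \<partial>lborel\<bar> \<le> S"
  shows "(L2norm lborel f)\<^sup>2 \<le> \<epsilon> + L2norm lborel (indicator (cball (0::real^'n) M) :: real^'n \<Rightarrow> real) * S"
proof -
  have fL2: "f \<in> L2 lborel" by (rule U_L2[OF f])
  have f_meas: "f \<in> borel_measurable borel" using L2_measurable[OF fL2] by simp
  obtain C where C: "0 \<le> C" "\<And>z \<phi>. norm z \<le> 1 \<Longrightarrow> \<phi> \<in> L2 lborel \<Longrightarrow> translate M z \<phi> \<in> L2 lborel"
    "\<And>z \<phi>. norm z \<le> 1 \<Longrightarrow> \<phi> \<in> L2 lborel \<Longrightarrow> L2norm lborel (translate M z \<phi>) \<le> C * L2norm lborel \<phi>"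
    by (rule translate_L2[OF M]) (rule that)
  have le1: "norm y \<le> 1" if "\<rho> y \<noteq> 0" for y
  proof -
    have "y \<in> nearly_fixing \<epsilon>" using supp that by blast
    then show ?thesis by (simp add: nearly_fixing_def)
  qed
  define H where "H y x = \<rho> y * (f x * translate M y f x)" for y x
  have H_meas: "(\<lambda>(y, x). H y x) \<in> borel_measurable (lborel \<Otimes>\<^sub>M lborel)"
  proof -
    have sets: "sets (lborel \<Otimes>\<^sub>M lborel :: ((real^'n) \<times> (real^'n)) measure) = sets borel"
      by (subst lborel_prod) simp
    have 1: "(\<lambda>p :: (real^'n) \<times> (real^'n). f (star (snd p) (fst p))) \<in> borel_measurable borel"
      by (rule measurable_compose[OF borel_measurable_continuous_onI f_meas])
        (intro continuous_star continuous_intros)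
    have 2: "(\<lambda>p :: (real^'n) \<times> (real^'n). \<rho> (fst p)) \<in> borel_measurable borel"
      by (rule borel_measurable_continuous_onI) (rule continuous_on_compose2[OF \<rho>(1)], auto intro: continuous_intros)
    have 3: "(\<lambda>p :: (real^'n) \<times> (real^'n). f (snd p)) \<in> borel_measurable borel"
      by (rule measurable_compose[OF borel_measurable_continuous_onI f_meas]) (intro continuous_intros)
    have 4: "(\<lambda>p :: (real^'n) \<times> (real^'n). indicator (cball 0 M) (snd p) :: real) \<in> borel_measurable borel"
      by (rule measurable_compose[OF borel_measurable_continuous_onI borel_measurable_indicator]) (auto intro: continuous_intros)
    have "(\<lambda>p. H (fst p) (snd p)) \<in> borel_measurable borel"
      unfolding H_def translate_def by (intro borel_measurable_times 1 2 3 4)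
    then show ?thesis
      by (simp add: case_prod_unfold measurable_cong_sets[OF sets refl])
  qed
  have H_int: "integrable lborel (H y)" for y
  proof (cases "\<rho> y = 0")
    case False
    then show ?thesis unfolding H_def[abs_def]
      by (intro integrable_mult_right L2_mult_integrable fL2 C(2) le1)
  qed (simp add: H_def[abs_def])
  have absL2: "(\<lambda>x. \<bar>f x\<bar>) \<in> L2 lborel" "L2norm lborel (\<lambda>x. \<bar>f x\<bar>) = L2norm lborel f"
    using fL2 by (auto simp: L2_real_iff L2norm_def)
  \<comment> \<open>The uniform bound on translations makes the double integral absolutely
    convergent, as Fubini demands.\<close>
  have H_norm: "(\<integral>x. norm (H y x) \<partial>lborel) \<le> C * \<rho> y" for y
  proof (cases "\<rho> y = 0")
    case False
    have tr: "translate M y f \<in> L2 lborel" by (rule C(2)[OF le1[OF False] fL2])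
    have tr_abs: "(\<lambda>x. \<bar>translate M y f x\<bar>) \<in> L2 lborel" "L2norm lborel (\<lambda>x. \<bar>translate M y f x\<bar>) = L2norm lborel (translate M y f)"
      using tr by (auto simp: L2_real_iff L2norm_def)
    have "(\<integral>x. norm (H y x) \<partial>lborel) = \<rho> y * L2_inner lborel (\<lambda>x. \<bar>f x\<bar>) (\<lambda>x. \<bar>translate M y f x\<bar>)"
      using \<rho>(2)[of y] by (simp add: H_def abs_mult L2_inner_def)
    also have "\<dots> \<le> \<rho> y * (L2norm lborel f * L2norm lborel (translate M y f))"
      using L2_inner_Cauchy_Schwarz[OF absL2(1) tr_abs(1)] \<rho>(2)[of y] absL2(2) tr_abs(2)
      by (intro mult_left_mono) auto
    also have "\<dots> \<le> \<rho> y * (1 * (C * 1))"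
      using \<rho>(2)[of y] U_norm[OF f] C(1) order_trans[OF C(3)[OF le1[OF False] fL2] mult_left_mono[OF U_norm[OF f] C(1)]]
      by (intro mult_left_mono mult_mono) (auto simp: L2norm_nonneg)
    finally show ?thesis by (simp add: mult.commute)
  qed (simp add: H_def)
  have H_pair: "integrable (lborel \<Otimes>\<^sub>M lborel) (\<lambda>(y, x). H y x)"
  proof (rule lborel_pair.Fubini_integrable[OF H_meas])
    have "(\<lambda>y. \<integral>x. norm (H y x) \<partial>lborel) \<in> borel_measurable lborel"
      using H_meas by (intro lborel.borel_measurable_lebesgue_integral) (simp add: case_prod_unfold)
    moreover have "norm (\<integral>x. norm (H y x) \<partial>lborel) \<le> norm (C * \<rho> y)" for y
    proof -
      have "0 \<le> (\<integral>x. norm (H y x) \<partial>lborel)" by (rule integral_nonneg_AE) simp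
      then show ?thesis using H_norm[of y] by simp
    qed
    ultimately show "integrable lborel (\<lambda>y. \<integral>x. norm (case (y, x) of (y, x) \<Rightarrow> H y x) \<partial>lborel)"
      unfolding prod.case
      by (intro Bochner_Integration.integrable_bound[OF integrable_mult_right[OF \<rho>(3), of C]] AE_I2)
    show "AE y in lborel. integrable lborel (\<lambda>x. case (y, x) of (y, x) \<Rightarrow> H y x)"
      using H_int by simp
  qed
  have fst_int: "integrable lborel (\<lambda>y. \<integral>x. H y x \<partial>lborel)" using lborel_pair.integrable_fst[OF H_pair] .
  have snd_int: "integrable lborel (\<lambda>x. \<integral>y. H y x \<partial>lborel)" using lborel_pair.integrable_snd[OF H_pair] .
  have swap: "(\<integral>y. (\<integral>x. H y x \<partial>lborel) \<partial>lborel) = (\<integral>x. (\<integral>y. H y x \<partial>lborel) \<partial>lborel)"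
    using lborel_pair.Fubini_integral[OF H_pair] by simp
  let ?V = "L2norm lborel (indicator (cball (0::real^'n) M) :: real^'n \<Rightarrow> real)"
  have "(\<integral>x. (\<integral>y. H y x \<partial>lborel) \<partial>lborel) \<le> (\<integral>x. S * (\<bar>f x\<bar> * indicator (cball 0 M) x) \<partial>lborel)"
  proof (rule integral_mono[OF snd_int])
    show "integrable lborel (\<lambda>x. S * (\<bar>f x\<bar> * indicator (cball 0 M) x))"
      by (intro integrable_mult_right L2_mult_integrable absL2 indicator_cball_L2)
    fix x
    have "(\<integral>y. H y x \<partial>lborel) = (f x * indicator (cball 0 M) x) * (\<integral>y. \<rho> y * f (star x y) \<partial>lborel)"
      by (simp add: H_def translate_def ac_simps flip: integral_mult_right_zero)
    also have "\<dots> \<le> \<bar>f x * indicator (cball 0 M) x\<bar> * \<bar>\<integral>y. \<rho> y * f (star x y) \<partial>lborel\<bar>"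
      by (simp flip: abs_mult)
    also have "\<dots> \<le> S * (\<bar>f x\<bar> * indicator (cball 0 M) x)"
      using bound[of x] by (auto simp: indicator_def mult.commute[of S] intro: mult_left_mono)
    finally show "(\<integral>y. H y x \<partial>lborel) \<le> S * (\<bar>f x\<bar> * indicator (cball 0 M) x)" .
  qed
  also have "\<dots> = S * L2_inner lborel (\<lambda>x. \<bar>f x\<bar>) (indicator (cball 0 M))" by (simp add: L2_inner_def)
  also have "\<dots> \<le> S * (1 * ?V)"
  proof (rule mult_left_mono)
    have "L2_inner lborel (\<lambda>x. \<bar>f x\<bar>) (indicator (cball 0 M)) \<le> L2norm lborel f * ?V"
      using L2_inner_Cauchy_Schwarz[OF absL2(1) indicator_cball_L2[of 0 M]] absL2(2) by simp
    also have "\<dots> \<le> 1 * ?V" using U_norm[OF f] by (intro mult_right_mono L2norm_nonneg)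
    finally show "L2_inner lborel (\<lambda>x. \<bar>f x\<bar>) (indicator (cball 0 M)) \<le> 1 * ?V" .
    show "0 \<le> S" using bound[of 0] M by (rule_tac order_trans[OF abs_ge_zero]) simp
  qed
  finally have upper: "(\<integral>y. (\<integral>x. H y x \<partial>lborel) \<partial>lborel) \<le> ?V * S" using swap by (simp add: mult.commute)
  have lower: "\<rho> y * ((L2norm lborel f)\<^sup>2 - \<epsilon>) \<le> (\<integral>x. H y x \<partial>lborel)" for y
  proof (cases "\<rho> y = 0")
    case False
    then have y: "y \<in> nearly_fixing \<epsilon>" using supp by blast
    have tr: "translate M y f \<in> L2 lborel" by (rule C(2)[OF le1[OF False] fL2])
    have "L2_inner lborel f (translate M y f) - L2_inner lborel f f = L2_inner lborel f (translate M y f - f)"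
      by (rule L2.diff_right[OF fL2 tr fL2, symmetric])
    moreover have "\<bar>L2_inner lborel f (translate M y f - f)\<bar> \<le> \<epsilon> * L2norm lborel f"
      using y f fL2 by (auto simp: nearly_fixing_def)
    moreover have "\<epsilon> * L2norm lborel f \<le> \<epsilon>" using U_norm[OF f] \<epsilon> by (simp add: mult_left_le)
    moreover have "L2_inner lborel f f = (L2norm lborel f)\<^sup>2" using L2.nrm_sq[OF fL2] by (simp add: L2_nrm)
    ultimately have "(L2norm lborel f)\<^sup>2 - \<epsilon> \<le> L2_inner lborel f (translate M y f)" by linarith
    then have "\<rho> y * ((L2norm lborel f)\<^sup>2 - \<epsilon>) \<le> \<rho> y * L2_inner lborel f (translate M y f)"
      using \<rho>(2) by (rule mult_left_mono)
    then show ?thesis by (simp add: H_def L2_inner_def)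
  qed (simp add: H_def)
  have "(L2norm lborel f)\<^sup>2 - \<epsilon> = (\<integral>y. \<rho> y * ((L2norm lborel f)\<^sup>2 - \<epsilon>) \<partial>lborel)"
    using \<rho>(4) by simp
  also have "\<dots> \<le> (\<integral>y. (\<integral>x. H y x \<partial>lborel) \<partial>lborel)"
    by (rule integral_mono[OF integrable_mult_left[OF \<rho>(3)] fst_int lower])
  finally show ?thesis using upper by linarith
qed

text \<open>The kernels depend uniformly continuously on the centre x in the ball, so all averages
  are controlled by those at the finitely many centres of a net. Pairing with the kernels at these
  centres gives the functionals, and \<open>C\<close> is the norm of the indicator of the
  ball.\<close>

theorem ehrling:
  assumes "\<epsilon> > 0"
  obtains K :: "(real^'n \<Rightarrow> real) set" and C where "finite K" "K \<subseteq> L2 lborel" "0 \<le> C"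
    "\<And>f. f \<in> U \<Longrightarrow> (L2norm lborel f)\<^sup>2 \<le> \<epsilon> + C * (\<Sum>k\<in>K. \<bar>L2_inner lborel k f\<bar>)"
proof (cases "U = {}")
  case True
  show ?thesis by (rule that[of "{}" 0]) (use True in auto)
next
  case False
  \<comment> \<open>Any element of \<open>U\<close> gives access to
    \<open>left_average_kernel\<close>, whose first claim concerns the kernel alone.\<close>
  then obtain f0 where f0: "f0 \<in> U" by blast
  let ?V = "L2norm lborel (indicator (cball (0::real^'n) M) :: real^'n \<Rightarrow> real)"
  \<comment> \<open>Half of \<epsilon> is spent on near invariance; the net contributes \<epsilon>'
    times \<open>?V\<^sup>2\<close>, at most the other half. The added 1 covers a ball of measure
    zero.\<close>
  define \<epsilon>' where "\<epsilon>' = \<epsilon> / (2 * (?V\<^sup>2 + 1))"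
  have "?V\<^sup>2 + 1 > 0" by (intro add_nonneg_pos) auto
  then have \<epsilon>': "\<epsilon>' > 0" "\<epsilon>' * ?V\<^sup>2 \<le> \<epsilon> / 2" using assms by (auto simp: \<epsilon>'_def field_simps)
  have "\<epsilon> / 2 > 0" using assms by simp
  then obtain \<delta> where \<delta>: "\<delta> > 0" "\<And>y. norm y < \<delta> \<Longrightarrow> y \<in> nearly_fixing (\<epsilon> / 2)"
    by (rule nearly_fixing_nhds) (rule that)
  obtain \<rho> :: "real^'n \<Rightarrow> real" where \<rho>: "continuous_on UNIV \<rho>" "\<And>y. 0 \<le> \<rho> y"
    "\<And>y. \<delta> \<le> norm y \<Longrightarrow> \<rho> y = 0" "integrable lborel \<rho>" "(\<integral>y. \<rho> y \<partial>lborel) = 1"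
    by (rule unit_mass_near_zero[OF \<delta>(1)]) (rule that)
  have supp: "\<rho> y = 0" if "y \<notin> nearly_fixing (\<epsilon> / 2)" for y
    using \<delta>(2)[of y] \<rho>(3)[of y] that by force
  define \<kappa> where "\<kappa> x u = left_jac (- x, u) * \<rho> (star (- x) u)" for x u
  define k where "k x u = indicator (cball 0 M) u * \<kappa> x u" for x u
  have kL2: "k x \<in> L2 lborel" for x
    using left_average_kernel(1)[OF f0 \<rho>(1), of x] by (simp add: k_def[abs_def] \<kappa>_def)
  have avg: "(\<integral>y. \<rho> y * f (star x y) \<partial>lborel) = L2_inner lborel (k x) f" if "f \<in> U" for f x
    using left_average_kernel(2)[OF that \<rho>(1), of x] by (simp add: k_def[abs_def] \<kappa>_def)
  have "continuous_on (cball 0 M \<times> cball 0 M) (\<lambda>p. \<kappa> (fst p) (snd p))"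
    unfolding \<kappa>_def
    by (intro continuous_on_mult continuous_on_compose2[OF continuous_jac(2)[of UNIV]]
        continuous_on_compose2[OF \<rho>(1)] continuous_star continuous_intros) auto
  then have "uniformly_continuous_on (cball 0 M \<times> cball 0 M) (\<lambda>p. \<kappa> (fst p) (snd p))"
    by (rule compact_uniformly_continuous) (intro compact_Times compact_cball)
  then obtain d where d: "d > 0" "\<And>p q. p \<in> cball 0 M \<times> cball 0 M \<Longrightarrow> q \<in> cball 0 M \<times> cball 0 M \<Longrightarrow> dist q p < d \<Longrightarrow>
      dist (\<kappa> (fst q) (snd q)) (\<kappa> (fst p) (snd p)) < \<epsilon>'"
    using \<epsilon>'(1) unfolding uniformly_continuous_on_def by metis
  have \<kappa>_close: "\<bar>\<kappa> x u - \<kappa> x' u\<bar> < \<epsilon>'" if "norm x \<le> M" "norm x' \<le> M" "norm u \<le> M" "dist x x' < d" for x x' u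
    using d(2)[of "(x', u)" "(x, u)"] that by (simp add: dist_Pair_Pair dist_real_def)
  obtain X where X: "X \<subseteq> cball 0 M" "finite X" "cball (0::real^'n) M \<subseteq> (\<Union>x\<in>X. ball x d)"
    by (rule compactE_image[OF compact_cball[of "0::real^'n" M], of "cball 0 M" "\<lambda>x. ball x d"]) (use d(1) that in auto)
  have "(L2norm lborel f)\<^sup>2 \<le> \<epsilon> + ?V * (\<Sum>k\<in>k ` X. \<bar>L2_inner lborel k f\<bar>)" if f: "f \<in> U" for f
  proof -
    let ?S = "\<Sum>k\<in>k ` X. \<bar>L2_inner lborel k f\<bar>"
    have "(L2norm lborel f)\<^sup>2 \<le> \<epsilon> / 2 + ?V * (?S + \<epsilon>' * ?V)"
    proof (rule average_estimate[OF f \<rho>(1,2,4,5) supp])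
      fix x :: "real^'n" assume x: "norm x \<le> M"
      then obtain x' where x': "x' \<in> X" "dist x x' < d" using X(3) by (auto simp: dist_commute)
      then have "norm x' \<le> M" using X(1) by auto
      have "L2norm lborel (k x - k x') \<le> L2norm lborel (\<epsilon>' *\<^sub>R (indicator (cball (0::real^'n) M) :: real^'n \<Rightarrow> real))"
      proof (rule L2_bound(2))
        show "\<epsilon>' *\<^sub>R (indicator (cball (0::real^'n) M) :: real^'n \<Rightarrow> real) \<in> L2 lborel"
          by (intro L2.mem_scale indicator_cball_L2)
        show "k x - k x' \<in> borel_measurable lborel" by (intro L2_measurable L2.mem_diff kL2)
        have "\<bar>(k x - k x') u\<bar> \<le> \<bar>(\<epsilon>' *\<^sub>R indicator (cball 0 M)) u\<bar>" for u
          using \<kappa>_close[OF x \<open>norm x' \<le> M\<close> _ x'(2), of u] by (auto simp: k_def indicator_def)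
        then show "AE u in lborel. \<bar>(k x - k x') u\<bar> \<le> \<bar>(\<epsilon>' *\<^sub>R indicator (cball 0 M)) u\<bar>" by (rule AE_I2)
      qed
      also have "\<dots> = \<epsilon>' * ?V" using L2.nrm_scale[OF indicator_cball_L2, of \<epsilon>' 0 M] \<epsilon>'(1) by (simp add: L2_nrm)
      finally have kk: "L2norm lborel (k x - k x') \<le> \<epsilon>' * ?V" .
      have "\<bar>L2_inner lborel (k x - k x') f\<bar> \<le> L2norm lborel (k x - k x') * L2norm lborel f"
        by (intro L2_inner_Cauchy_Schwarz L2.mem_diff kL2 U_L2[OF f])
      also have "\<dots> \<le> (\<epsilon>' * ?V) * 1" using \<epsilon>'(1) by (intro mult_mono kk U_norm[OF f]) (auto simp: L2norm_nonneg)
      finally have "\<bar>L2_inner lborel (k x) f\<bar> \<le> \<bar>L2_inner lborel (k x') f\<bar> + \<epsilon>' * ?V"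
        using L2.diff_left[OF kL2 kL2 U_L2[OF f], of x x'] by linarith
      also have "\<bar>L2_inner lborel (k x') f\<bar> \<le> ?S"
        by (rule member_le_sum[of "k x'" "k ` X" "\<lambda>k. \<bar>L2_inner lborel k f\<bar>"]) (use x' X(2) in auto)
      finally show "\<bar>\<integral>y. \<rho> y * f (star x y) \<partial>lborel\<bar> \<le> ?S + \<epsilon>' * ?V" using avg[OF f] by simp
    qed (use assms in auto)
    also have "\<epsilon> / 2 + ?V * (?S + \<epsilon>' * ?V) = \<epsilon> / 2 + \<epsilon>' * ?V\<^sup>2 + ?V * ?S"
      by (simp add: algebra_simps power2_eq_square)
    finally show ?thesis using \<epsilon>'(2) by linarith
  qed
  then show ?thesis
    by (intro that[of "k ` X" ?V]) (use X(2) kL2 in \<open>auto simp: L2norm_nonneg\<close>)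
qed

end

section \<open>A Fredholm alternative\<close>

text \<open>The complexification seen as a real space, the pair (x, y) standing for x + i y.\<close>

lemma (in semi_hilbert_space) semi_hilbert_square:
  "semi_hilbert_space (D \<times> D) (\<lambda>p q. e (fst p) (fst q) + e (snd p) (snd q))" (is "semi_hilbert_space _ ?e")
proof -
  interpret sq: semi_inner_space "D \<times> D" ?e
  proof
    show "subspace (D \<times> D)" using subspace subspace by (rule subspace_Times)
  qed (auto simp: sym bilinear mem nonneg algebra_simps)
  have fst_le: "nrm (fst p) \<le> sq.nrm p" and snd_le: "nrm (snd p) \<le> sq.nrm p"
    and le: "sq.nrm p \<le> nrm (fst p) + nrm (snd p)" if "p \<in> D \<times> D" for p
  proof -
    have p: "fst p \<in> D" "snd p \<in> D" using that by auto
    show "nrm (fst p) \<le> sq.nrm p" "nrm (snd p) \<le> sq.nrm p"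
      using nonneg[OF p(1)] nonneg[OF p(2)] by (auto simp: nrm_def sq.nrm_def)
    show "sq.nrm p \<le> nrm (fst p) + nrm (snd p)"
      using nonneg[OF p(1)] nonneg[OF p(2)] by (auto simp: nrm_def sq.nrm_def sqrt_add_le_add_sqrt)
  qed
  show ?thesis
  proof
    fix s :: "nat \<Rightarrow> 'a \<times> 'a" assume s: "\<And>n. s n \<in> D \<times> D"
      and cauchy: "\<And>\<epsilon>. \<epsilon> > 0 \<Longrightarrow> \<exists>N. \<forall>m\<ge>N. \<forall>n\<ge>N. sq.nrm (s m - s n) < \<epsilon>"
    have s': "fst (s n) \<in> D" "snd (s n) \<in> D" for n using s[of n] by auto
    have diff: "s m - s n \<in> D \<times> D" for m n using s by (intro sq.mem_diff)
    have "\<exists>x\<in>D. (\<lambda>n. nrm (fst (s n) - x)) \<longlonglongrightarrow> 0"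
    proof (rule complete)
      fix \<epsilon> :: real assume "\<epsilon> > 0"
      from cauchy[OF this] obtain N where N: "\<forall>m\<ge>N. \<forall>n\<ge>N. sq.nrm (s m - s n) < \<epsilon>" ..
      have "nrm (fst (s m) - fst (s n)) < \<epsilon>" if "m \<ge> N" "n \<ge> N" for m n
        using fst_le[OF diff, of m n] N[rule_format, OF that] by simp
      then show "\<exists>N. \<forall>m\<ge>N. \<forall>n\<ge>N. nrm (fst (s m) - fst (s n)) < \<epsilon>" by blast
    qed (rule s')
    then obtain x where x: "x \<in> D" "(\<lambda>n. nrm (fst (s n) - x)) \<longlonglongrightarrow> 0" by blast
    have "\<exists>x\<in>D. (\<lambda>n. nrm (snd (s n) - x)) \<longlonglongrightarrow> 0"
    proof (rule complete)
      fix \<epsilon> :: real assume "\<epsilon> > 0"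
      from cauchy[OF this] obtain N where N: "\<forall>m\<ge>N. \<forall>n\<ge>N. sq.nrm (s m - s n) < \<epsilon>" ..
      have "nrm (snd (s m) - snd (s n)) < \<epsilon>" if "m \<ge> N" "n \<ge> N" for m n
        using snd_le[OF diff, of m n] N[rule_format, OF that] by simp
      then show "\<exists>N. \<forall>m\<ge>N. \<forall>n\<ge>N. nrm (snd (s m) - snd (s n)) < \<epsilon>" by blast
    qed (rule s')
    then obtain y where y: "y \<in> D" "(\<lambda>n. nrm (snd (s n) - y)) \<longlonglongrightarrow> 0" by blast
    have xy: "(x, y) \<in> D \<times> D" using x y by simp
    have "(\<lambda>n. sq.nrm (s n - (x, y))) \<longlonglongrightarrow> 0"
    proof (rule Lim_null_comparison)
      show "\<forall>\<^sub>F n in sequentially. norm (sq.nrm (s n - (x, y))) \<le> nrm (fst (s n) - x) + nrm (snd (s n) - y)"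
        using le[OF sq.mem_diff[OF s xy]] sq.nrm_nonneg[OF sq.mem_diff[OF s xy]]
        by (auto intro!: always_eventually)
      show "(\<lambda>n. nrm (fst (s n) - x) + nrm (snd (s n) - y)) \<longlonglongrightarrow> 0"
        using tendsto_add[OF x(2) y(2)] by simp
    qed
    then show "\<exists>p\<in>D \<times> D. (\<lambda>n. sq.nrm (s n - p)) \<longlonglongrightarrow> 0" using xy by blast
  qed
qed

text \<open>Here \<open>e\<close> is the energy inner product and \<open>l\<close> a weaker one; \<open>compact\<close> is the compactness of
  the embedding, quantified by finitely many functionals.\<close>

locale compact_form = semi_hilbert_space D e
  for D :: "'v::real_vector set" and e +
  fixes l :: "'v \<Rightarrow> 'v \<Rightarrow> real"
  assumes l_sym: "x \<in> D \<Longrightarrow> y \<in> D \<Longrightarrow> l x y = l y x"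
    and l_add: "x \<in> D \<Longrightarrow> y \<in> D \<Longrightarrow> z \<in> D \<Longrightarrow> l (x + y) z = l x z + l y z"
    and l_scale: "x \<in> D \<Longrightarrow> y \<in> D \<Longrightarrow> l (a *\<^sub>R x) y = a * l x y"
    and l_nonneg: "x \<in> D \<Longrightarrow> 0 \<le> l x x"
    and l_bound: "x \<in> D \<Longrightarrow> y \<in> D \<Longrightarrow> \<bar>l x y\<bar> \<le> nrm x * nrm y"
    and compact: "\<epsilon> > 0 \<Longrightarrow> \<exists>(K :: ('v \<Rightarrow> real) set) C. finite K \<and> 0 \<le> C \<and>
      (\<forall>k\<in>K. \<forall>x\<in>D. \<forall>y\<in>D. k (x - y) = k x - k y) \<and> (\<forall>k\<in>K. \<forall>x\<in>D. \<forall>a. k (a *\<^sub>R x) = a * k x) \<and>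
      (\<exists>A. \<forall>k\<in>K. \<forall>x\<in>D. \<bar>k x\<bar> \<le> A * nrm x) \<and>
      (\<forall>x\<in>D. l x x \<le> \<epsilon> * e x x + C * nrm x * (\<Sum>k\<in>K. \<bar>k x\<bar>))"
begin

text \<open>The real and imaginary parts of the complexified form \<open>e + (\<alpha> + i \<beta>) l\<close> at \<open>x + i y\<close>.\<close>

definition re_part :: "real \<Rightarrow> real \<Rightarrow> 'v \<Rightarrow> 'v \<Rightarrow> 'v \<Rightarrow> real" where
  "re_part \<alpha> \<beta> x y h = e x h + \<alpha> * l x h - \<beta> * l y h"

definition im_part :: "real \<Rightarrow> real \<Rightarrow> 'v \<Rightarrow> 'v \<Rightarrow> 'v \<Rightarrow> real" where
  "im_part \<alpha> \<beta> x y h = e y h + \<alpha> * l y h + \<beta> * l x h"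

text \<open>The first conclusion bounds the inverse, the second solves the equation. Both come from
  one symmetric real form on pairs: \<open>compact\<close>, used on each component, gives its
  coercivity up to finitely many functionals, and with \<open>inj\<close> this makes it bounded
  below.\<close>

lemma complex_fredholm:
  assumes inj: "\<And>x y. x \<in> D \<Longrightarrow> y \<in> D \<Longrightarrow> (\<And>h. h \<in> D \<Longrightarrow> re_part \<alpha> \<beta> x y h = 0) \<Longrightarrow>
      (\<And>h. h \<in> D \<Longrightarrow> im_part \<alpha> \<beta> x y h = 0) \<Longrightarrow> e x x = 0 \<and> e y y = 0"
  shows "\<exists>C\<ge>0. \<forall>x\<in>D. \<forall>y\<in>D. \<forall>K\<ge>0. (\<forall>h\<in>D. \<bar>re_part \<alpha> \<beta> x y h\<bar> \<le> K * nrm h \<and> \<bar>im_part \<alpha> \<beta> x y h\<bar> \<le> K * nrm h) \<longrightarrow>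
      nrm x \<le> C * K \<and> nrm y \<le> C * K" (is ?bound)
    and "\<And>F G A. (\<And>x y. x \<in> D \<Longrightarrow> y \<in> D \<Longrightarrow> F (x + y) = F x + F y) \<Longrightarrow> (\<And>a x. x \<in> D \<Longrightarrow> F (a *\<^sub>R x) = a * F x) \<Longrightarrow>
      (\<And>x y. x \<in> D \<Longrightarrow> y \<in> D \<Longrightarrow> G (x + y) = G x + G y) \<Longrightarrow> (\<And>a x. x \<in> D \<Longrightarrow> G (a *\<^sub>R x) = a * G x) \<Longrightarrow>
      (\<And>x. x \<in> D \<Longrightarrow> \<bar>F x\<bar> \<le> A * nrm x) \<Longrightarrow> (\<And>x. x \<in> D \<Longrightarrow> \<bar>G x\<bar> \<le> A * nrm x) \<Longrightarrow> 0 \<le> A \<Longrightarrow>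
      \<exists>x\<in>D. \<exists>y\<in>D. \<forall>h\<in>D. re_part \<alpha> \<beta> x y h = F h \<and> im_part \<alpha> \<beta> x y h = G h"
proof -
  have l_add_right: "l x (y + z) = l x y + l x z" if "x \<in> D" "y \<in> D" "z \<in> D" for x y z
    using that l_sym[of x] l_add[of y z x] mem_add[of y z] by simp
  have l_scale_right: "l x (a *\<^sub>R y) = a * l x y" if "x \<in> D" "y \<in> D" for x y a
    using that l_sym[of x] l_scale[of y x a] mem_scale[of y a] by simp
  have l_minus: "l x (- y) = - l x y" "e x (- y) = - e x y" if "x \<in> D" "y \<in> D" for x y
    using l_scale_right[OF that, of "-1"] scale_right[OF that, of "-1"] by simp_all
  have zero: "e x 0 = 0" "l x 0 = 0" if "x \<in> D" for x
    using scale_right[OF that mem_zero, of 0] l_scale_right[OF that mem_zero, of 0] by simp_all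
  \<comment> \<open>The complexified form is complex symmetric rather than Hermitian; conjugating the second
    argument's imaginary part makes its real part a symmetric real form.\<close>
  define c where "c p q = re_part \<alpha> \<beta> (fst p) (snd p) (fst q) - im_part \<alpha> \<beta> (fst p) (snd p) (snd q)" for p q
  let ?e = "\<lambda>p q. e (fst p) (fst q) + e (snd p) (snd q)"
  interpret sq: semi_hilbert_space "D \<times> D" ?e by (rule semi_hilbert_square)
  have nrm_le: "nrm (fst p) \<le> sq.nrm p" "nrm (snd p) \<le> sq.nrm p" if "p \<in> D \<times> D" for p
    using nonneg[of "fst p"] nonneg[of "snd p"] that by (auto simp: nrm_def sq.nrm_def)
  have prod_le: "nrm x * nrm y \<le> sq.nrm p * sq.nrm q"
    if "p \<in> D \<times> D" "q \<in> D \<times> D" "x \<in> {fst p, snd p}" "y \<in> {fst q, snd q}" for p q x y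
    using nrm_le[OF that(1)] nrm_le[OF that(2)] that nrm_nonneg sq.nrm_nonneg
    by (intro mult_mono) auto
  have e_le: "\<bar>e x y\<bar> \<le> sq.nrm p * sq.nrm q" and l_le: "\<bar>l x y\<bar> \<le> sq.nrm p * sq.nrm q"
    if "p \<in> D \<times> D" "q \<in> D \<times> D" "x \<in> {fst p, snd p}" "y \<in> {fst q, snd q}" for p q x y
  proof -
    have "x \<in> D" "y \<in> D" using that by auto
    then show "\<bar>e x y\<bar> \<le> sq.nrm p * sq.nrm q" "\<bar>l x y\<bar> \<le> sq.nrm p * sq.nrm q"
      using prod_le[OF that] Cauchy_Schwarz[of x y] l_bound[of x y] by linarith+
  qed
  interpret sq: symmetric_form "D \<times> D" ?e c "2 + 2 * \<bar>\<alpha>\<bar> + 2 * \<bar>\<beta>\<bar>"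
  proof
    fix p q assume p: "p \<in> D \<times> D" and q: "q \<in> D \<times> D"
    then show "c p q = c q p"
      using l_sym sym by (auto simp: c_def re_part_def im_part_def)
    let ?N = "sq.nrm p * sq.nrm q"
    have *: "\<bar>\<gamma> * l x y\<bar> \<le> \<bar>\<gamma>\<bar> * ?N" if "x \<in> {fst p, snd p}" "y \<in> {fst q, snd q}" for \<gamma> x y
      using l_le[OF p q that] by (simp add: abs_mult mult_left_mono)
    have "\<bar>c p q\<bar> \<le> ?N + \<bar>\<alpha>\<bar> * ?N + \<bar>\<beta>\<bar> * ?N + (?N + \<bar>\<alpha>\<bar> * ?N + \<bar>\<beta>\<bar> * ?N)"
    proof -
      have tri: "\<bar>a1 + a2 - a3 - (b1 + b2 + b3)\<bar> \<le> \<bar>a1\<bar> + \<bar>a2\<bar> + \<bar>a3\<bar> + (\<bar>b1\<bar> + \<bar>b2\<bar> + \<bar>b3\<bar>)"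
        for a1 a2 a3 b1 b2 b3 :: real by linarith
      show ?thesis
        unfolding c_def re_part_def im_part_def
        by (rule order_trans[OF tri], intro add_mono e_le[OF p q] *) simp_all
    qed
    also have "\<dots> = (2 + 2 * \<bar>\<alpha>\<bar> + 2 * \<bar>\<beta>\<bar>) * sq.nrm p * sq.nrm q" by (simp add: algebra_simps)
    finally show "\<bar>c p q\<bar> \<le> (2 + 2 * \<bar>\<alpha>\<bar> + 2 * \<bar>\<beta>\<bar>) * sq.nrm p * sq.nrm q" .
  qed (auto simp: c_def re_part_def im_part_def bilinear l_add l_scale algebra_simps)
  \<comment> \<open>Chosen so that |\<alpha>| \<epsilon> is at most 1/2 and half of the squared norm
    can be absorbed on the left.\<close>
  define \<epsilon> where "\<epsilon> = 1 / (2 * (\<bar>\<alpha>\<bar> + 1))"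
  have \<epsilon>: "\<epsilon> > 0" "\<bar>\<alpha>\<bar> * \<epsilon> \<le> 1 / 2" by (auto simp: \<epsilon>_def field_simps)
  from compact[OF \<epsilon>(1)] obtain K :: "('v \<Rightarrow> real) set" and C where KC: "finite K" "0 \<le> C"
    "\<forall>k\<in>K. \<forall>x\<in>D. \<forall>y\<in>D. k (x - y) = k x - k y" "\<forall>k\<in>K. \<forall>x\<in>D. \<forall>a. k (a *\<^sub>R x) = a * k x"
    "\<exists>A. \<forall>k\<in>K. \<forall>x\<in>D. \<bar>k x\<bar> \<le> A * nrm x"
    "\<forall>x\<in>D. l x x \<le> \<epsilon> * e x x + C * nrm x * (\<Sum>k\<in>K. \<bar>k x\<bar>)"
    by (elim exE conjE) (rule that, (assumption | rule exI)+)
  from KC(5) obtain A where A: "\<forall>k\<in>K. \<forall>x\<in>D. \<bar>k x\<bar> \<le> A * nrm x" ..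
  note K = KC(1,2) KC(3,4)[rule_format] A[rule_format] KC(6)[rule_format]
  \<comment> \<open>Each functional acts on the first and on the second component; the boolean
    records which.\<close>
  define k2 where "k2 j p = fst j (if snd j then fst p else snd p)" for j :: "('v \<Rightarrow> real) \<times> bool" and p :: "'v \<times> 'v"
  let ?I = "K \<times> (UNIV :: bool set)"
  have sum_k2: "(\<Sum>j\<in>?I. \<bar>k2 j p\<bar>) = (\<Sum>k\<in>K. \<bar>k (fst p)\<bar>) + (\<Sum>k\<in>K. \<bar>k (snd p)\<bar>)" for p
    by (simp add: k2_def sum.cartesian_product' UNIV_bool sum.distrib)
  have est: "sq.nrm p \<le> (2 * max 1 (\<bar>\<alpha>\<bar> * C)) * (L + (\<Sum>j\<in>?I. \<bar>k2 j p\<bar>))"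
    if p: "p \<in> D \<times> D" and L: "0 \<le> L" "\<And>q. q \<in> D \<times> D \<Longrightarrow> \<bar>c p q\<bar> \<le> L * sq.nrm q" for p L
  proof -
    obtain x y where xy: "p = (x, y)" "x \<in> D" "y \<in> D" using p by auto
    let ?S = "\<Sum>j\<in>?I. \<bar>k2 j p\<bar>" and ?N = "sq.nrm p"
    have S: "0 \<le> ?S" by (intro sum_nonneg) auto
    have N: "0 \<le> ?N" using sq.nrm_nonneg[OF p] .
    \<comment> \<open>Testing with the conjugate (x, -y) makes both energies positive and cancels
      the terms with \<beta>, since \<open>l\<close> is symmetric.\<close>
    have q: "(x, - y) \<in> D \<times> D" using xy mem by simp
    have "sq.nrm (x, - y) = ?N"
      using xy scale_left[of y "- y" "-1"] l_minus(2)[of y y] mem_minus by (simp add: sq.nrm_def)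
    then have "\<bar>c p (x, - y)\<bar> \<le> L * ?N" using L(2)[OF q] by simp
    moreover have "c p (x, - y) = ?N\<^sup>2 + \<alpha> * (l x x + l y y)"
      using xy l_sym[of x y] sq.nrm_sq[OF p]
      by (simp add: c_def re_part_def im_part_def l_minus algebra_simps)
    ultimately have "?N\<^sup>2 \<le> L * ?N + \<bar>\<alpha>\<bar> * (l x x + l y y)"
      using abs_ge_minus_self[of "\<alpha> * (l x x + l y y)"] l_nonneg[of x] l_nonneg[of y] xy
      by (simp add: abs_mult)
    also have "l x x + l y y \<le> \<epsilon> * ?N\<^sup>2 + C * ?N * ?S"
    proof -
      have "C * nrm x * (\<Sum>k\<in>K. \<bar>k x\<bar>) \<le> C * ?N * (\<Sum>k\<in>K. \<bar>k x\<bar>)"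
        "C * nrm y * (\<Sum>k\<in>K. \<bar>k y\<bar>) \<le> C * ?N * (\<Sum>k\<in>K. \<bar>k y\<bar>)"
        using nrm_le[OF p] xy K(2) by (auto intro!: mult_right_mono mult_left_mono sum_nonneg)
      then have "l x x + l y y \<le> \<epsilon> * e x x + \<epsilon> * e y y + C * ?N * ((\<Sum>k\<in>K. \<bar>k x\<bar>) + (\<Sum>k\<in>K. \<bar>k y\<bar>))"
        using K(6)[OF xy(2)] K(6)[OF xy(3)] by (simp add: distrib_left)
      then show ?thesis using sq.nrm_sq[OF p] xy sum_k2[of p] by (simp add: distrib_left)
    qed
    then have "\<bar>\<alpha>\<bar> * (l x x + l y y) \<le> \<bar>\<alpha>\<bar> * (\<epsilon> * ?N\<^sup>2 + C * ?N * ?S)" by (rule mult_left_mono) simp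
    also have "\<dots> \<le> 1 / 2 * ?N\<^sup>2 + (\<bar>\<alpha>\<bar> * C) * ?S * ?N"
      using mult_right_mono[OF \<epsilon>(2), of "?N\<^sup>2"] by (simp add: algebra_simps)
    finally have "?N\<^sup>2 \<le> 2 * ((L + (\<bar>\<alpha>\<bar> * C) * ?S) * ?N)" by (simp add: algebra_simps)
    then have *: "?N * ?N \<le> 2 * (L + (\<bar>\<alpha>\<bar> * C) * ?S) * ?N"
      by (simp only: power2_eq_square mult.assoc)
    have "?N \<le> 2 * (L + (\<bar>\<alpha>\<bar> * C) * ?S)"
    proof (cases "?N = 0")
      case True
      then show ?thesis using L(1) K(2) S by simp
    next
      case False
      then show ?thesis using * N by (auto dest: mult_right_le_imp_le)
    qed
    also have "\<dots> \<le> 2 * (max 1 (\<bar>\<alpha>\<bar> * C) * L + max 1 (\<bar>\<alpha>\<bar> * C) * ?S)"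
    proof -
      have "1 * L \<le> max 1 (\<bar>\<alpha>\<bar> * C) * L" using L(1) by (intro mult_right_mono) auto
      moreover have "(\<bar>\<alpha>\<bar> * C) * ?S \<le> max 1 (\<bar>\<alpha>\<bar> * C) * ?S" using S by (intro mult_right_mono) auto
      ultimately show ?thesis by simp
    qed
    also have "\<dots> = (2 * max 1 (\<bar>\<alpha>\<bar> * C)) * (L + ?S)" by (simp add: algebra_simps)
    finally show ?thesis .
  qed
  have l2_diff: "l (x - y) z = l x z - l y z" if "x \<in> D" "y \<in> D" "z \<in> D" for x y z
    using l_add[of x "- y" z] l_scale[of y z "-1"] that mem_minus by simp
  have inj': "?e p p = 0" if p: "p \<in> D \<times> D" and cz: "\<And>q. q \<in> D \<times> D \<Longrightarrow> c p q = 0" for p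
  proof -
    obtain x y where xy: "p = (x, y)" "x \<in> D" "y \<in> D" using p by auto
    \<comment> \<open>The arguments (h, 0) and (0, h) of \<open>c\<close> recover the real and the
      imaginary equation separately.\<close>
    have "re_part \<alpha> \<beta> x y h = 0" if "h \<in> D" for h
      using cz[of "(h, 0)"] xy that mem_zero by (simp add: c_def im_part_def zero)
    moreover have "im_part \<alpha> \<beta> x y h = 0" if "h \<in> D" for h
      using cz[of "(0, h)"] xy that mem_zero by (simp add: c_def re_part_def zero)
    ultimately show ?thesis using inj[OF xy(2,3)] xy by simp
  qed
  obtain k where k: "k > 0" "\<And>p L. p \<in> D \<times> D \<Longrightarrow> 0 \<le> L \<Longrightarrow>
      (\<And>q. q \<in> D \<times> D \<Longrightarrow> \<bar>c p q\<bar> \<le> L * sq.nrm q) \<Longrightarrow> k * sq.nrm p \<le> L"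
  proof (rule sq.bounded_below_of_injective[where I = ?I and l = k2 and A = "\<bar>A\<bar>", OF _ _ _ _ est inj'])
    show "finite ?I" using K(1) by simp
    show "k2 j (a *\<^sub>R p) = a * k2 j p" if "j \<in> ?I" "p \<in> D \<times> D" for j p a
      using that K(4) by (auto simp: k2_def)
    show "k2 j (p - q) = k2 j p - k2 j q" if "j \<in> ?I" "p \<in> D \<times> D" "q \<in> D \<times> D" for j p q
      using that K(3) by (auto simp: k2_def)
    show "\<bar>k2 j p\<bar> \<le> \<bar>A\<bar> * sq.nrm p" if j: "j \<in> ?I" and p: "p \<in> D \<times> D" for j p
    proof -
      have "\<bar>k x\<bar> \<le> \<bar>A\<bar> * sq.nrm p" if "k \<in> K" "x \<in> D" "nrm x \<le> sq.nrm p" for k x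
      proof -
        have "\<bar>k x\<bar> \<le> A * nrm x" by (rule K(5)[OF that(1,2)])
        also have "\<dots> \<le> \<bar>A\<bar> * nrm x" using nrm_nonneg[OF that(2)] by (intro mult_right_mono) auto
        also have "\<dots> \<le> \<bar>A\<bar> * sq.nrm p" using that(3) by (intro mult_left_mono) auto
        finally show ?thesis .
      qed
      then show ?thesis using j p nrm_le[OF p] by (auto simp: k2_def)
    qed
  qed (use that in auto)
  show ?bound
  proof (intro exI[of _ "2 / k"] conjI ballI allI impI)
    show "0 \<le> 2 / k" using k(1) by simp
    fix x y L assume xy: "x \<in> D" "y \<in> D" and L: "0 \<le> (L::real)"
      and b: "\<forall>h\<in>D. \<bar>re_part \<alpha> \<beta> x y h\<bar> \<le> L * nrm h \<and> \<bar>im_part \<alpha> \<beta> x y h\<bar> \<le> L * nrm h"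
    have p: "(x, y) \<in> D \<times> D" using xy by simp
    have "k * sq.nrm (x, y) \<le> 2 * L"
    proof (rule k(2)[OF p])
      fix q assume q: "q \<in> D \<times> D"
      have "\<bar>c (x, y) q\<bar> \<le> L * nrm (fst q) + L * nrm (snd q)"
        unfolding c_def fst_conv snd_conv
        by (rule order_trans[OF abs_triangle_ineq4], intro add_mono) (use b q in auto)
      also have "\<dots> \<le> L * sq.nrm q + L * sq.nrm q"
        using nrm_le[OF q] L by (intro add_mono mult_left_mono)
      finally show "\<bar>c (x, y) q\<bar> \<le> 2 * L * sq.nrm q" by simp
    qed (use L in simp)
    then have "sq.nrm (x, y) \<le> 2 / k * L" using k(1) by (simp add: field_simps)
    then show "nrm x \<le> 2 / k * L" "nrm y \<le> 2 / k * L" using nrm_le[OF p] by simp_all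
  qed
  fix F G :: "'v \<Rightarrow> real" and A
  assume F: "\<And>x y. x \<in> D \<Longrightarrow> y \<in> D \<Longrightarrow> F (x + y) = F x + F y" "\<And>a x. x \<in> D \<Longrightarrow> F (a *\<^sub>R x) = a * F x"
    and G: "\<And>x y. x \<in> D \<Longrightarrow> y \<in> D \<Longrightarrow> G (x + y) = G x + G y" "\<And>a x. x \<in> D \<Longrightarrow> G (a *\<^sub>R x) = a * G x"
    and FG: "\<And>x. x \<in> D \<Longrightarrow> \<bar>F x\<bar> \<le> A * nrm x" "\<And>x. x \<in> D \<Longrightarrow> \<bar>G x\<bar> \<le> A * nrm x" "0 \<le> A"
  \<comment> \<open>The minus sign matches the one in front of \<open>im_part\<close> in
    \<open>c\<close>.\<close>
  obtain p where p: "p \<in> D \<times> D" "\<And>q. q \<in> D \<times> D \<Longrightarrow> c p q = F (fst q) - G (snd q)"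
  proof (rule sq.solvable_of_bounded_below[OF k, where F = "\<lambda>q. F (fst q) - G (snd q)" and K = "2 * A"])
    show "\<bar>F (fst q) - G (snd q)\<bar> \<le> 2 * A * sq.nrm q" if q: "q \<in> D \<times> D" for q
    proof -
      have "\<bar>F (fst q) - G (snd q)\<bar> \<le> A * nrm (fst q) + A * nrm (snd q)"
        using FG(1)[of "fst q"] FG(2)[of "snd q"] q by auto
      also have "\<dots> \<le> A * sq.nrm q + A * sq.nrm q"
        using nrm_le[OF q] FG(3) by (intro add_mono mult_left_mono)
      finally show ?thesis by simp
    qed
  qed (use F G that in \<open>auto simp: algebra_simps\<close>)
  obtain x y where xy: "p = (x, y)" "x \<in> D" "y \<in> D" using p by auto
  have FG0: "F 0 = 0" "G 0 = 0" using F(2)[OF mem_zero, of 0] G(2)[OF mem_zero, of 0] by simp_all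
  have "re_part \<alpha> \<beta> x y h = F h \<and> im_part \<alpha> \<beta> x y h = G h" if "h \<in> D" for h
    using p(2)[of "(h, 0)"] p(2)[of "(0, h)"] xy that mem_zero FG0
    by (simp add: c_def re_part_def im_part_def zero)
  then show "\<exists>x\<in>D. \<exists>y\<in>D. \<forall>h\<in>D. re_part \<alpha> \<beta> x y h = F h \<and> im_part \<alpha> \<beta> x y h = G h"
    using xy by blast
qed

end

section \<open>The horizontal Sobolev space\<close>

lemma L2_inner_cong_left:
  "AE x in M. f x = f' x \<Longrightarrow> f \<in> L2 M \<Longrightarrow> f' \<in> L2 M \<Longrightarrow> g \<in> L2 M \<Longrightarrow> L2_inner M f g = L2_inner M f' g"
  by (rule L2_inner_cong_AE) auto

lemma L2_inner_commute: "L2_inner M f g = L2_inner M g f"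
  by (simp add: L2_inner_def mult.commute)

lemma L2_inner_self: "f \<in> L2 M \<Longrightarrow> L2_inner M f f = (L2norm M f)\<^sup>2"
  using L2.nrm_sq[of f M] by (simp add: L2_nrm)

text \<open>The complement of the essential support is a union of possibly uncountably many open
  sets; Lindelof leaves countably many exceptional null sets.\<close>

lemma AE_zero_outside_ess_support: "AE x in lborel. x \<notin> ess_support f \<longrightarrow> f x = 0"
proof -
  define \<U> where "\<U> = {U. open U \<and> (AE x in lborel. x \<in> U \<longrightarrow> f x = 0)}"
  obtain \<V> where \<V>: "\<V> \<subseteq> \<U>" "countable \<V>" "\<Union>\<V> = \<Union>\<U>"
    using Lindelof[of \<U>] by (auto simp: \<U>_def)
  have "AE x in lborel. \<forall>U\<in>\<V>. x \<in> U \<longrightarrow> f x = 0"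
    using \<V> by (subst AE_ball_countable) (auto simp: \<U>_def)
  then show ?thesis
  proof eventually_elim
    fix x assume x: "\<forall>U\<in>\<V>. x \<in> U \<longrightarrow> f x = 0"
    show "x \<notin> ess_support f \<longrightarrow> f x = 0"
    proof
      assume "x \<notin> ess_support f"
      then have "x \<in> \<Union>\<V>" unfolding \<V>(3) by (auto simp: ess_support_def \<U>_def)
      then show "f x = 0" using x by blast
    qed
  qed
qed

lemma ess_support_subsetI:
  assumes "\<And>x. x \<notin> S \<Longrightarrow> \<exists>U. open U \<and> x \<in> U \<and> (AE y in lborel. y \<in> U \<longrightarrow> f y = 0)"
  shows "ess_support f \<subseteq> S"
proof
  fix x assume x: "x \<in> ess_support f"
  show "x \<in> S"
  proof (rule ccontr)
    assume "x \<notin> S"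
    from assms[OF this] show False using x unfolding ess_support_def by blast
  qed
qed

lemma ess_supportE:
  assumes "x \<notin> ess_support f"
  obtains U where "open U" "x \<in> U" "AE y in lborel. y \<in> U \<longrightarrow> f y = 0"
  using assms by (auto simp: ess_support_def)

locale sobolev = homogeneous_carnot_group star ginv wt r
  for star :: "real^'n \<Rightarrow> real^'n \<Rightarrow> real^'n" and ginv wt r +
  fixes B :: "(real^'n) set"
  assumes finite_B: "finite B" and span_B: "span B = layer wt 1"
begin

lemma lie_derivative_L2:
  assumes "test_function \<phi>" shows "lie_derivative star v \<phi> \<in> L2 lborel"
proof (rule continuous_bounded_support_L2(1))
  show "continuous_on UNIV (lie_derivative star v \<phi>)"
    by (rule continuous_lie_derivative[OF test_function_Ck[OF assms]])
  show "bounded (closure {x. \<phi> x \<noteq> 0})"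
    using assms by (simp add: test_function_def compact_imp_bounded)
qed (rule lie_derivative_zero_outside)

lemma has_distr_derivative_inner:
  "has_distr_derivative star v f g \<longleftrightarrow>
    (\<forall>\<phi>. test_function \<phi> \<longrightarrow> L2_inner lborel f (lie_derivative star v \<phi>) = - L2_inner lborel g \<phi>)"
  by (simp add: has_distr_derivative_def L2_inner_def)

lemma has_distr_derivative_unique:
  assumes "has_distr_derivative star v f g" "has_distr_derivative star v f' g'"
    and "f \<in> L2 lborel" "f' \<in> L2 lborel" "AE x in lborel. f x = f' x" and g: "g \<in> L2 lborel" "g' \<in> L2 lborel"
  shows "AE x in lborel. g x = g' x"
proof -
  have "AE x in lborel. (g - g') x = 0"
  proof (rule AE_zero_of_test_functions)
    show "g - g' \<in> L2 lborel" using g by (rule L2.mem_diff)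
    show "(\<integral>x. (g - g') x * \<phi> x \<partial>lborel) = 0" if \<phi>: "test_function \<phi>" for \<phi>
      using assms(1,2) \<phi> L2.diff_left[OF g test_function_L2[OF \<phi>]]
        L2_inner_cong_left[OF assms(5,3,4) lie_derivative_L2[OF \<phi>, of v]]
      by (simp add: has_distr_derivative_inner L2_inner_def)
  qed
  then show ?thesis by simp
qed

lemma has_distr_derivative_add:
  assumes "has_distr_derivative star v f g" "has_distr_derivative star v f' g'"
    and "f \<in> L2 lborel" "f' \<in> L2 lborel" "g \<in> L2 lborel" "g' \<in> L2 lborel"
  shows "has_distr_derivative star v (f + f') (g + g')"
  using assms(1,2) L2.add_left[OF assms(3,4) lie_derivative_L2] L2.add_left[OF assms(5,6) test_function_L2]
  by (simp add: has_distr_derivative_inner)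

lemma has_distr_derivative_scale:
  assumes "has_distr_derivative star v f g" "f \<in> L2 lborel" "g \<in> L2 lborel"
  shows "has_distr_derivative star v (a *\<^sub>R f) (a *\<^sub>R g)"
  using assms(1) L2.scale_left[OF assms(2) lie_derivative_L2] L2.scale_left[OF assms(3) test_function_L2]
  by (simp add: has_distr_derivative_inner)

lemma W12_L2: "f \<in> W12 star B \<Longrightarrow> f \<in> L2 lborel"
  by (simp add: W12_def)

lemma distr_derivative:
  assumes "f \<in> W12 star B" "v \<in> B"
  shows "distr_derivative star v f \<in> L2 lborel" "has_distr_derivative star v f (distr_derivative star v f)"
proof -
  have "\<exists>g. g \<in> L2 lborel \<and> has_distr_derivative star v f g"
    using assms by (auto simp: W12_def)
  from someI_ex[OF this] show "distr_derivative star v f \<in> L2 lborel"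
    "has_distr_derivative star v f (distr_derivative star v f)"
    by (simp_all add: distr_derivative_def)
qed

lemma subspace_W12: "subspace (W12 star B)"
  unfolding subspace_def
proof (intro conjI ballI allI)
  have "has_distr_derivative star v 0 0" for v by (simp add: has_distr_derivative_def)
  then show "0 \<in> W12 star B" using L2.mem_zero by (auto simp: W12_def)
next
  fix f g assume f: "f \<in> W12 star B" and g: "g \<in> W12 star B"
  then show "f + g \<in> W12 star B"
    using has_distr_derivative_add[OF distr_derivative(2)[OF f] distr_derivative(2)[OF g]]
      distr_derivative(1)[OF f] distr_derivative(1)[OF g] L2.mem_add
    unfolding W12_def by blast
next
  fix a f assume f: "f \<in> W12 star B"
  then show "a *\<^sub>R f \<in> W12 star B"
    using has_distr_derivative_scale[OF distr_derivative(2)[OF f]] distr_derivative(1)[OF f] L2.mem_scale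
    unfolding W12_def by blast
qed

text \<open>\<open>SOME\<close> picks the derivatives of f, g and f + g independently of each other,
  so linearity holds only almost everywhere, through uniqueness of weak derivatives.\<close>

lemma distr_derivative_add:
  assumes f: "f \<in> W12 star B" and g: "g \<in> W12 star B" and v: "v \<in> B"
  shows "AE x in lborel. distr_derivative star v (f + g) x = (distr_derivative star v f + distr_derivative star v g) x"
proof (rule has_distr_derivative_unique)
  have fg: "f + g \<in> W12 star B" using subspace_W12 f g by (rule subspace_add)
  show "has_distr_derivative star v (f + g) (distr_derivative star v (f + g))" by (rule distr_derivative(2)[OF fg v])
  show "has_distr_derivative star v (f + g) (distr_derivative star v f + distr_derivative star v g)"
    by (intro has_distr_derivative_add distr_derivative f g v W12_L2)
qed (intro L2.mem_add W12_L2 f g v distr_derivative subspace_add[OF subspace_W12] AE_I2 refl)+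

lemma distr_derivative_scale:
  assumes f: "f \<in> W12 star B" and v: "v \<in> B"
  shows "AE x in lborel. distr_derivative star v (a *\<^sub>R f) x = (a *\<^sub>R distr_derivative star v f) x"
proof (rule has_distr_derivative_unique)
  have fg: "a *\<^sub>R f \<in> W12 star B" using subspace_W12 f by (rule subspace_scale)
  show "has_distr_derivative star v (a *\<^sub>R f) (distr_derivative star v (a *\<^sub>R f))" by (rule distr_derivative(2)[OF fg v])
  show "has_distr_derivative star v (a *\<^sub>R f) (a *\<^sub>R distr_derivative star v f)"
    by (intro has_distr_derivative_scale distr_derivative f v W12_L2)
qed (intro L2.mem_scale W12_L2 f v distr_derivative subspace_scale[OF subspace_W12] AE_I2 refl)+

lemma dirichlet_form_eq:
  assumes "f \<in> W12 star B" "g \<in> W12 star B"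
  shows "dirichlet_form star B f g = (\<Sum>v\<in>B. L2_inner lborel (distr_derivative star v f) (distr_derivative star v g))"
  unfolding dirichlet_form_def L2_inner_def
  by (intro Bochner_Integration.integral_sum L2_mult_integrable distr_derivative assms)

text \<open>The inner product of \<open>W12\<close>. The added \<open>L2\<close> product shifts the
  spectral parameter by 1, hence the later \<open>Re z - 1\<close>.\<close>

definition energy :: "(real^'n \<Rightarrow> real) \<Rightarrow> (real^'n \<Rightarrow> real) \<Rightarrow> real" where
  "energy f g = dirichlet_form star B f g + L2_inner lborel f g"

sublocale W: semi_inner_space "W12 star B" energy
proof
  show "subspace (W12 star B)" by (rule subspace_W12)
  fix f g assume f: "f \<in> W12 star B" and g: "g \<in> W12 star B"
  show "energy f g = energy g f"
    using f g by (simp add: energy_def dirichlet_form_eq L2_inner_commute)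
  fix a
  have af: "a *\<^sub>R f \<in> W12 star B" using subspace_W12 f by (rule subspace_scale)
  have "L2_inner lborel (distr_derivative star v (a *\<^sub>R f)) (distr_derivative star v g) =
      a * L2_inner lborel (distr_derivative star v f) (distr_derivative star v g)" if v: "v \<in> B" for v
    using L2_inner_cong_left[OF distr_derivative_scale[OF f v, of a] distr_derivative(1)[OF af v]
        L2.mem_scale[OF distr_derivative(1)[OF f v]] distr_derivative(1)[OF g v]]
      L2.scale_left[OF distr_derivative(1)[OF f v] distr_derivative(1)[OF g v], of a] by simp
  then show "energy (a *\<^sub>R f) g = a * energy f g"
    using f g af L2.scale_left[OF W12_L2[OF f] W12_L2[OF g], of a]
    by (simp add: energy_def dirichlet_form_eq sum_distrib_left distrib_left)
  fix h assume h: "h \<in> W12 star B"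
  have fg: "f + g \<in> W12 star B" using subspace_W12 f g by (rule subspace_add)
  have "L2_inner lborel (distr_derivative star v (f + g)) (distr_derivative star v h) =
      L2_inner lborel (distr_derivative star v f) (distr_derivative star v h) +
      L2_inner lborel (distr_derivative star v g) (distr_derivative star v h)" if v: "v \<in> B" for v
    using L2_inner_cong_left[OF distr_derivative_add[OF f g v] distr_derivative(1)[OF fg v]
        L2.mem_add[OF distr_derivative(1)[OF f v] distr_derivative(1)[OF g v]] distr_derivative(1)[OF h v]]
      L2.add_left[OF distr_derivative(1)[OF f v] distr_derivative(1)[OF g v] distr_derivative(1)[OF h v]] by simp
  then show "energy (f + g) h = energy f h + energy g h"
    using f g h fg L2.add_left[OF W12_L2[OF f] W12_L2[OF g] W12_L2[OF h]]
    by (simp add: energy_def dirichlet_form_eq sum.distrib)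
next
  fix f assume f: "f \<in> W12 star B"
  then show "0 \<le> energy f f"
    by (simp add: energy_def dirichlet_form_eq L2_inner_self distr_derivative W12_L2 sum_nonneg)
qed

lemma energy_self:
  "f \<in> W12 star B \<Longrightarrow> energy f f = (\<Sum>v\<in>B. (L2norm lborel (distr_derivative star v f))\<^sup>2) + (L2norm lborel f)\<^sup>2"
  by (simp add: energy_def dirichlet_form_eq L2_inner_self distr_derivative W12_L2)

lemma W12_norm_eq: "f \<in> W12 star B \<Longrightarrow> W12_norm star B f = W.nrm f"
  by (simp add: W12_norm_def W.nrm_def energy_def L2_inner_self W12_L2)

lemma L2norm_le_nrm:
  assumes "f \<in> W12 star B" shows "L2norm lborel f \<le> W.nrm f"
  unfolding W.nrm_def energy_self[OF assms] by (rule real_le_rsqrt) (simp add: sum_nonneg)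

lemma L2norm_derivative_le_nrm:
  assumes "f \<in> W12 star B" "v \<in> B" shows "L2norm lborel (distr_derivative star v f) \<le> W.nrm f"
proof -
  have "(L2norm lborel (distr_derivative star v f))\<^sup>2 \<le> (\<Sum>v\<in>B. (L2norm lborel (distr_derivative star v f))\<^sup>2)"
    using assms finite_B by (intro member_le_sum) auto
  then show ?thesis
    unfolding W.nrm_def energy_self[OF assms(1)] by (intro real_le_rsqrt) (simp add: add_increasing2)
qed

lemma distr_derivative_diff:
  assumes f: "f \<in> W12 star B" and g: "g \<in> W12 star B" and v: "v \<in> B"
  shows "AE x in lborel. distr_derivative star v (f - g) x = (distr_derivative star v f - distr_derivative star v g) x"
proof -
  have g': "(-1) *\<^sub>R g \<in> W12 star B" using subspace_W12 g by (rule subspace_scale)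
  have eq: "f + (-1) *\<^sub>R g = f - g" by (simp add: fun_eq_iff)
  show ?thesis
    using distr_derivative_add[OF f g' v] distr_derivative_scale[OF g v, of "-1"] unfolding eq
    by eventually_elim simp
qed

text \<open>The functions and each of their weak derivatives converge in \<open>L2\<close>. For a
  fixed test function both sides of the weak identity are continuous in \<open>L2\<close>, so the
  limits are related by it as well.\<close>

sublocale W: semi_hilbert_space "W12 star B" energy
proof
  fix s :: "nat \<Rightarrow> real^'n \<Rightarrow> real" assume s: "\<And>n. s n \<in> W12 star B"
    and cauchy: "\<And>\<epsilon>. \<epsilon> > 0 \<Longrightarrow> \<exists>N. \<forall>m\<ge>N. \<forall>n\<ge>N. W.nrm (s m - s n) < \<epsilon>"
  let ?d = "distr_derivative star"
  have diff: "s m - s n \<in> W12 star B" for m n by (intro W.mem_diff s)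
  have d_diff: "L2norm lborel (?d v (s m) - ?d v (s n)) = L2norm lborel (?d v (s m - s n))" if v: "v \<in> B" for m n v
    using distr_derivative_diff[OF s s v, of m n]
    by (intro L2_cong_AE(2)[OF distr_derivative(1)[OF diff v] L2_measurable[OF L2.mem_diff]] distr_derivative s v)
      (auto elim: eventually_mono)
  have "\<exists>f\<in>L2 lborel. (\<lambda>n. L2.nrm lborel (s n - f)) \<longlonglongrightarrow> 0"
  proof (rule L2.complete)
    fix \<epsilon> :: real assume "\<epsilon> > 0"
    from cauchy[OF this] obtain N where N: "\<forall>m\<ge>N. \<forall>n\<ge>N. W.nrm (s m - s n) < \<epsilon>" ..
    have "L2.nrm lborel (s m - s n) < \<epsilon>" if "m \<ge> N" "n \<ge> N" for m n
      using L2norm_le_nrm[OF diff, of m n] N[rule_format, OF that] by (simp add: L2_nrm)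
    then show "\<exists>N. \<forall>m\<ge>N. \<forall>n\<ge>N. L2.nrm lborel (s m - s n) < \<epsilon>" by blast
  qed (rule W12_L2[OF s])
  then obtain f where f: "f \<in> L2 lborel" "(\<lambda>n. L2.nrm lborel (s n - f)) \<longlonglongrightarrow> 0" by blast
  have "\<exists>g\<in>L2 lborel. (\<lambda>n. L2.nrm lborel (?d v (s n) - g)) \<longlonglongrightarrow> 0" if v: "v \<in> B" for v
  proof (rule L2.complete)
    fix \<epsilon> :: real assume "\<epsilon> > 0"
    from cauchy[OF this] obtain N where N: "\<forall>m\<ge>N. \<forall>n\<ge>N. W.nrm (s m - s n) < \<epsilon>" ..
    have "L2.nrm lborel (?d v (s m) - ?d v (s n)) < \<epsilon>" if "m \<ge> N" "n \<ge> N" for m n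
      using L2norm_derivative_le_nrm[OF diff v, of m n] N[rule_format, OF that] d_diff[OF v] by (simp add: L2_nrm)
    then show "\<exists>N. \<forall>m\<ge>N. \<forall>n\<ge>N. L2.nrm lborel (?d v (s m) - ?d v (s n)) < \<epsilon>" by blast
  qed (rule distr_derivative(1)[OF s v])
  then obtain g where g: "\<And>v. v \<in> B \<Longrightarrow> g v \<in> L2 lborel"
    "\<And>v. v \<in> B \<Longrightarrow> (\<lambda>n. L2.nrm lborel (?d v (s n) - g v)) \<longlonglongrightarrow> 0" by metis
  have fg: "has_distr_derivative star v f (g v)" if v: "v \<in> B" for v
    unfolding has_distr_derivative_inner
  proof (intro allI impI)
    fix \<phi> :: "real^'n \<Rightarrow> real" assume \<phi>: "test_function \<phi>"
    have "(\<lambda>n. L2_inner lborel (s n) (lie_derivative star v \<phi>)) \<longlonglongrightarrow> L2_inner lborel f (lie_derivative star v \<phi>)"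
      by (rule L2.tendsto_left[OF W12_L2[OF s] f(1) lie_derivative_L2[OF \<phi>] f(2)])
    moreover have "(\<lambda>n. - L2_inner lborel (?d v (s n)) \<phi>) \<longlonglongrightarrow> - L2_inner lborel (g v) \<phi>"
      by (intro tendsto_minus L2.tendsto_left[OF distr_derivative(1)[OF s v] g(1)[OF v] test_function_L2[OF \<phi>] g(2)[OF v]])
    moreover have "L2_inner lborel (s n) (lie_derivative star v \<phi>) = - L2_inner lborel (?d v (s n)) \<phi>" for n
      using distr_derivative(2)[OF s v, of n] \<phi> by (simp add: has_distr_derivative_inner)
    ultimately show "L2_inner lborel f (lie_derivative star v \<phi>) = - L2_inner lborel (g v) \<phi>"
      using LIMSEQ_unique by simp
  qed
  have fW: "f \<in> W12 star B" using f(1) g(1) fg by (auto simp: W12_def)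
  have d_eq: "L2norm lborel (?d v (s n - f)) = L2norm lborel (?d v (s n) - g v)" if v: "v \<in> B" for n v
  proof (rule L2_cong_AE(2))
    show "?d v (s n) - g v \<in> L2 lborel" by (intro L2.mem_diff distr_derivative s v g)
    show "?d v (s n - f) \<in> borel_measurable lborel"
      by (intro L2_measurable distr_derivative W.mem_diff s fW v)
    have "AE x in lborel. ?d v f x = g v x"
      by (rule has_distr_derivative_unique[OF distr_derivative(2)[OF fW v] fg[OF v] f(1) f(1) _ distr_derivative(1)[OF fW v] g(1)[OF v]]) simp
    then show "AE x in lborel. ?d v (s n - f) x = (?d v (s n) - g v) x"
      using distr_derivative_diff[OF s fW v, of n] by eventually_elim simp
  qed
  have "(\<lambda>n. (\<Sum>v\<in>B. (L2norm lborel (?d v (s n) - g v))\<^sup>2) + (L2norm lborel (s n - f))\<^sup>2) \<longlonglongrightarrow> (\<Sum>v\<in>B. 0\<^sup>2) + 0\<^sup>2"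
    using f(2) g(2) by (intro tendsto_add tendsto_sum tendsto_power) (simp_all add: L2_nrm)
  then have "(\<lambda>n. sqrt (energy (s n - f) (s n - f))) \<longlonglongrightarrow> sqrt 0"
    by (intro tendsto_real_sqrt) (simp add: energy_self[OF W.mem_diff[OF s fW]] d_eq)
  then show "\<exists>f\<in>W12 star B. (\<lambda>n. W.nrm (s n - f)) \<longlonglongrightarrow> 0"
    using fW by (auto simp: W.nrm_def)
qed

end

section \<open>The Dirichlet problem\<close>

text \<open>Bridges functions on \<Omega>, whose values elsewhere are disregarded, and functions on
  the whole space.\<close>

definition extend_zero :: "'a set \<Rightarrow> ('a \<Rightarrow> real) \<Rightarrow> 'a \<Rightarrow> real" where
  "extend_zero A u x = indicator A x * u x"

lemma L2_restrict_space:
  fixes u :: "'a \<Rightarrow> real"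
  assumes A: "A \<in> sets M"
  shows "u \<in> L2 (restrict_space M A) \<longleftrightarrow> extend_zero A u \<in> L2 M" (is ?iff)
    and "L2norm (restrict_space M A) u = L2norm M (extend_zero A u)"
    and "(\<integral>x. u x * h x \<partial>restrict_space M A) = L2_inner M (extend_zero A u) h"
proof -
  have A': "A \<inter> space M \<in> sets M" using A by simp
  have sq: "indicator A x * (u x)\<^sup>2 = (extend_zero A u x)\<^sup>2" for x
    by (simp add: extend_zero_def indicator_def)
  have meas: "u \<in> borel_measurable (restrict_space M A) \<longleftrightarrow> extend_zero A u \<in> borel_measurable M"
    using borel_measurable_restrict_space_iff[OF A', of u] by (simp add: extend_zero_def[abs_def])
  have int: "integrable (restrict_space M A) (\<lambda>x. (u x)\<^sup>2) \<longleftrightarrow> integrable M (\<lambda>x. (extend_zero A u x)\<^sup>2)"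
    using integrable_restrict_space[OF A', of "\<lambda>x. (u x)\<^sup>2"] by (simp add: sq)
  show ?iff using meas int by (simp add: L2_real_iff)
  show "L2norm (restrict_space M A) u = L2norm M (extend_zero A u)"
    using integral_restrict_space[OF A', of "\<lambda>x. (u x)\<^sup>2"] by (simp add: sq L2norm_def)
  show "(\<integral>x. u x * h x \<partial>restrict_space M A) = L2_inner M (extend_zero A u) h"
    using integral_restrict_space[OF A', of "\<lambda>x. u x * h x"]
    by (simp add: L2_inner_def extend_zero_def mult.assoc)
qed

lemma L2_complex:
  fixes f :: "'a \<Rightarrow> complex"
  shows "f \<in> L2 M \<longleftrightarrow> (Re \<circ> f) \<in> L2 M \<and> (Im \<circ> f) \<in> L2 M" (is ?iff)
    and "f \<in> L2 M \<Longrightarrow> (L2norm M f)\<^sup>2 = (L2norm M (Re \<circ> f))\<^sup>2 + (L2norm M (Im \<circ> f))\<^sup>2"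
proof -
  show iff: ?iff
  proof
    assume f: "f \<in> L2 M"
    then have meas: "f \<in> borel_measurable M" and int: "integrable M (\<lambda>x. (norm (f x))\<^sup>2)" by (auto simp: L2_def)
    then have m: "(\<lambda>x. Re (f x)) \<in> borel_measurable M" "(\<lambda>x. Im (f x)) \<in> borel_measurable M" by simp_all
    have "integrable M (\<lambda>x. (Re (f x))\<^sup>2)" "integrable M (\<lambda>x. (Im (f x))\<^sup>2)"
      by (rule Bochner_Integration.integrable_bound[OF int]; use m in \<open>auto simp: cmod_power2\<close>)+
    then show "(Re \<circ> f) \<in> L2 M \<and> (Im \<circ> f) \<in> L2 M" using m by (simp add: L2_real_iff o_def)
  next
    assume *: "(Re \<circ> f) \<in> L2 M \<and> (Im \<circ> f) \<in> L2 M"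
    then show "f \<in> L2 M"
      by (auto simp: L2_def o_def borel_measurable_complex_iff cmod_power2)
  qed
  show "(L2norm M f)\<^sup>2 = (L2norm M (Re \<circ> f))\<^sup>2 + (L2norm M (Im \<circ> f))\<^sup>2" if "f \<in> L2 M"
    using that L2_square_integrable[of "Re \<circ> f" M] L2_square_integrable[of "Im \<circ> f" M] unfolding iff
    by (simp add: L2norm_def cmod_power2 integral_nonneg_AE)
qed

locale dirichlet_problem = sobolev star ginv wt r B
  for star :: "real^'n \<Rightarrow> real^'n \<Rightarrow> real^'n" and ginv wt r B +
  fixes \<Omega> :: "(real^'n) set"
  assumes bounded_\<Omega>: "bounded \<Omega>" and open_\<Omega>: "open \<Omega>"
begin

abbreviation D where "D \<equiv> dirichlet_domain star B \<Omega>"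

lemma subspace_supported: "subspace {g \<in> W12 star B. ess_support g \<subseteq> \<Omega>}"
  unfolding subspace_def
proof (intro conjI ballI allI)
  have "ess_support (0 :: real^'n \<Rightarrow> real) \<subseteq> \<Omega>" by (rule ess_support_subsetI) (auto intro!: exI[of _ UNIV])
  then show "0 \<in> {g \<in> W12 star B. ess_support g \<subseteq> \<Omega>}" using W.mem_zero by simp
next
  fix f g assume f: "f \<in> {g \<in> W12 star B. ess_support g \<subseteq> \<Omega>}" and g: "g \<in> {g \<in> W12 star B. ess_support g \<subseteq> \<Omega>}"
  have "ess_support (f + g) \<subseteq> \<Omega>"
  proof (rule ess_support_subsetI)
    fix x assume "x \<notin> \<Omega>"
    then have x: "x \<notin> ess_support f" "x \<notin> ess_support g" using f g by auto
    obtain U where U: "open U" "x \<in> U" "AE y in lborel. y \<in> U \<longrightarrow> f y = 0" by (rule ess_supportE[OF x(1)])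
    obtain V where V: "open V" "x \<in> V" "AE y in lborel. y \<in> V \<longrightarrow> g y = 0" by (rule ess_supportE[OF x(2)])
    have "AE y in lborel. y \<in> U \<inter> V \<longrightarrow> (f + g) y = 0" using U(3) V(3) by eventually_elim auto
    then show "\<exists>U. open U \<and> x \<in> U \<and> (AE y in lborel. y \<in> U \<longrightarrow> (f + g) y = 0)"
      using U V by (intro exI[of _ "U \<inter> V"]) auto
  qed
  then show "f + g \<in> {g \<in> W12 star B. ess_support g \<subseteq> \<Omega>}" using f g W.mem_add by simp
next
  fix a f assume f: "f \<in> {g \<in> W12 star B. ess_support g \<subseteq> \<Omega>}"
  have "ess_support (a *\<^sub>R f) \<subseteq> \<Omega>"
  proof (rule ess_support_subsetI)
    fix x assume "x \<notin> \<Omega>"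
    then have x: "x \<notin> ess_support f" using f by auto
    obtain U where U: "open U" "x \<in> U" "AE y in lborel. y \<in> U \<longrightarrow> f y = 0" by (rule ess_supportE[OF x])
    then show "\<exists>U. open U \<and> x \<in> U \<and> (AE y in lborel. y \<in> U \<longrightarrow> (a *\<^sub>R f) y = 0)"
      by (intro exI[of _ U]) (auto elim: eventually_mono)
  qed
  then show "a *\<^sub>R f \<in> {g \<in> W12 star B. ess_support g \<subseteq> \<Omega>}" using f W.mem_scale by simp
qed

lemma dirichlet_domain_eq:
  "D = {f \<in> W12 star B. \<forall>\<epsilon>>0. \<exists>g\<in>{g \<in> W12 star B. ess_support g \<subseteq> \<Omega>}. W.nrm (f - g) < \<epsilon>}"
proof -
  have eq: "W12_norm star B (\<lambda>x. f x - g x) = W.nrm (f - g)" if "f \<in> W12 star B" "g \<in> W12 star B" for f g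
    using W12_norm_eq[OF W.mem_diff[OF that]] by (simp add: fun_diff_def)
  have "(\<exists>g\<in>W12 star B. ess_support g \<subseteq> \<Omega> \<and> W12_norm star B (\<lambda>x. f x - g x) < \<epsilon>) \<longleftrightarrow>
      (\<exists>g\<in>{g \<in> W12 star B. ess_support g \<subseteq> \<Omega>}. W.nrm (f - g) < \<epsilon>)" if "f \<in> W12 star B" for f \<epsilon>
    using eq[OF that] by auto
  then show ?thesis
    unfolding dirichlet_domain_def by (intro Collect_cong conj_cong refl) simp
qed

lemma D_W12: "f \<in> D \<Longrightarrow> f \<in> W12 star B"
  by (simp add: dirichlet_domain_def)

lemma D_L2: "f \<in> D \<Longrightarrow> f \<in> L2 lborel"
  by (intro W12_L2 D_W12)

sublocale D: semi_hilbert_space D energy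
  unfolding dirichlet_domain_eq by (rule W.semi_hilbert_closure[OF subspace_supported]) auto

text \<open>Off \<Omega> an approximant g with essential support inside \<Omega> vanishes, so |f| is
  bounded there by |f - g|, whose norm is arbitrarily small.\<close>

lemma D_vanish:
  assumes f: "f \<in> D" shows "AE x in lborel. x \<notin> \<Omega> \<longrightarrow> f x = 0"
proof -
  have fW: "f \<in> W12 star B" by (rule D_W12[OF f])
  define h where "h = extend_zero (- \<Omega>) f"
  have meas: "h \<in> borel_measurable lborel"
    unfolding h_def extend_zero_def[abs_def]
    using open_\<Omega> by (intro borel_measurable_times borel_measurable_indicator L2_measurable[OF W12_L2[OF fW]]) auto
  have hL2: "h \<in> L2 lborel"
    by (rule L2_bound(1)[OF W12_L2[OF fW] meas]) (auto simp: h_def extend_zero_def indicator_def)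
  have small: "L2norm lborel h \<le> \<epsilon>" if "\<epsilon> > 0" for \<epsilon>
  proof -
    obtain g where g: "g \<in> W12 star B" "ess_support g \<subseteq> \<Omega>" "W.nrm (f - g) < \<epsilon>"
      using f \<open>\<epsilon> > 0\<close> unfolding dirichlet_domain_eq by blast
    have fg: "f - g \<in> W12 star B" using fW g(1) by (rule W.mem_diff)
    have "AE x in lborel. \<bar>h x\<bar> \<le> \<bar>(f - g) x\<bar>"
      using AE_zero_outside_ess_support[of g] g(2)
      by (auto elim!: eventually_mono simp: h_def extend_zero_def indicator_def)
    then have "L2norm lborel h \<le> L2norm lborel (f - g)" by (rule L2_bound(2)[OF W12_L2[OF fg] meas])
    also have "\<dots> \<le> W.nrm (f - g)" by (rule L2norm_le_nrm[OF fg])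
    finally show ?thesis using g(3) by simp
  qed
  have "L2norm lborel h \<le> 0" by (rule field_le_epsilon) (use small in simp)
  then have "L2norm lborel h = 0" using L2norm_nonneg[of lborel h] by simp
  from L2norm_eq_0[OF hL2 this] show ?thesis
    by eventually_elim (auto simp: h_def extend_zero_def)
qed

text \<open>\<open>ehrling\<close> on the unit ball, applied to f divided by its norm and multiplied
  back by the squared norm; hence the factor \<open>W.nrm f\<close> at the functionals. Null vectors
  of the energy are treated apart.\<close>

lemma compact_embedding:
  assumes "\<epsilon> > 0"
  obtains K :: "((real^'n \<Rightarrow> real)) set" and C where "finite K" "K \<subseteq> L2 lborel" "0 \<le> C"
    "\<And>f. f \<in> D \<Longrightarrow> (L2norm lborel f)\<^sup>2 \<le> \<epsilon> * energy f f + C * W.nrm f * (\<Sum>k\<in>K. \<bar>L2_inner lborel k f\<bar>)"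
proof -
  obtain M where M: "0 \<le> M" "\<Omega> \<subseteq> cball 0 M"
    using bounded_subset_ballD[OF bounded_\<Omega>, of 0] ball_subset_cball by (meson less_imp_le order_trans)
  define U where "U = {f \<in> D. W.nrm f \<le> 1}"
  interpret horizontal_family star ginv wt r B M U
  proof
    fix f assume f: "f \<in> U"
    then have fW: "f \<in> W12 star B" using D_W12 by (simp add: U_def)
    show "f \<in> L2 lborel" by (rule W12_L2[OF fW])
    show "L2norm lborel f \<le> 1" using L2norm_le_nrm[OF fW] f by (simp add: U_def)
    show "AE x in lborel. x \<notin> cball 0 M \<longrightarrow> f x = 0"
      using D_vanish[of f] f M(2) by (auto simp: U_def elim!: eventually_mono)
    fix v assume v: "v \<in> B"
    show "\<exists>g\<in>L2 lborel. L2norm lborel g \<le> 1 \<and> has_distr_derivative star v f g"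
      using distr_derivative[OF fW v] L2norm_derivative_le_nrm[OF fW v] f
      by (intro bexI[of _ "distr_derivative star v f"]) (auto simp: U_def)
  qed (use M span_B in auto)
  obtain K :: "(real^'n \<Rightarrow> real) set" and C where K: "finite K" "K \<subseteq> L2 lborel" "0 \<le> C"
    "\<And>f. f \<in> U \<Longrightarrow> (L2norm lborel f)\<^sup>2 \<le> \<epsilon> + C * (\<Sum>k\<in>K. \<bar>L2_inner lborel k f\<bar>)"
    by (rule ehrling[OF assms]) (rule that)
  have "(L2norm lborel f)\<^sup>2 \<le> \<epsilon> * energy f f + C * W.nrm f * (\<Sum>k\<in>K. \<bar>L2_inner lborel k f\<bar>)" if f: "f \<in> D" for f
  proof (cases "W.nrm f = 0")
    case True
    have "L2norm lborel f \<le> 0" using L2norm_le_nrm[OF D_W12[OF f]] True by simp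
    then have "L2norm lborel f = 0" using L2norm_nonneg[of lborel f] by simp
    then show ?thesis using True assms D.nonneg[OF f] by simp
  next
    case False
    let ?n = "W.nrm f"
    have n: "?n > 0" using False W.nrm_nonneg[OF D_W12[OF f]] by simp
    define g where "g = (1 / ?n) *\<^sub>R f"
    have g: "g \<in> U"
      using D.mem_scale[OF f, of "1 / ?n"] D.nrm_scale[OF f, of "1 / ?n"] n by (simp add: U_def g_def)
    have L: "L2norm lborel g = L2norm lborel f / ?n"
      using L2.nrm_scale[OF D_L2[OF f], of "1 / ?n"] n by (simp add: g_def L2_nrm)
    have k: "\<bar>L2_inner lborel k g\<bar> = \<bar>L2_inner lborel k f\<bar> / ?n" if "k \<in> K" for k
      using L2.scale_right[of k lborel f "1 / ?n"] that K(2) D_L2[OF f] n by (auto simp: g_def abs_mult)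
    have "(L2norm lborel g)\<^sup>2 \<le> \<epsilon> + C * ((\<Sum>k\<in>K. \<bar>L2_inner lborel k f\<bar>) / ?n)"
      using K(4)[OF g] k by (simp add: sum_divide_distrib)
    then have "(L2norm lborel g)\<^sup>2 * ?n\<^sup>2 \<le> (\<epsilon> + C * ((\<Sum>k\<in>K. \<bar>L2_inner lborel k f\<bar>) / ?n)) * ?n\<^sup>2"
      by (rule mult_right_mono) simp
    also have "\<dots> = \<epsilon> * ?n\<^sup>2 + C * ?n * (\<Sum>k\<in>K. \<bar>L2_inner lborel k f\<bar>)"
      using n by (simp add: field_simps power2_eq_square)
    also have "(L2norm lborel g)\<^sup>2 * ?n\<^sup>2 = (L2norm lborel f)\<^sup>2" using n L by (simp add: power_divide)
    finally show ?thesis by (simp only: D.nrm_sq[OF f])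
  qed
  then show ?thesis using that K(1-3) by blast
qed

sublocale D: compact_form D energy "L2_inner lborel"
proof
  show "L2_inner lborel x y = L2_inner lborel y x" if "x \<in> D" "y \<in> D" for x y
    by (rule L2_inner_commute)
  show "L2_inner lborel (x + y) z = L2_inner lborel x z + L2_inner lborel y z" if "x \<in> D" "y \<in> D" "z \<in> D" for x y z
    using that by (intro L2.add_left D_L2)
  show "L2_inner lborel (a *\<^sub>R x) y = a * L2_inner lborel x y" if "x \<in> D" "y \<in> D" for a x y
    using that by (intro L2.scale_left D_L2)
  show "0 \<le> L2_inner lborel x x" if "x \<in> D" for x using that by (intro L2.nonneg D_L2)
  show "\<bar>L2_inner lborel x y\<bar> \<le> W.nrm x * W.nrm y" if "x \<in> D" "y \<in> D" for x y
  proof -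
    have "\<bar>L2_inner lborel x y\<bar> \<le> L2norm lborel x * L2norm lborel y"
      using that by (intro L2_inner_Cauchy_Schwarz D_L2)
    also have "\<dots> \<le> W.nrm x * W.nrm y"
      using that by (intro mult_mono L2norm_le_nrm D_W12 L2norm_nonneg W.nrm_nonneg)
    finally show ?thesis .
  qed
  fix \<epsilon> :: real assume "\<epsilon> > 0"
  then obtain K :: "((real^'n \<Rightarrow> real)) set" and C where K: "finite K" "K \<subseteq> L2 lborel" "0 \<le> C"
    "\<And>f. f \<in> D \<Longrightarrow> (L2norm lborel f)\<^sup>2 \<le> \<epsilon> * energy f f + C * W.nrm f * (\<Sum>k\<in>K. \<bar>L2_inner lborel k f\<bar>)"
    by (rule compact_embedding) (rule that)
  let ?K = "L2_inner lborel ` K"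
  \<comment> \<open>Different elements of \<open>K\<close> may induce the same functional and merge
    in the image; the factor \<open>card K\<close> makes up for this.\<close>
  have sum_le: "(\<Sum>k\<in>K. \<bar>L2_inner lborel k f\<bar>) \<le> card K * (\<Sum>k\<in>?K. \<bar>k f\<bar>)" for f
    using K(1) by (intro sum_bounded_above member_le_sum[of _ ?K "\<lambda>k. \<bar>k f\<bar>"]) auto
  define A where "A = (\<Sum>k\<in>K. L2norm lborel k)"
  have bound: "\<bar>L2_inner lborel k x\<bar> \<le> A * W.nrm x" if "k \<in> K" "x \<in> D" for k x
  proof -
    have "\<bar>L2_inner lborel k x\<bar> \<le> L2norm lborel k * L2norm lborel x"
      using that K(2) D_L2 by (intro L2_inner_Cauchy_Schwarz) auto
    also have "\<dots> \<le> A * W.nrm x"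
      unfolding A_def using that K(1)
      by (intro mult_mono L2norm_le_nrm D_W12 member_le_sum) (auto simp: L2norm_nonneg sum_nonneg)
    finally show ?thesis .
  qed
  have est: "L2_inner lborel x x \<le> \<epsilon> * energy x x + (C * card K) * W.nrm x * (\<Sum>k\<in>?K. \<bar>k x\<bar>)" if x: "x \<in> D" for x
  proof -
    have "C * W.nrm x * (\<Sum>k\<in>K. \<bar>L2_inner lborel k x\<bar>) \<le> C * W.nrm x * (card K * (\<Sum>k\<in>?K. \<bar>k x\<bar>))"
      using K(3) W.nrm_nonneg[OF D_W12[OF x]] by (intro mult_left_mono sum_le) auto
    then show ?thesis using K(4)[OF x] L2_inner_self[OF D_L2[OF x]] by (simp add: ac_simps)
  qed
  show "\<exists>(K :: ((real^'n \<Rightarrow> real) \<Rightarrow> real) set) C. finite K \<and> 0 \<le> C \<and>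
      (\<forall>k\<in>K. \<forall>x\<in>D. \<forall>y\<in>D. k (x - y) = k x - k y) \<and> (\<forall>k\<in>K. \<forall>x\<in>D. \<forall>a. k (a *\<^sub>R x) = a * k x) \<and>
      (\<exists>A. \<forall>k\<in>K. \<forall>x\<in>D. \<bar>k x\<bar> \<le> A * W.nrm x) \<and>
      (\<forall>x\<in>D. L2_inner lborel x x \<le> \<epsilon> * energy x x + C * W.nrm x * (\<Sum>k\<in>K. \<bar>k x\<bar>))"
  proof (rule exI[of _ ?K], rule exI[of _ "C * card K"], intro conjI)
    show "finite ?K" "0 \<le> C * card K" using K by auto
    show "\<forall>k\<in>?K. \<forall>x\<in>D. \<forall>y\<in>D. k (x - y) = k x - k y" using K(2) D_L2 by (auto intro!: L2.diff_right)
    show "\<forall>k\<in>?K. \<forall>x\<in>D. \<forall>a. k (a *\<^sub>R x) = a * k x" using K(2) D_L2 by (auto intro!: L2.scale_right)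
    show "\<exists>A. \<forall>k\<in>?K. \<forall>x\<in>D. \<bar>k x\<bar> \<le> A * W.nrm x" using bound by (intro exI[of _ A]) auto
    show "\<forall>x\<in>D. L2_inner lborel x x \<le> \<epsilon> * energy x x + (C * card K) * W.nrm x * (\<Sum>k\<in>?K. \<bar>k x\<bar>)"
      using est by blast
  qed
qed

section \<open>The resolvent equation in weak form, and the spectrum\<close>

abbreviation M\<Omega> where "M\<Omega> \<equiv> restrict_space lborel \<Omega>"
abbreviation \<L> where "\<L> \<equiv> complexification (dirichlet_sub_laplacian star B \<Omega>)"

lemma \<Omega>_sets: "\<Omega> \<in> sets lborel"
  using open_\<Omega> by simp

lemma extend_zero_D: "f \<in> D \<Longrightarrow> AE x in lborel. extend_zero \<Omega> f x = f x"
  using D_vanish[of f] by (auto elim!: eventually_mono simp: extend_zero_def indicator_def)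

lemma D_L2_\<Omega>: assumes "f \<in> D" shows "f \<in> L2 M\<Omega>" "L2norm M\<Omega> f = L2norm lborel f"
proof -
  have "extend_zero \<Omega> f \<in> borel_measurable lborel"
    unfolding extend_zero_def[abs_def]
    by (intro borel_measurable_times borel_measurable_indicator \<Omega>_sets L2_measurable[OF D_L2[OF assms]])
  from L2_cong_AE[OF D_L2[OF assms] this extend_zero_D[OF assms]]
  show "f \<in> L2 M\<Omega>" "L2norm M\<Omega> f = L2norm lborel f" by (simp_all add: L2_restrict_space[OF \<Omega>_sets])
qed

lemma integral_\<Omega>_D:
  assumes "f \<in> D" "h \<in> D" shows "(\<integral>x. f x * h x \<partial>M\<Omega>) = L2_inner lborel f h"
  unfolding L2_restrict_space(3)[OF \<Omega>_sets]
  using D_L2_\<Omega>(1)[OF assms(1)] L2_restrict_space(1)[OF \<Omega>_sets, of f]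
  by (intro L2_inner_cong_left[OF extend_zero_D[OF assms(1)] _ D_L2[OF assms(1)] D_L2[OF assms(2)]]) simp

lemma dirichlet_sub_laplacian_iff:
  "(f, g) \<in> dirichlet_sub_laplacian star B \<Omega> \<longleftrightarrow>
    f \<in> D \<and> g \<in> L2 M\<Omega> \<and> (\<forall>h\<in>D. dirichlet_form star B f h = - (\<integral>x. g x * h x \<partial>M\<Omega>))"
proof -
  have minus: "(\<lambda>x. - u x) \<in> L2 M\<Omega> \<longleftrightarrow> u \<in> L2 M\<Omega>" for u :: "real^'n \<Rightarrow> real"
    by (simp add: L2_real_iff)
  show ?thesis
  proof
    assume "(f, g) \<in> dirichlet_sub_laplacian star B \<Omega>"
    then show "f \<in> D \<and> g \<in> L2 M\<Omega> \<and> (\<forall>h\<in>D. dirichlet_form star B f h = - (\<integral>x. g x * h x \<partial>M\<Omega>))"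
      by (auto simp: dirichlet_sub_laplacian_def neg_dirichlet_sub_laplacian_def minus)
  next
    assume *: "f \<in> D \<and> g \<in> L2 M\<Omega> \<and> (\<forall>h\<in>D. dirichlet_form star B f h = - (\<integral>x. g x * h x \<partial>M\<Omega>))"
    then have "(f, \<lambda>x. - g x) \<in> neg_dirichlet_sub_laplacian star B \<Omega>"
      by (auto simp: neg_dirichlet_sub_laplacian_def minus)
    then show "(f, g) \<in> dirichlet_sub_laplacian star B \<Omega>"
      unfolding dirichlet_sub_laplacian_def by force
  qed
qed

lemma dirichlet_form_energy: "dirichlet_form star B f h = energy f h - L2_inner lborel f h"
  by (simp add: energy_def)

lemma complex_laplacian_iff:
  "(F, G) \<in> \<L> \<longleftrightarrow> (Re \<circ> F) \<in> D \<and> (Im \<circ> F) \<in> D \<and> G \<in> L2 M\<Omega> \<and>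
    (\<forall>h\<in>D. dirichlet_form star B (Re \<circ> F) h = - (\<integral>x. (Re \<circ> G) x * h x \<partial>M\<Omega>) \<and>
      dirichlet_form star B (Im \<circ> F) h = - (\<integral>x. (Im \<circ> G) x * h x \<partial>M\<Omega>))"
  unfolding complexification_def dirichlet_sub_laplacian_iff L2_complex(1)[of G] by auto

text \<open>Writing G = z F + w, the defining relation form(F, h) = -(G, h) becomes energy(F, h) +
  (z - 1) (F, h) = -(w, h). The parameters of \<open>re_part\<close> and \<open>im_part\<close> are
  thus the real and imaginary part of z - 1.\<close>

lemma weak_equation:
  assumes F: "(Re \<circ> F) \<in> D" "(Im \<circ> F) \<in> D" and w: "w \<in> L2 M\<Omega>"
  shows "(F, \<lambda>x. z * F x + w x) \<in> \<L> \<longleftrightarrow>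
    (\<forall>h\<in>D. D.re_part (Re z - 1) (Im z) (Re \<circ> F) (Im \<circ> F) h = - (\<integral>x. (Re \<circ> w) x * h x \<partial>M\<Omega>) \<and>
      D.im_part (Re z - 1) (Im z) (Re \<circ> F) (Im \<circ> F) h = - (\<integral>x. (Im \<circ> w) x * h x \<partial>M\<Omega>))"
proof -
  define G where "G = (\<lambda>x. z * F x + w x)"
  have w': "(Re \<circ> w) \<in> L2 M\<Omega>" "(Im \<circ> w) \<in> L2 M\<Omega>" using w L2_complex(1)[of w] by auto
  have F': "(Re \<circ> F) \<in> L2 M\<Omega>" "(Im \<circ> F) \<in> L2 M\<Omega>" using D_L2_\<Omega>(1) F by auto
  have ReG: "Re \<circ> G = (Re z *\<^sub>R (Re \<circ> F) - Im z *\<^sub>R (Im \<circ> F)) + (Re \<circ> w)"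
    and ImG: "Im \<circ> G = (Re z *\<^sub>R (Im \<circ> F) + Im z *\<^sub>R (Re \<circ> F)) + (Im \<circ> w)"
    by (auto simp: G_def fun_eq_iff)
  have G: "G \<in> L2 M\<Omega>"
    unfolding L2_complex(1)[of G] ReG ImG by (intro conjI L2.mem F' w')
  have int_G: "(\<integral>x. (Re \<circ> G) x * h x \<partial>M\<Omega>) = Re z * L2_inner lborel (Re \<circ> F) h - Im z * L2_inner lborel (Im \<circ> F) h + (\<integral>x. (Re \<circ> w) x * h x \<partial>M\<Omega>)"
    "(\<integral>x. (Im \<circ> G) x * h x \<partial>M\<Omega>) = Re z * L2_inner lborel (Im \<circ> F) h + Im z * L2_inner lborel (Re \<circ> F) h + (\<integral>x. (Im \<circ> w) x * h x \<partial>M\<Omega>)"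
    if h: "h \<in> D" for h
  proof -
    have h': "h \<in> L2 M\<Omega>" by (rule D_L2_\<Omega>(1)[OF h])
    have "L2_inner M\<Omega> (Re \<circ> G) h = Re z * L2_inner M\<Omega> (Re \<circ> F) h - Im z * L2_inner M\<Omega> (Im \<circ> F) h + L2_inner M\<Omega> (Re \<circ> w) h"
      "L2_inner M\<Omega> (Im \<circ> G) h = Re z * L2_inner M\<Omega> (Im \<circ> F) h + Im z * L2_inner M\<Omega> (Re \<circ> F) h + L2_inner M\<Omega> (Im \<circ> w) h"
      unfolding ReG ImG using F' w' h' by (simp_all add: L2.bilinear L2.mem)
    then show "(\<integral>x. (Re \<circ> G) x * h x \<partial>M\<Omega>) = Re z * L2_inner lborel (Re \<circ> F) h - Im z * L2_inner lborel (Im \<circ> F) h + (\<integral>x. (Re \<circ> w) x * h x \<partial>M\<Omega>)"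
      "(\<integral>x. (Im \<circ> G) x * h x \<partial>M\<Omega>) = Re z * L2_inner lborel (Im \<circ> F) h + Im z * L2_inner lborel (Re \<circ> F) h + (\<integral>x. (Im \<circ> w) x * h x \<partial>M\<Omega>)"
      using integral_\<Omega>_D[OF F(1) h] integral_\<Omega>_D[OF F(2) h] unfolding L2_inner_def[of M\<Omega>] by simp_all
  qed
  have "(F, G) \<in> \<L> \<longleftrightarrow> (\<forall>h\<in>D. dirichlet_form star B (Re \<circ> F) h = - (\<integral>x. (Re \<circ> G) x * h x \<partial>M\<Omega>) \<and>
      dirichlet_form star B (Im \<circ> F) h = - (\<integral>x. (Im \<circ> G) x * h x \<partial>M\<Omega>))"
    unfolding complex_laplacian_iff using F G by simp
  also have "\<dots> \<longleftrightarrow> (\<forall>h\<in>D. D.re_part (Re z - 1) (Im z) (Re \<circ> F) (Im \<circ> F) h = - (\<integral>x. (Re \<circ> w) x * h x \<partial>M\<Omega>) \<and>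
      D.im_part (Re z - 1) (Im z) (Re \<circ> F) (Im \<circ> F) h = - (\<integral>x. (Im \<circ> w) x * h x \<partial>M\<Omega>))"
  proof (rule ball_cong[OF refl])
    fix h assume h: "h \<in> D"
    show "(dirichlet_form star B (Re \<circ> F) h = - (\<integral>x. (Re \<circ> G) x * h x \<partial>M\<Omega>) \<and>
        dirichlet_form star B (Im \<circ> F) h = - (\<integral>x. (Im \<circ> G) x * h x \<partial>M\<Omega>)) \<longleftrightarrow>
      (D.re_part (Re z - 1) (Im z) (Re \<circ> F) (Im \<circ> F) h = - (\<integral>x. (Re \<circ> w) x * h x \<partial>M\<Omega>) \<and>
        D.im_part (Re z - 1) (Im z) (Re \<circ> F) (Im \<circ> F) h = - (\<integral>x. (Im \<circ> w) x * h x \<partial>M\<Omega>))"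
      unfolding int_G[OF h] dirichlet_form_energy D.re_part_def D.im_part_def left_diff_distrib by linarith
  qed
  finally show ?thesis by (simp add: G_def)
qed

lemma norm_integral_\<Omega>_le:
  assumes u: "u \<in> L2 M\<Omega>" and h: "h \<in> D"
  shows "\<bar>\<integral>x. u x * h x \<partial>M\<Omega>\<bar> \<le> L2norm M\<Omega> u * W.nrm h"
proof -
  have "\<bar>L2_inner M\<Omega> u h\<bar> \<le> L2norm M\<Omega> u * L2norm M\<Omega> h"
    by (intro L2_inner_Cauchy_Schwarz u D_L2_\<Omega>(1)[OF h])
  also have "\<dots> \<le> L2norm M\<Omega> u * W.nrm h"
    using L2norm_le_nrm[OF D_W12[OF h]] D_L2_\<Omega>(2)[OF h] by (intro mult_left_mono L2norm_nonneg) simp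
  finally show ?thesis by (simp add: L2_inner_def)
qed

text \<open>An eigenfunction violates the first clause of the resolvent set. Conversely, if z is no
  eigenvalue, solutions of the homogeneous weak equation have zero energy, and
  \<open>complex_fredholm\<close> at z - 1 delivers the second and third clause.\<close>

theorem spectrum_eq_point_spectrum: "spectrum M\<Omega> \<L> = point_spectrum M\<Omega> \<L>"
proof (intro equalityI subsetI)
  fix z assume "z \<in> point_spectrum M\<Omega> \<L>"
  then obtain F G where FG: "(F, G) \<in> \<L>" "\<not> (AE x in M\<Omega>. F x = 0)" "AE x in M\<Omega>. G x = z * F x"
    by (auto simp: point_spectrum_def)
  have "AE x in M\<Omega>. G x - z * F x = 0" using FG(3) by eventually_elim simp
  then show "z \<in> spectrum M\<Omega> \<L>"
    using FG(1,2) by (auto simp: spectrum_def resolvent_set_def)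
next
  fix z assume z: "z \<in> spectrum M\<Omega> \<L>"
  show "z \<in> point_spectrum M\<Omega> \<L>"
  proof (rule ccontr)
    assume no_eigenvalue: "z \<notin> point_spectrum M\<Omega> \<L>"
    have no_eigenfunction: "AE x in M\<Omega>. F x = 0" if FG: "(F, G) \<in> \<L>" "AE x in M\<Omega>. G x = z * F x" for F G
    proof (rule ccontr)
      assume "\<not> (AE x in M\<Omega>. F x = 0)"
      then have "z \<in> point_spectrum M\<Omega> \<L>"
        unfolding point_spectrum_def mem_Collect_eq using FG by (intro bexI[OF _ FG(1)]) simp
      with no_eigenvalue show False by contradiction
    qed
    let ?\<alpha> = "Re z - 1" and ?\<beta> = "Im z"
    have inj: "energy f f = 0 \<and> energy k k = 0"
      if f: "f \<in> D" and k: "k \<in> D" and re: "\<And>h. h \<in> D \<Longrightarrow> D.re_part ?\<alpha> ?\<beta> f k h = 0"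
        and im: "\<And>h. h \<in> D \<Longrightarrow> D.im_part ?\<alpha> ?\<beta> f k h = 0" for f k
    proof -
      define F where "F x = Complex (f x) (k x)" for x
      have F: "Re \<circ> F = f" "Im \<circ> F = k" by (auto simp: F_def)
      have zero: "(\<lambda>x. 0::complex) \<in> L2 M\<Omega>" by (simp add: L2_def)
      have "(F, \<lambda>x. z * F x + 0) \<in> \<L>"
        by (subst weak_equation[OF _ _ zero]) (use f k re im in \<open>auto simp: F\<close>)
      from no_eigenfunction[OF this] have "AE x in M\<Omega>. F x = 0" by simp
      then have "AE x in lborel. x \<in> \<Omega> \<longrightarrow> F x = 0"
        using \<Omega>_sets by (simp add: AE_restrict_space_iff)
      then have ae: "AE x in lborel. f x = 0 \<and> k x = 0"
        using D_vanish[OF f] D_vanish[OF k]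
        by eventually_elim (auto simp: F_def complex_eq_iff)
      \<comment> \<open>That f and k vanish almost everywhere says nothing directly about the chosen
        derivatives. Their energy is read off from the equations tested with f and k, where the
        \<open>L2\<close> terms drop out.\<close>
      have zero: "L2_inner lborel f h = 0" "L2_inner lborel k h = 0" for h
        unfolding L2_inner_def by (rule integral_eq_zero_AE, use ae in eventually_elim, simp)+
      show ?thesis
        using re[OF f] im[OF k] by (simp add: D.re_part_def D.im_part_def zero)
    qed
    note fredholm = D.complex_fredholm[of ?\<alpha> ?\<beta>, OF inj]
    obtain C where C: "0 \<le> C" "\<forall>f\<in>D. \<forall>k\<in>D. \<forall>K\<ge>0.
        (\<forall>h\<in>D. \<bar>D.re_part ?\<alpha> ?\<beta> f k h\<bar> \<le> K * W.nrm h \<and> \<bar>D.im_part ?\<alpha> ?\<beta> f k h\<bar> \<le> K * W.nrm h) \<longrightarrow>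
        W.nrm f \<le> C * K \<and> W.nrm k \<le> C * K"
      using fredholm(1) by blast
    have "z \<in> resolvent_set M\<Omega> \<L>"
      unfolding resolvent_set_def mem_Collect_eq
    proof (intro conjI ballI)
      fix p assume p: "p \<in> \<L>"
      obtain F G where FG: "p = (F, G)" by fastforce
      have "AE x in M\<Omega>. F x = 0" if "AE x in M\<Omega>. G x - z * F x = 0"
        by (rule no_eigenfunction[of F G]) (use p FG that in auto)
      then show "case p of (f, g) \<Rightarrow> (AE x in M\<Omega>. g x - z * f x = 0) \<longrightarrow> (AE x in M\<Omega>. f x = 0)"
        using FG by simp
    next
      fix u :: "real^'n \<Rightarrow> complex" assume u: "u \<in> L2 M\<Omega>"
      have u': "(Re \<circ> u) \<in> L2 M\<Omega>" "(Im \<circ> u) \<in> L2 M\<Omega>" using u L2_complex(1)[of u] by auto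
      let ?F = "\<lambda>h. - L2_inner M\<Omega> (Re \<circ> u) h" and ?G = "\<lambda>h. - L2_inner M\<Omega> (Im \<circ> u) h"
      have "\<exists>f\<in>D. \<exists>k\<in>D. \<forall>h\<in>D. D.re_part ?\<alpha> ?\<beta> f k h = ?F h \<and> D.im_part ?\<alpha> ?\<beta> f k h = ?G h"
      proof (rule fredholm(2)[where A = "L2norm M\<Omega> (Re \<circ> u) + L2norm M\<Omega> (Im \<circ> u)"])
        fix x assume x: "x \<in> D"
        have "0 \<le> L2norm M\<Omega> (Re \<circ> u) * W.nrm x" "0 \<le> L2norm M\<Omega> (Im \<circ> u) * W.nrm x"
          using W.nrm_nonneg[OF D_W12[OF x]] by (auto intro!: mult_nonneg_nonneg L2norm_nonneg)
        then show "\<bar>?F x\<bar> \<le> (L2norm M\<Omega> (Re \<circ> u) + L2norm M\<Omega> (Im \<circ> u)) * W.nrm x"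
          "\<bar>?G x\<bar> \<le> (L2norm M\<Omega> (Re \<circ> u) + L2norm M\<Omega> (Im \<circ> u)) * W.nrm x"
          using norm_integral_\<Omega>_le[OF u'(1) x] norm_integral_\<Omega>_le[OF u'(2) x]
          by (simp_all add: L2_inner_def distrib_right)
      qed (use u' in \<open>auto simp: L2.bilinear D_L2_\<Omega> L2norm_nonneg\<close>)
      then obtain f k where fk: "f \<in> D" "k \<in> D"
        "\<And>h. h \<in> D \<Longrightarrow> D.re_part ?\<alpha> ?\<beta> f k h = ?F h \<and> D.im_part ?\<alpha> ?\<beta> f k h = ?G h" by blast
      define F where "F x = Complex (f x) (k x)" for x
      have F: "Re \<circ> F = f" "Im \<circ> F = k" by (auto simp: F_def)
      have "(F, \<lambda>x. z * F x + u x) \<in> \<L>"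
        by (subst weak_equation[OF _ _ u]) (use fk in \<open>auto simp: F L2_inner_def\<close>)
      then show "\<exists>(f, g)\<in>\<L>. AE x in M\<Omega>. g x - z * f x = u x"
        by (intro bexI[of _ "(F, \<lambda>x. z * F x + u x)"]) auto
    next
      show "\<exists>C. \<forall>(f, g)\<in>\<L>. L2norm M\<Omega> f \<le> C * L2norm M\<Omega> (\<lambda>x. g x - z * f x)"
      \<comment> \<open>The factor 2 adds the bounds for the real and the imaginary part.\<close>
      proof (rule exI[of _ "2 * C"], intro ballI)
        fix p assume p: "p \<in> \<L>"
        obtain F G where FG: "p = (F, G)" by fastforce
        define w where "w = (\<lambda>x. G x - z * F x)"
        have F: "(Re \<circ> F) \<in> D" "(Im \<circ> F) \<in> D" and G: "G \<in> L2 M\<Omega>" using p FG by (auto simp: complex_laplacian_iff)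
        have F': "(Re \<circ> F) \<in> L2 M\<Omega>" "(Im \<circ> F) \<in> L2 M\<Omega>" using D_L2_\<Omega>(1) F by auto
        have "Re \<circ> w = (Re \<circ> G) - (Re z *\<^sub>R (Re \<circ> F) - Im z *\<^sub>R (Im \<circ> F))"
          "Im \<circ> w = (Im \<circ> G) - (Re z *\<^sub>R (Im \<circ> F) + Im z *\<^sub>R (Re \<circ> F))"
          by (auto simp: w_def fun_eq_iff)
        then have w: "w \<in> L2 M\<Omega>"
          unfolding L2_complex(1)[of w] using F' G L2_complex(1)[of G] by (auto intro!: L2.mem)
        have "(F, \<lambda>x. z * F x + w x) \<in> \<L>" using p FG by (simp add: w_def)
        then have eqs: "D.re_part ?\<alpha> ?\<beta> (Re \<circ> F) (Im \<circ> F) h = - (\<integral>x. (Re \<circ> w) x * h x \<partial>M\<Omega>)"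
          "D.im_part ?\<alpha> ?\<beta> (Re \<circ> F) (Im \<circ> F) h = - (\<integral>x. (Im \<circ> w) x * h x \<partial>M\<Omega>)" if "h \<in> D" for h
          using weak_equation[OF F w] that by auto
        have part: "L2norm M\<Omega> (Re \<circ> w) \<le> L2norm M\<Omega> w" "L2norm M\<Omega> (Im \<circ> w) \<le> L2norm M\<Omega> w"
          by (rule power2_le_imp_le; simp add: L2_complex(2)[OF w] L2norm_nonneg)+
        have w': "(Re \<circ> w) \<in> L2 M\<Omega>" "(Im \<circ> w) \<in> L2 M\<Omega>" using w L2_complex(1)[of w] by auto
        have "\<bar>D.re_part ?\<alpha> ?\<beta> (Re \<circ> F) (Im \<circ> F) h\<bar> \<le> L2norm M\<Omega> w * W.nrm h \<and>
            \<bar>D.im_part ?\<alpha> ?\<beta> (Re \<circ> F) (Im \<circ> F) h\<bar> \<le> L2norm M\<Omega> w * W.nrm h" if h: "h \<in> D" for h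
          unfolding eqs[OF h] abs_minus_cancel
          using order_trans[OF norm_integral_\<Omega>_le[OF w'(1) h] mult_right_mono[OF part(1) W.nrm_nonneg[OF D_W12[OF h]]]]
            order_trans[OF norm_integral_\<Omega>_le[OF w'(2) h] mult_right_mono[OF part(2) W.nrm_nonneg[OF D_W12[OF h]]]]
          by blast
        then have "W.nrm (Re \<circ> F) \<le> C * L2norm M\<Omega> w \<and> W.nrm (Im \<circ> F) \<le> C * L2norm M\<Omega> w"
          using C(2)[rule_format, OF F L2norm_nonneg[of M\<Omega> w]] by blast
        then have le: "L2norm M\<Omega> (Re \<circ> F) \<le> C * L2norm M\<Omega> w" "L2norm M\<Omega> (Im \<circ> F) \<le> C * L2norm M\<Omega> w"
          using L2norm_le_nrm[OF D_W12[OF F(1)]] L2norm_le_nrm[OF D_W12[OF F(2)]] D_L2_\<Omega>(2)[OF F(1)] D_L2_\<Omega>(2)[OF F(2)]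
          by simp_all
        have "F \<in> L2 M\<Omega>" using F' L2_complex(1)[of F] by simp
        from real_sqrt_unique[OF L2_complex(2)[OF this] L2norm_nonneg]
        have "L2norm M\<Omega> F = sqrt ((L2norm M\<Omega> (Re \<circ> F))\<^sup>2 + (L2norm M\<Omega> (Im \<circ> F))\<^sup>2)"
          by simp
        also have "\<dots> \<le> L2norm M\<Omega> (Re \<circ> F) + L2norm M\<Omega> (Im \<circ> F)"
          by (rule sqrt_sum_squares_le_sum) (simp_all add: L2norm_nonneg)
        finally have "L2norm M\<Omega> F \<le> 2 * C * L2norm M\<Omega> w" using le by simp
        then show "case p of (f, g) \<Rightarrow> L2norm M\<Omega> f \<le> 2 * C * L2norm M\<Omega> (\<lambda>x. g x - z * f x)"
          by (simp add: FG w_def)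
      qed
    qed
    then show False using z by (simp add: spectrum_def)
  qed
qed

end

theorem corollary3p4:
  fixes star :: "real^'n \<Rightarrow> real^'n \<Rightarrow> real^'n"
    and ginv :: "real^'n \<Rightarrow> real^'n"
    and wt :: "'n \<Rightarrow> nat"
    and r :: nat
    and ip :: "real^'n \<Rightarrow> real^'n \<Rightarrow> real"
    and B :: "(real^'n) set"
    and \<Omega> :: "(real^'n) set"
  assumes "homogeneous_carnot_group star ginv wt r"
    and "inner_product_on (layer wt 1) ip"
    and "orthonormal_basis_of (layer wt 1) ip B"
    and "\<Omega> \<noteq> {}" and "bounded \<Omega>" and "open \<Omega>" and "connected \<Omega>"
  shows "spectrum (restrict_space lborel \<Omega>) (complexification (dirichlet_sub_laplacian star B \<Omega>)) =
    point_spectrum (restrict_space lborel \<Omega>) (complexification (dirichlet_sub_laplacian star B \<Omega>))"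
proof -
  interpret homogeneous_carnot_group star ginv wt r by fact
  \<comment> \<open>Finiteness of \<open>B\<close> comes from independence in a finite-dimensional
    space.\<close>
  interpret dirichlet_problem star ginv wt r B \<Omega>
    by unfold_locales (use assms in \<open>auto simp: orthonormal_basis_of_def independent_imp_finite\<close>)
  show ?thesis by (rule spectrum_eq_point_spectrum)
qed

end
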